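(* Let $\mathcal{Q}=(\Delta,\sigma,\xi)$ be any Q-datum for $\mathfrak{g}$, let $i,j\in I$, $\imath\in i$, $\jmath\in j$ and $u\in\mathbb{Z}_{\ge0}$. Then $$\widetilde c_{ij}(u)=\begin{cases}\bigl(\varpi_\imath,\ \tau_{\mathcal{Q}}^{(u+\xi_\jmath-\xi_\imath-d_i)/2}(\gamma^{\mathcal{Q}}_\jmath)\bigr)&\text{if }u+\xi_\jmath-\xi_\imath-d_i\in2\mathbb{Z},\\0&\text{otherwise.}\end{cases}$$
   Context: Basic notation. Let $\mathsf{g}$ be a finite-dimensional complex simple Lie algebra of type ADE with Dynkin diagram $\Delta$ (vertex set $\Delta_0$; $\imath\sim\jmath$ means adjacent). $\mathsf{P}=\bigoplus_{\imath\in\Delta_0}\mathbb{Z}\varpi_\imath$ is the weight lattice, $\alpha_\imath$ the simple roots, $(\cdot,\cdot):\mathsf{P}\times\mathsf{P}\to\mathbb{Q}$ the symmetric form with $(\varpi_\imath,\alpha_\jmath)=\delta_{\imath\jmath}$, $\mathsf{W}\subset\mathrm{Aut}(\mathsf{P})$ the Weyl group generated by $s_\imath(\lambda)=\lambda-(\lambda,\alpha_\imath)\alpha_\imath$. Let $\sigma$ be an automorphism of $\Delta$ such that there is no $\imath$ with $\imath\sim\sigma(\imath)$, and let $r\in\{1,2,3\}$ be its order; $\sigma$ acts on $\mathsf{P}$ by $\sigma(\varpi_\imath)=\varpi_{\sigma(\imath)}$. Let $I$ be the set of $\sigma$-orbits in $\Delta_0$, $\imath\mapsto\bar\imath$ the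 quotient map, $d_i=|i|\in\{1,r\}$ for $i\in I$. Write $i\sim j$ in $I$ if some representatives are adjacent; put $c_{ii}=2$, $c_{ij}=-\lceil d_j/d_i\rceil$ if $i\sim j$, $c_{ij}=0$ otherwise. Then $(c_{ij})$ is the Cartan matrix of a complex simple Lie algebra $\mathfrak{g}$; every such $\mathfrak{g}$ arises so: $\sigma=\mathrm{id}$ and $\mathfrak{g}=\mathsf{g}$ if simply-laced, otherwise $(\mathsf{g},r,\mathfrak{g})=(A_{2n-1},2,B_n),(D_{n+1},2,C_n),(E_6,2,F_4),(D_4,3,G_2)$. The pair $(\Delta,\sigma)$ is fixed. Q-data. A height function on $(\Delta,\sigma)$ is a function $\xi:\Delta_0\to\mathbb{Z}$, $\imath\mapsto\xi_\imath$, such that (a) $|\xi_\imath-\xi_\jmath|=d_{\bar\imath}$ whenever $\imath\sim\jmath$ and $d_{\bar\imath}=d_{\bar\jmath}$; (b) for $i,j\in I$ with $i\sim j$ and $d_i<d_j$ (so $d_i=1$, $d_j=r$, $i=\{\imath\}$), there is a unique $j^\circ\in j$ with $|\xi_\imath-\xi_{j^\circ}|=1$ and $\xi_{\sigma^l(j^\circ)}=\xi_{j^\circ}-2l$ for $0\le l<r$. A Q-datum for $\mathfrak{g}$ is a triple $\mathcal{Q}=(\Delta,\sigma,\xi)$ with $\xi$ a height function. Fix once and for all a $\sigma$-parity function: integers $\epsilon_\imath$, $0\le\epsilon_\imath<2d_{\bar\imath}$, with $\epsilon_{\imath}\equiv\epsilon_{\imath'}\pmod 2$ if $\bar\imath=\bar\imath'$;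 $\epsilon_{\sigma^l(\imath)}\equiv\epsilon_\imath-2l\pmod{2d_{\bar\imath}}$ for $l\in\mathbb{Z}$; and $\epsilon_\imath\equiv\epsilon_\jmath+\min(d_{\bar\imath},d_{\bar\jmath})\pmod{2\min(d_{\bar\imath},d_{\bar\jmath})}$ if $\imath\sim\jmath$. All height functions are required to satisfy in addition (c) $\xi_\imath-\epsilon_\imath\in2d_{\bar\imath}\mathbb{Z}$ for all $\imath$ (achievable by adding a constant). Repetition quiver. $\widehat\Delta^\sigma$ has vertex set $\widehat\Delta^\sigma_0=\{(\imath,p)\in\Delta_0\times\mathbb{Z}\mid p-\epsilon_\imath\in2d_{\bar\imath}\mathbb{Z}\}$ and an arrow $(\imath,p)\to(\jmath,s)$ whenever $\imath\sim\jmath$ and $s-p=\min(d_{\bar\imath},d_{\bar\jmath})$; $\pi(\imath,p)=\imath$. For a finite $X\subset\widehat\Delta^\sigma_0$, a compatible reading is a total ordering $(x_1,\dots,x_l)$ of $X$ with $k<k'$ whenever there is an arrow $x_{k'}\to x_k$; put $w[X]=s_{\pi(x_1)}\cdots s_{\pi(x_l)}\in\mathsf{W}$ (independent of the reading). Generalized twisted Coxeter element. For $i\in I$ let $i^\circ\in i$ be the unique element with $\xi_{i^\circ}=\max\{\xi_\imath\mid\imath\in i\}$. Put $X^\circ_{\mathcal{Q}}=\{(i^\circ,\xi_{i^\circ})\mid i\in I\}$, $\tau^\circ_{\mathcal{Q}}=w[X^\circ_{\mathcal{Q}}]\sigma$, $X'_{\mathcal{Q}}=\{(\sigma(i^\circ),p)\in\widehat\Delta^\sigma_0\mid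 i\in I,\ \xi_{\sigma(i^\circ)}<p\le\xi_{i^\circ}-2\}$, and $\tau_{\mathcal{Q}}=w[X'_{\mathcal{Q}}]^{-1}\,\tau^\circ_{\mathcal{Q}}\,w[X'_{\mathcal{Q}}]\in\mathsf{W}\sigma$. For $\imath\in\Delta_0$ put $\gamma^{\mathcal{Q}}_\imath=(1-\tau_{\mathcal{Q}}^{d_{\bar\imath}})\varpi_\imath$. Quantum Cartan matrix. $C(z)=(C_{ij}(z))_{i,j\in I}$ with $C_{ii}(z)=z^{d_i}+z^{-d_i}$ and $C_{ij}(z)=[c_{ij}]_z$ for $i\ne j$, where $[k]_z=(z^k-z^{-k})/(z-z^{-1})$. It is invertible over $\mathbb{Q}(z)$; $\widetilde C(z)=(\widetilde C_{ij}(z))=C(z)^{-1}$ and $\widetilde C_{ij}(z)=\sum_{u\in\mathbb{Z}}\widetilde c_{ij}(u)z^u$ is the formal Laurent expansion at $z=0$. *)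

theory Defs
  imports
    "HOL-Analysis.Finite_Cartesian_Product"
    "HOL-Combinatorics.Orbits"
    "HOL-Computational_Algebra.Computational_Algebra"
    "HOL-Computational_Algebra.Field_as_Ring"
    "HOL-Number_Theory.Cong"
begin

section \<open>Simply-laced Dynkin diagrams\<close>

text \<open>The vertex set is a finite type \<open>'v\<close> and a diagram is an adjacency relation on it. The
  model graphs have vertices \<open>1, \<dots>, n\<close>; each edge is listed in one direction. Type E follows
  Bourbaki's labelling (the vertex 2 is attached to the vertex 4).\<close>

definition edges_A :: "nat \<Rightarrow> (nat \<times> nat) set" where
  "edges_A n = {(k, k + 1) |k. 1 \<le> k \<and> k < n}"

definition edges_D :: "nat \<Rightarrow> (nat \<times> nat) set" where
  "edges_D n = insert (n - 2, n) {(k, k + 1) |k. 1 \<le> k \<and> k < n - 1}"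

definition edges_E :: "nat \<Rightarrow> (nat \<times> nat) set" where
  "edges_E n = {(1, 3), (2, 4)} \<union> {(k, k + 1) |k. 3 \<le> k \<and> k < n}"

definition graph_iso_to :: "('v \<Rightarrow> 'v \<Rightarrow> bool) \<Rightarrow> nat \<Rightarrow> (nat \<times> nat) set \<Rightarrow> bool" where
  "graph_iso_to adj n E \<longleftrightarrow>
     (\<exists>f. bij_betw f UNIV {1..n} \<and> (\<forall>x y. adj x y \<longleftrightarrow> (f x, f y) \<in> E \<or> (f y, f x) \<in> E))"

definition ADE_diagram :: "('v::finite \<Rightarrow> 'v \<Rightarrow> bool) \<Rightarrow> bool" where
  "ADE_diagram adj \<longleftrightarrow>
     (\<exists>n\<ge>1. graph_iso_to adj n (edges_A n)) \<or>
     (\<exists>n\<ge>4. graph_iso_to adj n (edges_D n)) \<or>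
     (\<exists>n\<in>{6, 7, 8}. graph_iso_to adj n (edges_E n))"

definition admissible_automorphism :: "('v \<Rightarrow> 'v \<Rightarrow> bool) \<Rightarrow> ('v \<Rightarrow> 'v) \<Rightarrow> bool" where
  "admissible_automorphism adj \<sigma> \<longleftrightarrow>
     bij \<sigma> \<and> (\<forall>x y. adj (\<sigma> x) (\<sigma> y) \<longleftrightarrow> adj x y) \<and> (\<forall>x. \<not> adj x (\<sigma> x))"

definition aut_order :: "('v \<Rightarrow> 'v) \<Rightarrow> nat" where
  "aut_order \<sigma> = (LEAST r. 0 < r \<and> \<sigma> ^^ r = id)"

text \<open>Integer powers of a bijection under composition.\<close>

definition int_funpow :: "('a \<Rightarrow> 'a) \<Rightarrow> int \<Rightarrow> 'a \<Rightarrow> 'a" where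
  "int_funpow f k = (if 0 \<le> k then f ^^ nat k else inv f ^^ nat (- k))"


section \<open>Weight lattice and Weyl group\<close>

text \<open>An element \<open>\<lambda>\<close> of the weight lattice is the vector of its coordinates in the basis of
  fundamental weights.\<close>

type_synonym 'v weight = "int ^ 'v"

definition fund_weight :: "'v::finite \<Rightarrow> 'v weight" where
  "fund_weight x = axis x 1"

text \<open>The columns of the Cartan matrix: \<open>\<alpha>\<^sub>x = 2 \<varpi>\<^sub>x - (\<Sum>y \<sim> x. \<varpi>\<^sub>y)\<close>.\<close>

definition simple_root :: "('v::finite \<Rightarrow> 'v \<Rightarrow> bool) \<Rightarrow> 'v \<Rightarrow> 'v weight" where
  "simple_root adj x = 2 *s fund_weight x - (\<Sum>y | adj x y. fund_weight y)"

definition weight_form :: "('v::finite \<Rightarrow> 'v \<Rightarrow> bool) \<Rightarrow> 'v weight \<Rightarrow> 'v weight \<Rightarrow> rat" where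
  "weight_form adj = (THE B.
     (\<forall>v w. B v w = B w v) \<and>
     (\<forall>u v w. B (u + v) w = B u w + B v w) \<and>
     (\<forall>x y. B (fund_weight x) (simple_root adj y) = (if x = y then 1 else 0)))"

text \<open>The coordinate \<open>v $ x\<close> is the (integral) value of the form at \<open>v\<close> and \<open>\<alpha>\<^sub>x\<close>.\<close>

definition reflection :: "('v::finite \<Rightarrow> 'v \<Rightarrow> bool) \<Rightarrow> 'v \<Rightarrow> 'v weight \<Rightarrow> 'v weight" where
  "reflection adj x v = v - (v $ x) *s simple_root adj x"

definition weight_aut :: "('v::finite \<Rightarrow> 'v) \<Rightarrow> 'v weight \<Rightarrow> 'v weight" where
  "weight_aut \<sigma> v = (\<Sum>x\<in>UNIV. (v $ x) *s fund_weight (\<sigma> x))"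


section \<open>Folding\<close>

definition orbits :: "('v \<Rightarrow> 'v) \<Rightarrow> 'v set set" where
  "orbits \<sigma> = range (orbit \<sigma>)"

abbreviation orbit_size :: "('v \<Rightarrow> 'v) \<Rightarrow> 'v \<Rightarrow> int" where
  "orbit_size \<sigma> x \<equiv> int (card (orbit \<sigma> x))"

definition orbit_adj :: "('v \<Rightarrow> 'v \<Rightarrow> bool) \<Rightarrow> 'v set \<Rightarrow> 'v set \<Rightarrow> bool" where
  "orbit_adj adj i j \<longleftrightarrow> (\<exists>x\<in>i. \<exists>y\<in>j. adj x y)"

definition folded_cartan :: "('v \<Rightarrow> 'v \<Rightarrow> bool) \<Rightarrow> 'v set \<Rightarrow> 'v set \<Rightarrow> int" where
  "folded_cartan adj i j =
     (if i = j then 2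
      else if orbit_adj adj i j then - \<lceil>of_nat (card j) / of_nat (card i) :: rat\<rceil>
      else 0)"


section \<open>Q-data\<close>

definition parity_function ::
    "('v::finite \<Rightarrow> 'v \<Rightarrow> bool) \<Rightarrow> ('v \<Rightarrow> 'v) \<Rightarrow> ('v \<Rightarrow> int) \<Rightarrow> bool" where
  "parity_function adj \<sigma> \<epsilon> \<longleftrightarrow>
     (\<forall>x. 0 \<le> \<epsilon> x \<and> \<epsilon> x < 2 * orbit_size \<sigma> x) \<and>
     (\<forall>x y. orbit \<sigma> x = orbit \<sigma> y \<longrightarrow> [\<epsilon> x = \<epsilon> y] (mod 2)) \<and>
     (\<forall>x l. [\<epsilon> (int_funpow \<sigma> l x) = \<epsilon> x - 2 * l] (mod (2 * orbit_size \<sigma> x))) \<and>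
     (\<forall>x y. adj x y \<longrightarrow>
        [\<epsilon> x = \<epsilon> y + min (orbit_size \<sigma> x) (orbit_size \<sigma> y)]
          (mod (2 * min (orbit_size \<sigma> x) (orbit_size \<sigma> y))))"

definition height_function ::
    "('v::finite \<Rightarrow> 'v \<Rightarrow> bool) \<Rightarrow> ('v \<Rightarrow> 'v) \<Rightarrow> ('v \<Rightarrow> int) \<Rightarrow> ('v \<Rightarrow> int) \<Rightarrow> bool" where
  "height_function adj \<sigma> \<epsilon> \<xi> \<longleftrightarrow>
     (\<forall>x y. adj x y \<and> orbit_size \<sigma> x = orbit_size \<sigma> y \<longrightarrow> \<bar>\<xi> x - \<xi> y\<bar> = orbit_size \<sigma> x) \<and>
     (\<forall>i\<in>orbits \<sigma>. \<forall>j\<in>orbits \<sigma>. orbit_adj adj i j \<and> card i < card j \<longrightarrow>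
        (\<forall>x\<in>i. \<exists>!y. y \<in> j \<and> \<bar>\<xi> x - \<xi> y\<bar> = 1 \<and>
           (\<forall>l<aut_order \<sigma>. \<xi> ((\<sigma> ^^ l) y) = \<xi> y - 2 * int l))) \<and>
     (\<forall>x. 2 * orbit_size \<sigma> x dvd \<xi> x - \<epsilon> x)"


section \<open>Repetition quiver\<close>

definition rep_vertices :: "('v \<Rightarrow> 'v) \<Rightarrow> ('v \<Rightarrow> int) \<Rightarrow> ('v \<times> int) set" where
  "rep_vertices \<sigma> \<epsilon> = {(x, p). 2 * orbit_size \<sigma> x dvd p - \<epsilon> x}"

definition rep_arrow :: "('v \<Rightarrow> 'v \<Rightarrow> bool) \<Rightarrow> ('v \<Rightarrow> 'v) \<Rightarrow> ('v \<Rightarrow> int) \<Rightarrow> 'v \<times> int \<Rightarrow> 'v \<times> int \<Rightarrow> bool"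
where
  "rep_arrow adj \<sigma> \<epsilon> a b \<longleftrightarrow>
     a \<in> rep_vertices \<sigma> \<epsilon> \<and> b \<in> rep_vertices \<sigma> \<epsilon> \<and> adj (fst a) (fst b) \<and>
     snd b - snd a = min (orbit_size \<sigma> (fst a)) (orbit_size \<sigma> (fst b))"

definition compatible_reading ::
    "('v \<Rightarrow> 'v \<Rightarrow> bool) \<Rightarrow> ('v \<Rightarrow> 'v) \<Rightarrow> ('v \<Rightarrow> int) \<Rightarrow> ('v \<times> int) set \<Rightarrow> ('v \<times> int) list \<Rightarrow> bool" where
  "compatible_reading adj \<sigma> \<epsilon> X xs \<longleftrightarrow>
     distinct xs \<and> set xs = X \<and>
     (\<forall>k<length xs. \<forall>k'<length xs. rep_arrow adj \<sigma> \<epsilon> (xs ! k') (xs ! k) \<longrightarrow> k < k')"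

text \<open>The product of reflections along some compatible reading; for finite \<open>X\<close> compatible readings
  exist and the product does not depend on the chosen one.\<close>

definition weyl_word ::
    "('v::finite \<Rightarrow> 'v \<Rightarrow> bool) \<Rightarrow> ('v \<Rightarrow> 'v) \<Rightarrow> ('v \<Rightarrow> int) \<Rightarrow> ('v \<times> int) set \<Rightarrow> 'v weight \<Rightarrow> 'v weight"
where
  "weyl_word adj \<sigma> \<epsilon> X =
     foldr (\<lambda>a w. reflection adj (fst a) \<circ> w) (SOME xs. compatible_reading adj \<sigma> \<epsilon> X xs) id"


section \<open>Generalized twisted Coxeter elements\<close>

definition orbit_top :: "('v \<Rightarrow> int) \<Rightarrow> 'v set \<Rightarrow> 'v" where
  "orbit_top \<xi> i = (THE x. x \<in> i \<and> \<xi> x = Max (\<xi> ` i))"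

definition X_circ :: "('v \<Rightarrow> 'v) \<Rightarrow> ('v \<Rightarrow> int) \<Rightarrow> ('v \<times> int) set" where
  "X_circ \<sigma> \<xi> = {(orbit_top \<xi> i, \<xi> (orbit_top \<xi> i)) |i. i \<in> orbits \<sigma>}"

definition tau_circ ::
    "('v::finite \<Rightarrow> 'v \<Rightarrow> bool) \<Rightarrow> ('v \<Rightarrow> 'v) \<Rightarrow> ('v \<Rightarrow> int) \<Rightarrow> ('v \<Rightarrow> int) \<Rightarrow> 'v weight \<Rightarrow> 'v weight"
where
  "tau_circ adj \<sigma> \<epsilon> \<xi> = weyl_word adj \<sigma> \<epsilon> (X_circ \<sigma> \<xi>) \<circ> weight_aut \<sigma>"

definition X_prime :: "('v \<Rightarrow> 'v) \<Rightarrow> ('v \<Rightarrow> int) \<Rightarrow> ('v \<Rightarrow> int) \<Rightarrow> ('v \<times> int) set" where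
  "X_prime \<sigma> \<epsilon> \<xi> =
     {(\<sigma> (orbit_top \<xi> i), p) |i p.
        i \<in> orbits \<sigma> \<and> (\<sigma> (orbit_top \<xi> i), p) \<in> rep_vertices \<sigma> \<epsilon> \<and>
        \<xi> (\<sigma> (orbit_top \<xi> i)) < p \<and> p \<le> \<xi> (orbit_top \<xi> i) - 2}"

definition twisted_coxeter ::
    "('v::finite \<Rightarrow> 'v \<Rightarrow> bool) \<Rightarrow> ('v \<Rightarrow> 'v) \<Rightarrow> ('v \<Rightarrow> int) \<Rightarrow> ('v \<Rightarrow> int) \<Rightarrow> 'v weight \<Rightarrow> 'v weight"
where
  "twisted_coxeter adj \<sigma> \<epsilon> \<xi> =
     inv (weyl_word adj \<sigma> \<epsilon> (X_prime \<sigma> \<epsilon> \<xi>)) \<circ> tau_circ adj \<sigma> \<epsilon> \<xi> \<circ>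
     weyl_word adj \<sigma> \<epsilon> (X_prime \<sigma> \<epsilon> \<xi>)"

definition gamma_weight ::
    "('v::finite \<Rightarrow> 'v \<Rightarrow> bool) \<Rightarrow> ('v \<Rightarrow> 'v) \<Rightarrow> ('v \<Rightarrow> int) \<Rightarrow> ('v \<Rightarrow> int) \<Rightarrow> 'v \<Rightarrow> 'v weight" where
  "gamma_weight adj \<sigma> \<epsilon> \<xi> x =
     fund_weight x - (twisted_coxeter adj \<sigma> \<epsilon> \<xi> ^^ card (orbit \<sigma> x)) (fund_weight x)"


section \<open>Inverse quantum Cartan matrix\<close>

text \<open>The field \<open>\<rat>(z)\<close> is \<open>rat poly fract\<close>.\<close>

definition zvar :: "rat poly fract" where
  "zvar = to_fract [:0, 1:]"

definition quantum_int :: "int \<Rightarrow> rat poly fract" where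
  "quantum_int k = (zvar powi k - zvar powi (- k)) / (zvar - zvar powi (- 1))"

definition quantum_cartan :: "('v \<Rightarrow> 'v \<Rightarrow> bool) \<Rightarrow> 'v set \<Rightarrow> 'v set \<Rightarrow> rat poly fract" where
  "quantum_cartan adj i j =
     (if i = j then zvar powi int (card i) + zvar powi (- int (card i))
      else quantum_int (folded_cartan adj i j))"

text \<open>The two-sided inverse of a matrix with rows and columns indexed by the finite set \<open>I\<close>,
  extended by zero outside \<open>I\<close> to make it unique.\<close>

definition inverse_matrix_on :: "'i set \<Rightarrow> ('i \<Rightarrow> 'i \<Rightarrow> 'a::field) \<Rightarrow> 'i \<Rightarrow> 'i \<Rightarrow> 'a" where
  "inverse_matrix_on I A = (THE B.
     (\<forall>i j. i \<notin> I \<or> j \<notin> I \<longrightarrow> B i j = 0) \<and>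
     (\<forall>i\<in>I. \<forall>j\<in>I. (\<Sum>k\<in>I. A i k * B k j) = (if i = j then 1 else 0)) \<and>
     (\<forall>i\<in>I. \<forall>j\<in>I. (\<Sum>k\<in>I. B i k * A k j) = (if i = j then 1 else 0)))"

definition quantum_cartan_inv ::
    "('v \<Rightarrow> 'v \<Rightarrow> bool) \<Rightarrow> ('v \<Rightarrow> 'v) \<Rightarrow> 'v set \<Rightarrow> 'v set \<Rightarrow> rat poly fract" where
  "quantum_cartan_inv adj \<sigma> = inverse_matrix_on (orbits \<sigma>) (quantum_cartan adj)"

text \<open>Expansion at \<open>z = 0\<close>: numerator divided by denominator in the field of formal Laurent series.\<close>

definition laurent_at_0 :: "rat poly fract \<Rightarrow> rat fls" where
  "laurent_at_0 f =
     fps_to_fls (fps_of_poly (fst (quot_of_fract f))) /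
     fps_to_fls (fps_of_poly (snd (quot_of_fract f)))"

definition c_tilde :: "('v \<Rightarrow> 'v \<Rightarrow> bool) \<Rightarrow> ('v \<Rightarrow> 'v) \<Rightarrow> 'v set \<Rightarrow> 'v set \<Rightarrow> int \<Rightarrow> rat" where
  "c_tilde adj \<sigma> i j u = fls_nth (laurent_at_0 (quantum_cartan_inv adj \<sigma> i j)) u"

end

theory Submission
  imports Defs "HOL-Analysis.Cartesian_Space"
begin

text \<open>Read along the repetition quiver, the fundamental weights transported by the Weyl group form a
  function \<open>W\<close> on its vertices with \<open>W y p + W y (p - 2 d\<^sub>y) = (\<Sum>z \<sim> y. W z q\<^sub>z)\<close>, where
  \<open>q\<^sub>z\<close> is the largest level of \<open>z\<close> below \<open>p\<close>; each such relation is one reflection. A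
  solution is determined by its values on a height function. Taking \<open>W y \<xi>\<^sub>y = \<varpi>\<^sub>y\<close>, the element
  \<open>\<tau>\<close> acts by \<open>\<tau> (W y p) = W (\<sigma> y) (p - 2)\<close>, so that the right-hand side of the theorem is
  the difference \<open>(\<varpi>\<^sub>x, W y p - W y (p - 2 d\<^sub>y))\<close> at \<open>p = \<xi>\<^sub>x + d\<^sub>x - u\<close>. Cut off above \<open>\<xi>\<close>,
  these differences satisfy the recursion expressing that a row of \<open>C~(z)\<close> multiplied by \<open>C(z)\<close> is a
  unit vector, and this recursion has at most one solution vanishing for \<open>u \<ll> 0\<close>. For \<open>u \<ge> 0\<close> the
  cut-off has no effect, since the differences vanish for \<open>\<xi>\<^sub>y < p < \<xi>\<^sub>x + 2 d\<^sub>x\<close>.\<close>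

section \<open>Weights and reflections\<close>

text \<open>Orbit sizes are mixed: a mesh relation at \<open>y\<close> sees each neighbour on a
  single level, whereas an entry [c]_z of the quantum Cartan matrix can have \<open>r\<close> terms.
  The gap closes for differences: subtracting consecutive relations at \<open>y\<close> telescopes
  the neighbour terms over all levels in between, and these are the terms of [c]_z. The unit vector
  has another source. Above \<xi> the cut-off function is frozen, and a mesh relation between frozen
  values is an equation for the ordinary Cartan matrix; after pairing with \<varpi>_x it fails
  exactly at x. The classification enters only through \<open>admissible_structure\<close>. Its
  vector \<open>h\<close>, which the Cartan matrix makes positive, gives nondegeneracy of the form
  and excludes cycles made of two orbits. Its clause on triality settles the one delicate point
  about X': the definition lists letters over \<sigma>(i) for the summit i only, which exhausts an
  orbit of size two; in an orbit of size three a fixed neighbour already forces \<xi> to descend in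
  steps of 2, so no letter is missing.\<close>

lemma fund_weight_nth [simp]: "fund_weight x $ y = (if y = x then 1 else 0)"
  by (simp add: fund_weight_def axis_def)

lemma reflection_fund_weight:
  "reflection adj y (fund_weight z) =
    (if z = y then (\<Sum>w | adj y w. fund_weight w) - fund_weight y else fund_weight z)"
  by (auto simp: reflection_def simple_root_def vec_eq_iff)

lemma additive_reflection: "additive (reflection adj y)"
  by standard (simp add: reflection_def vector_sadd_rdistrib algebra_simps)

lemma simple_root_nth: "simple_root adj y $ x = (if x = y then 2 else 0) - (if adj y x then 1 else 0)"
  by (simp add: simple_root_def sum.delta)

lemma bij_reflection: assumes "\<not> adj y y" shows "bij (reflection adj y)"
proof (rule o_bij)
  have "reflection adj y (reflection adj y v) = v" for v
    using assms by (simp add: reflection_def vec_eq_iff simple_root_nth)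
  thus "reflection adj y \<circ> reflection adj y = id" "reflection adj y \<circ> reflection adj y = id"
    by (auto simp: fun_eq_iff)
qed

lemma additive_comp: "additive f \<Longrightarrow> additive g \<Longrightarrow> additive (f \<circ> g)"
  by (simp add: additive_def)

lemma additive_inv: assumes "additive f" "bij f" shows "additive (inv f)"
proof
  fix v w
  have "f (inv f v + inv f w) = v + w"
    using assms by (simp add: additive.add bij_is_surj surj_f_inv_f)
  thus "inv f (v + w) = inv f v + inv f w" using assms(2) by (metis bij_inv_eq_iff)
qed

lemma additive_foldr_reflection:
  "additive (foldr (\<lambda>a w. reflection adj (fst a) \<circ> w) xs id)"
proof (induction xs)
  case (Cons a xs)
  show ?case using additive_comp[OF additive_reflection Cons.IH, of adj "fst a"] by (simp add: comp_def)
qed (simp add: additive_def)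

lemma bij_foldr_reflection:
  assumes "\<And>y. \<not> adj y y" shows "bij (foldr (\<lambda>a w. reflection adj (fst a) \<circ> w) xs id)"
proof (induction xs)
  case (Cons a xs)
  show ?case using bij_comp[OF Cons.IH bij_reflection[of adj "fst a"]] assms by (simp add: comp_def)
qed (simp add: bij_def)

lemma weight_aut_fund_weight: "weight_aut \<sigma> (fund_weight y) = fund_weight (\<sigma> y)"
proof -
  have "weight_aut \<sigma> (fund_weight y) = (\<Sum>x\<in>UNIV. if x = y then fund_weight (\<sigma> x) else 0)"
    unfolding weight_aut_def by (intro sum.cong) auto
  thus ?thesis by simp
qed

lemma additive_weight_aut: "additive (weight_aut \<sigma>)"
  by standard (simp add: weight_aut_def vector_sadd_rdistrib sum.distrib)

lemma weight_aut_nth: assumes "bij \<sigma>" shows "weight_aut \<sigma> v $ \<sigma> x = v $ x"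
proof -
  have "weight_aut \<sigma> v $ \<sigma> x = (\<Sum>y\<in>UNIV. if y = x then v $ y else 0)"
    unfolding weight_aut_def sum_component
    by (intro sum.cong) (auto simp: bij_is_inj[OF assms] inj_eq)
  thus ?thesis by simp
qed

lemma bij_weight_aut: assumes "bij \<sigma>" shows "bij (weight_aut \<sigma>)"
proof (rule bijI)
  show "inj (weight_aut \<sigma>)"
    by (rule injI) (metis weight_aut_nth[OF assms] vec_eq_iff)
  show "surj (weight_aut \<sigma>)"
  proof (rule surjI)
    fix v :: "'a weight"
    have "weight_aut \<sigma> (\<chi> x. v $ \<sigma> x) $ y = v $ y" for y
      using weight_aut_nth[OF assms, of "\<chi> x. v $ \<sigma> x" "inv \<sigma> y"] assms
      by (simp add: bij_is_surj surj_f_inv_f)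
    thus "weight_aut \<sigma> (\<chi> x. v $ \<sigma> x) = v" by (simp add: vec_eq_iff)
  qed
qed

section \<open>The bilinear form\<close>

text \<open>Maximum principle: at a vertex where the ratio of \<open>\<bar>v x\<bar>\<close> to
  \<open>h x\<close> is largest, the equation for \<open>v\<close> contradicts the strict inequality
  for \<open>h\<close> unless the ratio is 0.\<close>

lemma dominant_weight_kernel:
  fixes h :: "'v::finite \<Rightarrow> 'b::linordered_field" and v :: "'v \<Rightarrow> 'b"
  assumes "\<And>x. 0 < h x" "\<And>x. (\<Sum>y | adj x y. h y) < 2 * h x"
    and "\<And>x. 2 * v x = (\<Sum>y | adj x y. v y)"
  shows "v x = 0"
proof -
  define t where "t = Max (range (\<lambda>x. \<bar>v x\<bar> / h x))"
  have t: "\<bar>v y\<bar> \<le> t * h y" for y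
  proof -
    have "\<bar>v y\<bar> / h y \<le> t" unfolding t_def by (rule Max_ge) auto
    thus ?thesis using assms(1)[of y] by (simp add: pos_divide_le_eq)
  qed
  have "t \<in> range (\<lambda>x. \<bar>v x\<bar> / h x)" unfolding t_def by (intro Max_in) auto
  then obtain y where "t = \<bar>v y\<bar> / h y" by blast
  hence y: "\<bar>v y\<bar> = t * h y" using assms(1)[of y] by simp
  have t0: "0 \<le> t" using y assms(1)[of y] by (metis abs_ge_zero zero_le_mult_iff not_le)
  have "t = 0"
  proof (rule ccontr)
    assume "t \<noteq> 0"
    hence "0 < t" using t0 by simp
    have "2 * (t * h y) = \<bar>\<Sum>z | adj y z. v z\<bar>" using assms(3)[of y] y by (metis abs_mult abs_numeral)
    also have "\<dots> \<le> (\<Sum>z | adj y z. t * h z)"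
      by (rule order_trans[OF sum_abs]) (intro sum_mono t)
    also have "\<dots> < t * (2 * h y)"
      using assms(2)[of y] \<open>0 < t\<close> by (simp add: sum_distrib_left[symmetric])
    finally show False by simp
  qed
  thus ?thesis using t[of x] by simp
qed

text \<open>At a vertex of \<open>Z\<close> where \<open>h\<close> is least, two neighbours in
  \<open>Z\<close> already contribute \<open>2 * h x\<close>. This rules out cycles, and through
  them two neighbours of a vertex in one orbit of its own size.\<close>

lemma no_two_neighbours:
  fixes h :: "'v::finite \<Rightarrow> 'b::linordered_idom"
  assumes "\<And>x. 0 < h x" "\<And>x. (\<Sum>y | adj x y. h y) < 2 * h x" "Z \<noteq> {}"
    and "\<And>x. x \<in> Z \<Longrightarrow> \<exists>y z. y \<in> Z \<and> z \<in> Z \<and> y \<noteq> z \<and> adj x y \<and> adj x z"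
  shows False
proof -
  have "Min (h ` Z) \<in> h ` Z" using assms(3) by (intro Min_in) auto
  then obtain x where x: "x \<in> Z" "h x = Min (h ` Z)" by force
  have min: "h x \<le> h y" if "y \<in> Z" for y using that x by simp
  obtain y z where yz: "y \<in> Z" "z \<in> Z" "y \<noteq> z" "adj x y" "adj x z" using assms(4)[OF x(1)] by blast
  have "2 * h x \<le> h y + h z" using min[OF yz(1)] min[OF yz(2)] by linarith
  also have "\<dots> = (\<Sum>w\<in>{y, z}. h w)" using yz(3) by simp
  also have "\<dots> \<le> (\<Sum>w | adj x w. h w)"
    using yz assms(1) by (intro sum_mono2) (auto intro: less_imp_le)
  finally show False using assms(2)[of x] by simp
qed

text \<open>Injectivity of the Cartan matrix over the rationals; it gives both existence and
  uniqueness in the description of \<open>weight_form\<close>.\<close>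

definition cartan_kernel_trivial :: "('v::finite \<Rightarrow> 'v \<Rightarrow> bool) \<Rightarrow> bool" where
  "cartan_kernel_trivial adj \<longleftrightarrow>
    (\<forall>v :: 'v \<Rightarrow> rat. (\<forall>x. 2 * v x = (\<Sum>y | adj x y. v y)) \<longrightarrow> (\<forall>x. v x = 0))"

lemma additive_smult:
  fixes f :: "int ^ 'v::finite \<Rightarrow> rat" assumes "additive f" shows "f (k *s v) = of_int k * f v"
proof (induction k rule: int_induct[of _ 0])
  case base show ?case by (simp add: additive.zero[OF assms])
next
  case (step1 k)
  show ?case using step1.IH by (simp add: vector_sadd_rdistrib additive.add[OF assms] algebra_simps)
next
  case (step2 k)
  have "(k - 1) *s v + v = k *s v" by (simp add: vec_eq_iff algebra_simps)
  hence "f ((k - 1) *s v) + f v = f (k *s v)" by (metis additive.add[OF assms])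
  thus ?case using step2.IH by (simp add: algebra_simps)
qed

lemma weight_expand: "(v :: 'v::finite weight) = (\<Sum>x\<in>UNIV. (v $ x) *s fund_weight x)"
  by (simp add: vec_eq_iff if_distrib[of "\<lambda>t. _ * t"] sum.delta' cong: if_cong)

lemma additive_weight_expand:
  fixes f :: "'v::finite weight \<Rightarrow> rat" assumes "additive f"
  shows "f v = (\<Sum>x\<in>UNIV. of_int (v $ x) * f (fund_weight x))"
  by (subst weight_expand) (simp add: additive.sum[OF assms] additive_smult[OF assms])

lemma additive_simple_root:
  fixes f :: "'v::finite weight \<Rightarrow> rat" assumes "additive f"
  shows "f (simple_root adj y) = 2 * f (fund_weight y) - (\<Sum>z | adj y z. f (fund_weight z))"
  by (simp add: simple_root_def additive.diff[OF assms] additive.sum[OF assms] additive_smult[OF assms])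

text \<open>In the basis of fundamental weights the Gram matrix has to be the inverse of the Cartan
  matrix, and it inherits symmetry from it.\<close>

lemma ex_weight_form:
  fixes adj :: "'v::finite \<Rightarrow> 'v \<Rightarrow> bool"
  assumes "\<And>x y. adj x y \<Longrightarrow> adj y x" "\<And>x. \<not> adj x x" "cartan_kernel_trivial adj"
  obtains B :: "'v weight \<Rightarrow> 'v weight \<Rightarrow> rat" where
    "\<And>v w. B v w = B w v" "\<And>u v w. B (u + v) w = B u w + B v w"
    "\<And>x y. B (fund_weight x) (simple_root adj y) = (if x = y then 1 else 0)"
proof -
  define M :: "rat ^ 'v ^ 'v" where "M = (\<chi> x y. (if x = y then 2 else 0) - (if adj x y then 1 else 0))"
  have Mv: "(M *v g) $ x = 2 * g $ x - (\<Sum>y | adj x y. g $ y)" for g x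
    by (simp add: M_def matrix_vector_mult_def left_diff_distrib sum_subtractf
        if_distrib[of "\<lambda>t. t * _"] sum.delta' sum.If_cases cong: if_cong)
  have "g = 0" if "M *v g = 0" for g
  proof -
    have "2 * g $ x = (\<Sum>y | adj x y. g $ y)" for x using Mv[of g x] that by simp
    hence "g $ x = 0" for x using assms(3) unfolding cartan_kernel_trivial_def by blast
    thus ?thesis by (simp add: vec_eq_iff)
  qed
  then obtain R where R: "R ** M = mat 1" using matrix_left_invertible_ker[of M] by blast
  have R': "M ** R = mat 1" using R by (simp add: matrix_left_right_inverse)
  have Msym: "Finite_Cartesian_Product.transpose M = M" using assms(1) by (auto simp: Finite_Cartesian_Product.transpose_def M_def vec_eq_iff)
  have "Finite_Cartesian_Product.transpose R ** M = mat 1"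
    using R' Msym matrix_transpose_mul[of M R] by (simp add: transpose_mat)
  hence "Finite_Cartesian_Product.transpose R = R" using R' by (metis matrix_mul_assoc matrix_mul_lid matrix_mul_rid)
  hence Rsym: "R $ x $ y = R $ y $ x" for x y by (metis Finite_Cartesian_Product.transpose_def vec_lambda_beta)
  define B :: "'v weight \<Rightarrow> 'v weight \<Rightarrow> rat"
    where "B v w = (\<Sum>x\<in>UNIV. \<Sum>y\<in>UNIV. of_int (v $ x) * R $ x $ y * of_int (w $ y))" for v w
  have "B v w = B w v" for v w
  proof -
    have "B v w = (\<Sum>y\<in>UNIV. \<Sum>x\<in>UNIV. of_int (v $ x) * R $ x $ y * of_int (w $ y))"
      unfolding B_def by (rule sum.swap)
    also have "\<dots> = B w v" unfolding B_def using Rsym by (intro sum.cong refl) (simp add: mult_ac)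
    finally show ?thesis .
  qed
  moreover have "B (u + v) w = B u w + B v w" for u v w
    by (simp add: B_def sum.distrib[symmetric] algebra_simps)
  moreover have "B (fund_weight x) (simple_root adj y) = (if x = y then 1 else 0)" for x y
  proof -
    have "B (fund_weight x) (simple_root adj y) =
        (\<Sum>x'\<in>UNIV. if x' = x then (\<Sum>z\<in>UNIV. R $ x $ z * of_int (simple_root adj y $ z)) else 0)"
      unfolding B_def by (intro sum.cong refl) simp
    also have "\<dots> = (\<Sum>z\<in>UNIV. R $ x $ z * of_int (simple_root adj y $ z))" by simp
    also have "\<dots> = (R ** M) $ x $ y"
      using assms(1) unfolding matrix_matrix_mult_def M_def
      by (simp add: simple_root_nth) (intro sum.cong refl, auto)
    finally show ?thesis by (simp add: R mat_def)
  qed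
  ultimately show ?thesis using that by blast
qed

text \<open>For fixed \<open>x\<close> the difference of the two forms at \<varpi>_x and \<varpi>_y
  is, as a function of \<open>y\<close>, in the kernel of the Cartan matrix. Additivity spreads the
  equality from fundamental weights to the lattice.\<close>

lemma weight_form_unique:
  fixes adj :: "'v::finite \<Rightarrow> 'v \<Rightarrow> bool" and B B' :: "'v weight \<Rightarrow> 'v weight \<Rightarrow> rat"
  assumes "cartan_kernel_trivial adj"
    and B: "\<And>v w. B v w = B w v" "\<And>u v w. B (u + v) w = B u w + B v w"
      "\<And>x y. B (fund_weight x) (simple_root adj y) = (if x = y then 1 else 0)"
    and B': "\<And>v w. B' v w = B' w v" "\<And>u v w. B' (u + v) w = B' u w + B' v w"
      "\<And>x y. B' (fund_weight x) (simple_root adj y) = (if x = y then 1 else 0)"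
  shows "B = B'"
proof -
  have add: "additive (B v)" "additive (B' v)" "additive (\<lambda>w. B w v)" "additive (\<lambda>w. B' w v)" for v
    using B(1,2) B'(1,2) by (auto simp: additive_def)
  have fund: "B (fund_weight x) (fund_weight y) = B' (fund_weight x) (fund_weight y)" for x y
  proof -
    define g where "g y = B (fund_weight x) (fund_weight y) - B' (fund_weight x) (fund_weight y)" for y
    have "2 * g y = (\<Sum>z | adj y z. g z)" for y
      using B(3)[of x y] B'(3)[of x y]
      by (simp add: additive_simple_root[OF add(1)] additive_simple_root[OF add(2)] g_def
          sum_subtractf algebra_simps)
    hence "g y = 0" using assms(1) unfolding cartan_kernel_trivial_def by blast
    thus ?thesis by (simp add: g_def)
  qed
  have "B v w = B' v w" for v w
  proof -
    have "B (fund_weight x) w = B' (fund_weight x) w" for x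
      by (simp add: additive_weight_expand[OF add(1), of _ w] additive_weight_expand[OF add(2), of _ w] fund)
    thus ?thesis
      using additive_weight_expand[OF add(3)[of w], of v] additive_weight_expand[OF add(4)[of w], of v] by simp
  qed
  thus ?thesis by (simp add: fun_eq_iff)
qed

text \<open>Duality with the simple roots is put as a neighbour sum because this is the shape in
  which values of a mesh on a slice meet it, as the hypothesis \<open>dual\<close> below.\<close>

lemma weight_form_props:
  fixes adj :: "'v::finite \<Rightarrow> 'v \<Rightarrow> bool"
  assumes "\<And>x y. adj x y \<Longrightarrow> adj y x" "\<And>x. \<not> adj x x" "cartan_kernel_trivial adj"
  shows "additive (weight_form adj v)"
    and "2 * weight_form adj (fund_weight x) (fund_weight y) -
      (\<Sum>z | adj y z. weight_form adj (fund_weight x) (fund_weight z)) = (if y = x then 1 else 0)"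
proof -
  obtain B :: "'v weight \<Rightarrow> 'v weight \<Rightarrow> rat" where
    B: "\<And>v w. B v w = B w v" "\<And>u v w. B (u + v) w = B u w + B v w"
      "\<And>x y. B (fund_weight x) (simple_root adj y) = (if x = y then 1 else 0)"
    using ex_weight_form[OF assms] by blast
  have form: "weight_form adj = B" unfolding weight_form_def
  proof (rule the_equality)
    fix B' :: "'v weight \<Rightarrow> 'v weight \<Rightarrow> rat"
    assume *: "(\<forall>v w. B' v w = B' w v) \<and> (\<forall>u v w. B' (u + v) w = B' u w + B' v w) \<and>
      (\<forall>x y. B' (fund_weight x) (simple_root adj y) = (if x = y then 1 else 0))"
    show "B' = B"
      by (rule weight_form_unique[OF assms(3)]) (use * B in blast)+
  qed (use B in blast)
  show add: "additive (weight_form adj v)" for v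
    unfolding form using B(1,2) by (auto simp: additive_def)
  show "2 * weight_form adj (fund_weight x) (fund_weight y) -
      (\<Sum>z | adj y z. weight_form adj (fund_weight x) (fund_weight z)) = (if y = x then 1 else 0)"
    using additive_simple_root[OF add, of "fund_weight x" adj y] B(3)[of x y] by (auto simp: form)
qed

section \<open>Automorphisms of ADE diagrams\<close>

text \<open>\<open>h\<close> and its composition with \<sigma> solve the same Cartan equation with
  constant right-hand side, so their difference is in the kernel.\<close>

lemma dominant_weight_invariant:
  fixes h :: "'v::finite \<Rightarrow> 'b::linordered_field"
  assumes "bij \<sigma>" "\<And>x y. adj (\<sigma> x) (\<sigma> y) \<longleftrightarrow> adj x y"
    and h: "\<And>x. 0 < h x" "\<And>x. 2 * h x - (\<Sum>y | adj x y. h y) = c" and "0 < c"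
  shows "h (\<sigma> x) = h x"
proof -
  have "2 * (h (\<sigma> x) - h x) = (\<Sum>y | adj x y. h (\<sigma> y) - h y)" for x
  proof -
    have "{y. adj (\<sigma> x) y} = \<sigma> ` {y. adj x y}"
      using assms(1,2) by (auto simp: image_iff) (metis bij_pointE)
    hence "(\<Sum>y | adj (\<sigma> x) y. h y) = (\<Sum>y | adj x y. h (\<sigma> y))"
      using inj_on_subset[OF bij_is_inj[OF assms(1)]] by (simp add: sum.reindex)
    thus ?thesis using h(2)[of x] h(2)[of "\<sigma> x"] by (simp add: sum_subtractf algebra_simps)
  qed
  moreover have "(\<Sum>y | adj x y. h y) < 2 * h x" for x using h(2)[of x] assms(5) by simp
  ultimately have "h (\<sigma> x) - h x = 0"
    using dominant_weight_kernel[of h adj "\<lambda>x. h (\<sigma> x) - h x"] h(1) by blast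
  thus ?thesis by simp
qed

text \<open>\<open>x\<close>, \<open>\<sigma> x\<close> and \<open>\<sigma> (\<sigma> x)\<close>
  share a level of \<open>c\<close>, and levels have at most two elements. Whichever two coincide,
  injectivity leads back to \<open>x\<close>.\<close>

lemma involution_if_small_levels:
  assumes "inj \<sigma>" "\<And>x. c (\<sigma> x) = c x"
    and "\<And>x y z. c x = c y \<Longrightarrow> c y = c z \<Longrightarrow> x = y \<or> y = z \<or> x = z"
  shows "\<sigma> (\<sigma> x) = x"
  using assms(3)[of "\<sigma> (\<sigma> x)" "\<sigma> x" x] assms(1,2) by (metis injD)

section \<open>Diagrams transported to the numbered model graphs\<close>

locale model_graph =
  fixes adj :: "'v::finite \<Rightarrow> 'v \<Rightarrow> bool" and n :: nat and E :: "(nat \<times> nat) set" and f :: "'v \<Rightarrow> nat"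
  assumes bij_f: "bij_betw f UNIV {1..n}"
    and adj_iff: "adj x y \<longleftrightarrow> (f x, f y) \<in> E \<or> (f y, f x) \<in> E"
begin

definition nbrs :: "nat \<Rightarrow> nat set" where
  "nbrs i = {k. 1 \<le> k \<and> k \<le> n \<and> ((i, k) \<in> E \<or> (k, i) \<in> E)}"

lemma f_range: "1 \<le> f x" "f x \<le> n"
  using bij_f by (auto simp: bij_betw_def)

lemma f_inj: "f x = f y \<longleftrightarrow> x = y"
  using bij_f by (auto simp: bij_betw_def inj_def)

lemma f_surj: "1 \<le> k \<Longrightarrow> k \<le> n \<Longrightarrow> \<exists>x. f x = k"
  using bij_f unfolding bij_betw_def by (metis atLeastAtMost_iff imageE)

lemma bij_betw_nbrs: "bij_betw f {y. adj x y} (nbrs (f x))"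
  unfolding bij_betw_def
proof
  show "inj_on f {y. adj x y}" by (simp add: inj_on_def f_inj)
  show "f ` {y. adj x y} = nbrs (f x)"
    using f_range f_surj by (auto simp: nbrs_def adj_iff image_iff; metis)
qed

lemma sum_nbrs: "(\<Sum>y | adj x y. w (f y)) = (\<Sum>k\<in>nbrs (f x). w k)"
  by (rule sum.reindex_bij_betw[OF bij_betw_nbrs])

lemma card_nbrs: "card {y. adj x y} = card (nbrs (f x))"
  by (rule bij_betw_same_card[OF bij_betw_nbrs])

lemma ex_nbr: "nbrs (f x) \<noteq> {} \<Longrightarrow> \<exists>z. adj x z"
  using bij_betw_nbrs[of x] by (auto simp: bij_betw_def)

lemma adj_sym: "adj x y \<Longrightarrow> adj y x"
  by (auto simp: adj_iff)

end

text \<open>Multiples of the sum of the fundamental weights, written in the basis of simple roots. Their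
  level sets are small enough to leave little room for diagram automorphisms.\<close>

definition rho_A :: "nat \<Rightarrow> nat \<Rightarrow> int" where "rho_A n k = int k * (int n + 1 - int k)"

definition rho_D :: "nat \<Rightarrow> nat \<Rightarrow> int" where
  "rho_D n k = (if k \<le> n - 2 then 2 * int k * (2 * int n - 1 - int k) else int n * (int n - 1))"

definition rho_E :: "nat \<Rightarrow> nat \<Rightarrow> int" where
  "rho_E n k = (if n = 6 then [16, 22, 30, 42, 30, 16]
    else if n = 7 then [34, 49, 66, 96, 75, 52, 27]
    else [92, 136, 182, 270, 220, 168, 114, 58]) ! (k - 1)"

text \<open>All that the rest of the argument takes from the classification. The last alternative is
  the triality of \<open>D\<^sub>4\<close>, whose leaves surround a fixed centre. Neighbours of
  moved vertices are what later orders several letters over one vertex.\<close>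

definition admissible_structure :: "('v::finite \<Rightarrow> 'v \<Rightarrow> bool) \<Rightarrow> ('v \<Rightarrow> 'v) \<Rightarrow> bool" where
  "admissible_structure adj \<sigma> \<longleftrightarrow>
    (\<forall>x y. adj x y \<longrightarrow> adj y x) \<and>
    (\<forall>x. \<not> adj x x) \<and>
    (\<exists>h :: 'v \<Rightarrow> rat. (\<forall>x. 0 < h x) \<and> (\<forall>x. (\<Sum>y | adj x y. h y) < 2 * h x)) \<and>
    (\<forall>x. \<sigma> x \<noteq> x \<longrightarrow> (\<exists>z. adj x z)) \<and>
    ((\<forall>x. \<sigma> (\<sigma> x) = x) \<or>
     (\<forall>x. \<sigma> (\<sigma> (\<sigma> x)) = x) \<and> (\<forall>x. \<sigma> x \<noteq> x \<longrightarrow> (\<exists>z. adj x z \<and> \<sigma> z = z)))"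

context model_graph
begin

lemma weight_sum:
  assumes "\<And>i. 1 \<le> i \<Longrightarrow> i \<le> n \<Longrightarrow> 2 * H i - (\<Sum>k\<in>nbrs i. H k) = (c :: int)"
  shows "2 * (of_int (H (f x)) :: rat) - (\<Sum>y | adj x y. of_int (H (f y))) = of_int c"
proof -
  have "2 * H (f x) - (\<Sum>y | adj x y. H (f y)) = c"
    using assms[of "f x"] f_range by (simp add: sum_nbrs)
  thus ?thesis by (metis of_int_diff of_int_mult of_int_numeral of_int_sum)
qed

lemma invariant:
  assumes "bij \<sigma>" "\<And>x y. adj (\<sigma> x) (\<sigma> y) \<longleftrightarrow> adj x y"
    and "\<And>i. 1 \<le> i \<Longrightarrow> i \<le> n \<Longrightarrow> 0 < H i"
    and "\<And>i. 1 \<le> i \<Longrightarrow> i \<le> n \<Longrightarrow> 2 * H i - (\<Sum>k\<in>nbrs i. H k) = (c :: int)" and "0 < c"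
  shows "H (f (\<sigma> x)) = H (f x)"
proof -
  have "(of_int (H (f (\<sigma> x))) :: rat) = of_int (H (f x))"
    by (rule dominant_weight_invariant[OF assms(1,2) _ weight_sum[OF assms(4)]])
      (use assms(3,5) f_range in auto)
  thus ?thesis by simp
qed

text \<open>The argument common to all types. What remains for each type is to bound the order of
  \<sigma> from the level sets of \<open>H\<close>, refined by the degrees of the vertices.\<close>

lemma structureI:
  assumes "admissible_automorphism adj \<sigma>" "\<And>i. (i, i) \<notin> E"
    and H: "\<And>i. 1 \<le> i \<Longrightarrow> i \<le> n \<Longrightarrow> 0 < H i"
      "\<And>i. 1 \<le> i \<Longrightarrow> i \<le> n \<Longrightarrow> 2 * H i - (\<Sum>k\<in>nbrs i. H k) = (c :: int)" "0 < c"
    and "\<And>x. \<sigma> x \<noteq> x \<Longrightarrow> nbrs (f x) \<noteq> {}"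
    and "(\<And>x. H (f (\<sigma> x)) = H (f x)) \<Longrightarrow> (\<And>x. card (nbrs (f (\<sigma> x))) = card (nbrs (f x))) \<Longrightarrow>
      inj \<sigma> \<Longrightarrow>
     (\<forall>x. \<sigma> (\<sigma> x) = x) \<or>
     (\<forall>x. \<sigma> (\<sigma> (\<sigma> x)) = x) \<and> (\<forall>x. \<sigma> x \<noteq> x \<longrightarrow> (\<exists>z. adj x z \<and> \<sigma> z = z))"
  shows "admissible_structure adj \<sigma>"
proof -
  have \<sigma>: "bij \<sigma>" "\<And>x y. adj (\<sigma> x) (\<sigma> y) \<longleftrightarrow> adj x y"
    using assms(1) by (auto simp: admissible_automorphism_def)
  have deg: "card (nbrs (f (\<sigma> x))) = card (nbrs (f x))" for x
  proof -
    have "{y. adj (\<sigma> x) y} = \<sigma> ` {y. adj x y}"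
      using \<sigma> by (auto simp: image_iff) (metis bij_pointE)
    hence "card {y. adj (\<sigma> x) y} = card {y. adj x y}"
      using inj_on_subset[OF bij_is_inj[OF \<sigma>(1)]] by (simp add: card_image)
    thus ?thesis by (simp add: card_nbrs)
  qed
  have "(\<Sum>y | adj x y. of_int (H (f y))) < 2 * (of_int (H (f x)) :: rat)" for x
  proof -
    have "(0 :: rat) < of_int c" using H(3) by simp
    thus ?thesis using weight_sum[OF H(2), of x] by linarith
  qed
  hence "\<exists>h :: 'v \<Rightarrow> rat. (\<forall>x. 0 < h x) \<and> (\<forall>x. (\<Sum>y | adj x y. h y) < 2 * h x)"
    using H(1) f_range by (intro exI[of _ "\<lambda>x. of_int (H (f x))"]) simp
  moreover have "\<forall>x. \<not> adj x x" by (simp add: adj_iff assms(2))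
  moreover have "\<forall>x. \<sigma> x \<noteq> x \<longrightarrow> (\<exists>z. adj x z)" using assms(6) ex_nbr by blast
  moreover have "\<forall>x y. adj x y \<longrightarrow> adj y x" using adj_sym by blast
  ultimately show ?thesis
    unfolding admissible_structure_def
    using assms(7)[OF invariant[OF \<sigma> H] deg bij_is_inj[OF \<sigma>(1)]] by blast
qed

lemma structure_A:
  assumes "E = edges_A n" "admissible_automorphism adj \<sigma>"
  shows "admissible_structure adj \<sigma>"
proof (rule structureI[where H = "rho_A n" and c = 2])
  have edge: "(i, k) \<in> E \<longleftrightarrow> 1 \<le> i \<and> i < n \<and> k = i + 1" for i k
    using assms(1) by (auto simp: edges_A_def)
  have nb: "nbrs i = {i - 1, i + 1} \<inter> {1..n}" if "1 \<le> i" "i \<le> n" for i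
    using that by (auto simp: nbrs_def edge)
  show "2 * rho_A n i - (\<Sum>k\<in>nbrs i. rho_A n k) = 2" if "1 \<le> i" "i \<le> n" for i
  proof -
    \<comment> \<open>\<open>rho_A\<close> vanishes at 0 and \<open>n + 1\<close>, so the two ends
      of the chain need no case of their own.\<close>
    have "(\<Sum>k\<in>nbrs i. rho_A n k) = (\<Sum>k\<in>{i - 1, i + 1}. rho_A n k)"
    proof (rule sum.mono_neutral_left)
      show "\<forall>k\<in>{i - 1, i + 1} - nbrs i. rho_A n k = 0"
      proof
        fix k assume "k \<in> {i - 1, i + 1} - nbrs i"
        hence "k = 0 \<or> k = n + 1" using nb[OF that] that by auto
        thus "rho_A n k = 0" by (auto simp: rho_A_def)
      qed
    qed (use nb[OF that] in auto)
    thus ?thesis using that by (simp add: rho_A_def of_nat_diff algebra_simps)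
  qed
  show "nbrs (f x) \<noteq> {}" if "\<sigma> x \<noteq> x" for x
  proof
    assume "nbrs (f x) = {}"
    hence "n = 1" using nb[of "f x"] f_range[of x]
      by (cases "f x = 1"; cases "f x = n") (auto simp: disjoint_iff)
    thus False using f_range[of x] f_range[of "\<sigma> x"] f_inj[of x "\<sigma> x"] that by simp
  qed
  assume inv: "\<And>x. rho_A n (f (\<sigma> x)) = rho_A n (f x)" and "inj \<sigma>"
  have lev: "a = b \<or> a + b = n + 1" if "rho_A n a = rho_A n b" for a b
  proof -
    \<comment> \<open>The difference of the two values factors, so the levels are the pairs
      \<open>k\<close>, \<open>n + 1 - k\<close>.\<close>
    have "(int a - int b) * (int n + 1 - int a - int b) = 0"
      using that by (simp add: rho_A_def algebra_simps)
    thus ?thesis by auto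
  qed
  have "\<sigma> (\<sigma> x) = x" for x
  proof (rule involution_if_small_levels[where c = "\<lambda>x. rho_A n (f x)"])
    fix x y z assume "rho_A n (f x) = rho_A n (f y)" "rho_A n (f y) = rho_A n (f z)"
    hence "f x = f y \<or> f y = f z \<or> f x = f z" using lev[of "f x" "f y"] lev[of "f y" "f z"] by linarith
    thus "x = y \<or> y = z \<or> x = z" by (simp add: f_inj)
  qed (use inv \<open>inj \<sigma>\<close> in auto)
  thus "(\<forall>x. \<sigma> (\<sigma> x) = x) \<or>
     (\<forall>x. \<sigma> (\<sigma> (\<sigma> x)) = x) \<and> (\<forall>x. \<sigma> x \<noteq> x \<longrightarrow> (\<exists>z. adj x z \<and> \<sigma> z = z))" by blast
qed (use assms in \<open>auto simp: edges_A_def rho_A_def\<close>)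

lemma structure_D:
  assumes "E = edges_D n" "4 \<le> n" "admissible_automorphism adj \<sigma>"
  shows "admissible_structure adj \<sigma>"
\<comment> \<open>Four times \<rho> instead of twice: the coefficient n (n - 1) / 2 at the two fork
  ends then needs no division.\<close>
proof (rule structureI[where H = "rho_D n" and c = 4])
  have edge: "(i, k) \<in> E \<longleftrightarrow> i = n - 2 \<and> k = n \<or> 1 \<le> i \<and> i < n - 1 \<and> k = i + 1" for i k
    using assms(1) by (auto simp: edges_D_def)
  have nb: "nbrs i = {i - 1, i + 1} - {0}" if "1 \<le> i" "i \<le> n - 3" for i
    using that assms(2) by (auto simp: nbrs_def edge)
  have nb2: "nbrs (n - 2) = {n - 3, n - 1, n}"
    using assms(2) by (auto simp: nbrs_def edge)
  have nb3: "nbrs (n - 1) = {n - 2}" "nbrs n = {n - 2}"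
    using assms(2) by (auto simp: nbrs_def edge)
  have cases: "i \<le> n - 3 \<or> i = n - 2 \<or> i = n - 1 \<or> i = n" if "i \<le> n" for i
    using that by linarith
  have n: "4 \<le> n" "2 \<le> n" "3 \<le> n" "1 \<le> n" using assms(2) by auto
  have top: "rho_D n (n - 3) = 2 * (int n - 3) * (int n + 2)" "rho_D n (n - 2) = 2 * (int n - 2) * (int n + 1)"
    "rho_D n (n - 1) = int n * (int n - 1)" "rho_D n (n - Suc 0) = int n * (int n - 1)" "rho_D n n = int n * (int n - 1)"
    using n by (auto simp: rho_D_def of_nat_diff)
  show "2 * rho_D n i - (\<Sum>k\<in>nbrs i. rho_D n k) = 4" if i: "1 \<le> i" "i \<le> n" for i
  proof -
    consider "i \<le> n - 3" | "i = n - 2" | "i = n - 1" | "i = n" using cases[OF i(2)] by blast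
    thus ?thesis
    proof cases
      case 1
      have low: "rho_D n k = 2 * int k * (2 * int n - 1 - int k)" if "k \<le> n - 2" for k
        using that by (simp add: rho_D_def)
      have "(\<Sum>k\<in>nbrs i. rho_D n k) = (\<Sum>k\<in>{i - 1, i + 1}. rho_D n k)"
      proof (rule sum.mono_neutral_left)
        show "nbrs i \<subseteq> {i - 1, i + 1}" unfolding nb[OF i(1) 1] by blast
        show "\<forall>k\<in>{i - 1, i + 1} - nbrs i. rho_D n k = 0"
          unfolding nb[OF i(1) 1] using low[of 0] by auto
      qed simp
      also have "\<dots> = rho_D n (i - 1) + rho_D n (i + 1)" by simp
      also have "rho_D n (i + 1) = 2 * (int i + 1) * (2 * int n - 1 - (int i + 1))"
        using low[of "i + 1"] 1 assms(2) by simp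
      also have "rho_D n (i - 1) = 2 * (int i - 1) * (2 * int n - 1 - (int i - 1))"
        using low[of "i - 1"] 1 i assms(2) by (simp add: of_nat_diff)
      finally have "(\<Sum>k\<in>nbrs i. rho_D n k) =
        2 * (int i - 1) * (2 * int n - 1 - (int i - 1)) + 2 * (int i + 1) * (2 * int n - 1 - (int i + 1))" .
      moreover have "rho_D n i = 2 * int i * (2 * int n - 1 - int i)" by (rule low) (use 1 in simp)
      ultimately show ?thesis by (simp add: algebra_simps)
    next
      case 2
      have "n - 3 \<noteq> n - 1" "n - 3 \<noteq> n" "n - 1 \<noteq> n" using n by auto
      hence "(\<Sum>k\<in>{n - 3, n - 1, n}. rho_D n k) = rho_D n (n - 3) + rho_D n (n - 1) + rho_D n n" by simp
      thus ?thesis unfolding 2 nb2 by (simp add: top algebra_simps)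
    next
      case 3
      thus ?thesis using nb3(1) by (simp add: top algebra_simps)
    next
      case 4
      thus ?thesis using nb3(2) by (simp add: top algebra_simps)
    qed
  qed
  show "0 < rho_D n i" if "1 \<le> i" "i \<le> n" for i
    using that assms(2) by (auto simp: rho_D_def)
  show "nbrs (f x) \<noteq> {}" for x
    using cases[OF f_range(2)[of x]] nb[OF f_range(1)[of x]] nb2 nb3 by auto
  assume inv: "\<And>x. rho_D n (f (\<sigma> x)) = rho_D n (f x)"
    and deg: "\<And>x. card (nbrs (f (\<sigma> x))) = card (nbrs (f x))" and inj: "inj \<sigma>"
  show "(\<forall>x. \<sigma> (\<sigma> x) = x) \<or>
     (\<forall>x. \<sigma> (\<sigma> (\<sigma> x)) = x) \<and> (\<forall>x. \<sigma> x \<noteq> x \<longrightarrow> (\<exists>z. adj x z \<and> \<sigma> z = z))"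
  proof (cases "n = 4")
    case False
    hence n5: "5 \<le> n" using assms(2) by simp
    have mono: "a = b" if "rho_D n a = rho_D n b" "a \<le> n - 2" "b \<le> n - 2" for a b
    proof -
      have "(int a - int b) * (2 * int n - 1 - int a - int b) = 0"
        using that by (simp add: rho_D_def algebra_simps)
      thus ?thesis using that n5 by auto
    qed
    \<comment> \<open>Along the chain \<open>rho_D\<close> can take its value at the fork ends (for
      example \<open>n = 21\<close>, \<open>a = 6\<close>), so degrees have to help: a chain vertex
      of degree one is \<open>a = 1\<close>, and there equal values would force
      \<open>n = 4\<close>.\<close>
    have mixed: False if "rho_D n a = rho_D n b" "card (nbrs a) = card (nbrs b)" "1 \<le> a" "a \<le> n - 2"
      "b = n - 1 \<or> b = n" for a b
    proof -
      have "card (nbrs a) = 1" using that nb3 by auto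
      have "a = 1"
      proof (rule ccontr)
        assume "a \<noteq> 1"
        hence "nbrs a = {a - 1, a + 1} \<or> nbrs a = {n - 3, n - 1, n}"
          using nb[of a] nb2 that(3,4) by (cases "a = n - 2") auto
        moreover have "n - 3 \<noteq> n - 1" "n - 3 \<noteq> n" "n - 1 \<noteq> n" using n by auto
        hence "card {n - 3, n - 1, n} = 3" by simp
        moreover have "card {a - 1, a + 1} = 2" by simp
        ultimately show False using \<open>card (nbrs a) = 1\<close> by auto
      qed
      hence "2 * (2 * int n - 2) = int n * (int n - 1)" using that n5 by (auto simp: rho_D_def)
      hence "(int n - 4) * (int n - 1) = 0" by (simp add: algebra_simps)
      thus False using n5 by auto
    qed
    have high: "a = n - 1 \<or> a = n" if "a \<le> n" "\<not> a \<le> n - 2" for a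
      using that by linarith
    have lev: "a = b \<or> (a = n - 1 \<or> a = n) \<and> (b = n - 1 \<or> b = n)"
      if "rho_D n a = rho_D n b" "card (nbrs a) = card (nbrs b)" "1 \<le> a" "a \<le> n" "1 \<le> b" "b \<le> n" for a b
    proof (cases "a \<le> n - 2"; cases "b \<le> n - 2")
      assume "a \<le> n - 2" "b \<le> n - 2"
      thus ?thesis using mono[OF that(1)] by blast
    next
      assume "a \<le> n - 2" "\<not> b \<le> n - 2"
      thus ?thesis using mixed[OF that(1,2,3)] high[OF that(6)] by blast
    next
      assume "\<not> a \<le> n - 2" "b \<le> n - 2"
      thus ?thesis using mixed[OF that(1)[symmetric] that(2)[symmetric] that(5)] high[OF that(4)] by blast
    next
      assume "\<not> a \<le> n - 2" "\<not> b \<le> n - 2"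
      thus ?thesis using high[OF that(4)] high[OF that(6)] by blast
    qed
    have "\<sigma> (\<sigma> x) = x" for x
    proof (rule involution_if_small_levels[where c = "\<lambda>x. (rho_D n (f x), card (nbrs (f x)))"])
      fix x y z
      assume *: "(rho_D n (f x), card (nbrs (f x))) = (rho_D n (f y), card (nbrs (f y)))"
        "(rho_D n (f y), card (nbrs (f y))) = (rho_D n (f z), card (nbrs (f z)))"
      have "f x = f y \<or> (f x = n - 1 \<or> f x = n) \<and> (f y = n - 1 \<or> f y = n)"
        by (rule lev[OF _ _ f_range f_range]) (use *(1) in simp_all)
      moreover have "f y = f z \<or> (f y = n - 1 \<or> f y = n) \<and> (f z = n - 1 \<or> f z = n)"
        by (rule lev[OF _ _ f_range f_range]) (use *(2) in simp_all)
      ultimately have "f x = f y \<or> f y = f z \<or> f x = f z" by metis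
      thus "x = y \<or> y = z \<or> x = z" by (simp add: f_inj)
    qed (use inv deg inj in auto)
    thus ?thesis by blast
  next
    case True
    \<comment> \<open>In \<open>D\<^sub>4\<close> the centre has the value 20 and each leaf the
      value 12, so \<sigma> fixes the centre and permutes the three leaves.\<close>
    obtain c where c: "f c = 2" using f_surj[of 2] assms(2) by auto
    have val: "f x = 1 \<or> f x = 2 \<or> f x = 3 \<or> f x = 4" for x using f_range[of x] True by linarith
    have "rho_D n (f x) = 20 \<longleftrightarrow> f x = 2" for x
      using val[of x] by (auto simp: rho_D_def True)
    hence two: "f (\<sigma> x) = 2 \<longleftrightarrow> f x = 2" for x using inv[of x] by metis
    hence \<sigma>c: "\<sigma> c = c" using c f_inj by metis
    have adj_c: "adj x c" if "f x \<noteq> 2" for x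
    proof -
      have "2 \<in> nbrs (f x)" using val[of x] that nb[of 1] nb3 True by auto
      hence "2 \<in> f ` {y. adj x y}" using bij_betw_nbrs[of x] by (simp add: bij_betw_def)
      then obtain y where "adj x y" "f y = f c" using c by auto
      thus ?thesis by (simp add: f_inj)
    qed
    have "\<exists>z. adj x z \<and> \<sigma> z = z" if "\<sigma> x \<noteq> x" for x
    proof -
      have "x \<noteq> c" using that \<sigma>c by auto
      thus ?thesis using adj_c[of x] \<sigma>c c f_inj by metis
    qed
    moreover have "(\<forall>x. \<sigma> (\<sigma> x) = x) \<or> (\<forall>x. \<sigma> (\<sigma> (\<sigma> x)) = x)"
    proof (rule ccontr)
      assume "\<not> ?thesis"
      then obtain x y where x: "\<sigma> (\<sigma> x) \<noteq> x" and y: "\<sigma> (\<sigma> (\<sigma> y)) \<noteq> y" by blast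
      have four: "card (f ` S) \<le> 3" if "\<And>w. w \<in> S \<Longrightarrow> f w \<noteq> 2" for S
      proof -
        have "f ` S \<subseteq> {1, 3, 4}" using that val by blast
        thus ?thesis using card_mono[of "{1, 3, 4}" "f ` S"] by simp
      qed
      have fx: "f x \<noteq> 2" "f y \<noteq> 2" using x y c \<sigma>c f_inj by metis+
      have d: "\<sigma> x \<noteq> x" "\<sigma> (\<sigma> x) \<noteq> \<sigma> x" using x inj by (metis injD)+
      have "card (f ` {x, \<sigma> x, \<sigma> (\<sigma> x), w}) \<le> 3" if "f w \<noteq> 2" for w
        by (rule four) (use that fx two in auto)
      moreover have "card (f ` S) = card S" for S by (rule card_image) (simp add: inj_on_def f_inj)
      ultimately have "card {x, \<sigma> x, \<sigma> (\<sigma> x), w} \<le> 3" if "f w \<noteq> 2" for w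
        using that by metis
      \<comment> \<open>If \<sigma> applied twice moves \<open>x\<close>, then \<open>x\<close> and
        its two images use up the leaves, and \<sigma> is a 3-cycle on them.\<close>
      hence three: "w = x \<or> w = \<sigma> x \<or> w = \<sigma> (\<sigma> x)" if "f w \<noteq> 2" for w
        using that x d by (force simp: card_insert_if split: if_splits)
      have "\<sigma> (\<sigma> (\<sigma> x)) = x"
        using three[of "\<sigma> (\<sigma> (\<sigma> x))"] fx two x d inj by (metis injD)
      thus False using three[of y] fx y by auto
    qed
    ultimately show ?thesis by blast
  qed
qed (use assms in \<open>auto simp: edges_D_def\<close>)

lemma structure_E:
  assumes "E = edges_E n" "n \<in> {6, 7, 8}" "admissible_automorphism adj \<sigma>"
  shows "admissible_structure adj \<sigma>"
proof (rule structureI[where H = "rho_E n" and c = 2])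
  have edge: "(i, k) \<in> E \<longleftrightarrow> i = 1 \<and> k = 3 \<or> i = 2 \<and> k = 4 \<or> 3 \<le> i \<and> i < n \<and> k = i + 1" for i k
    using assms(1) by (auto simp: edges_E_def)
  have nb: "nbrs 1 = {3}" "nbrs 2 = {4}" "nbrs 3 = {1, 4}" "nbrs 4 = {2, 3, 5}" "nbrs 5 = {4, 6}"
    "nbrs 6 = {5} \<union> (if 7 \<le> n then {7} else {})"
    "7 \<le> n \<Longrightarrow> nbrs 7 = {6} \<union> (if 8 \<le> n then {8} else {})" "8 \<le> n \<Longrightarrow> nbrs 8 = {7}"
    unfolding nbrs_def edge using assms(2) by auto
  have val: "i \<in> {1, 2, 3, 4, 5, 6} \<or> i = 7 \<and> 7 \<le> n \<or> i = 8 \<and> 8 \<le> n" if "1 \<le> i" "i \<le> n" for i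
    using that assms(2) by auto
  show "2 * rho_E n i - (\<Sum>k\<in>nbrs i. rho_E n k) = 2" if "1 \<le> i" "i \<le> n" for i
    using val[OF that] assms(2) nb by (elim disjE insertE emptyE) (auto simp: rho_E_def)
  show pos: "0 < rho_E n i" if "1 \<le> i" "i \<le> n" for i
    using val[OF that] assms(2) by (elim disjE insertE emptyE) (auto simp: rho_E_def)
  show "nbrs (f x) \<noteq> {}" for x
    using val[OF f_range, of x] nb by (elim disjE insertE emptyE) auto
  assume inv: "\<And>x. rho_E n (f (\<sigma> x)) = rho_E n (f x)" and inj: "inj \<sigma>"
  \<comment> \<open>Values repeat in \<open>E\<^sub>6\<close> only, and there exactly on the two
    pairs exchanged by the flip.\<close>
  have lev: "a = b \<or> a \<in> {1, 6} \<and> b \<in> {1, 6} \<or> a \<in> {3, 5} \<and> b \<in> {3, 5}"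
    if "rho_E n a = rho_E n b" "1 \<le> a" "a \<le> n" "1 \<le> b" "b \<le> n" for a b
    using val[OF that(2,3)] val[OF that(4,5)] assms(2) that(1)
    by (elim disjE insertE emptyE) (auto simp: rho_E_def)
  have "\<sigma> (\<sigma> x) = x" for x
  proof (rule involution_if_small_levels[where c = "\<lambda>x. rho_E n (f x)"])
    fix x y z
    assume *: "rho_E n (f x) = rho_E n (f y)" "rho_E n (f y) = rho_E n (f z)"
    have "f x = f y \<or> f y = f z \<or> f x = f z"
      using lev[OF *(1) f_range f_range] lev[OF *(2) f_range f_range] by (elim disjE) auto
    thus "x = y \<or> y = z \<or> x = z" by (simp add: f_inj)
  qed (use inv inj in auto)
  thus "(\<forall>x. \<sigma> (\<sigma> x) = x) \<or>
     (\<forall>x. \<sigma> (\<sigma> (\<sigma> x)) = x) \<and> (\<forall>x. \<sigma> x \<noteq> x \<longrightarrow> (\<exists>z. adj x z \<and> \<sigma> z = z))" by blast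
qed (use assms in \<open>auto simp: edges_E_def\<close>)

end

lemma ADE_admissible_structure:
  assumes "ADE_diagram adj" "admissible_automorphism adj \<sigma>"
  shows "admissible_structure adj \<sigma>"
proof -
  have graph: "model_graph adj n E f"
    if "bij_betw f UNIV {1..n} \<and> (\<forall>x y. adj x y \<longleftrightarrow> (f x, f y) \<in> E \<or> (f y, f x) \<in> E)" for n E f
    using that by (simp add: model_graph_def)
  show ?thesis
    using assms(1) unfolding ADE_diagram_def graph_iso_to_def
  proof (elim disjE exE bexE conjE)
    fix n f assume "bij_betw f UNIV {1..n}"
      "\<forall>x y. adj x y \<longleftrightarrow> (f x, f y) \<in> edges_A n \<or> (f y, f x) \<in> edges_A n"
    thus ?thesis using model_graph.structure_A[OF graph refl assms(2)] by blast
  next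
    fix n f assume "bij_betw f UNIV {1..n}" "4 \<le> n"
      "\<forall>x y. adj x y \<longleftrightarrow> (f x, f y) \<in> edges_D n \<or> (f y, f x) \<in> edges_D n"
    thus ?thesis using model_graph.structure_D[OF graph refl _ assms(2)] by blast
  next
    fix n f assume "bij_betw f UNIV {1..n}" "n \<in> {6, 7, 8}"
      "\<forall>x y. adj x y \<longleftrightarrow> (f x, f y) \<in> edges_E n \<or> (f y, f x) \<in> edges_E n"
    thus ?thesis using model_graph.structure_E[OF graph refl _ assms(2)] by blast
  qed
qed

section \<open>The mesh relation\<close>

lemma ex_lower_bound: "\<exists>m. \<forall>y. m \<le> g y" for g :: "'v::finite \<Rightarrow> int"
  by (intro exI[of _ "Min (range g)"]) auto

lemma ex_upper_bound: "\<exists>m. \<forall>y. g y \<le> m" for g :: "'v::finite \<Rightarrow> int"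
  by (intro exI[of _ "Max (range g)"]) auto

text \<open>For meshes only the periods and offsets of the levels matter, so \<sigma> is forgotten
  here. That neighbours never share a level gives the strict inequality \<open>below_gt\<close>, on
  which the downward recursion rests.\<close>

locale repetition_quiver =
  fixes adj :: "'v::finite \<Rightarrow> 'v \<Rightarrow> bool" and d \<epsilon> :: "'v \<Rightarrow> int"
  assumes adj_sym: "adj x y \<Longrightarrow> adj y x"
    and d_pos: "0 < d x"
    and adj_levels: "adj x y \<Longrightarrow> 2 * d x dvd p - \<epsilon> x \<Longrightarrow> \<not> 2 * d y dvd p - \<epsilon> y"
begin

definition vert :: "'v \<Rightarrow> int \<Rightarrow> bool" where
  "vert y p \<longleftrightarrow> 2 * d y dvd p - \<epsilon> y"

definition below :: "'v \<Rightarrow> int \<Rightarrow> int" where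
  "below z p = p - 1 - (p - 1 - \<epsilon> z) mod (2 * d z)"

definition mesh :: "('v \<Rightarrow> int \<Rightarrow> 'b::ab_group_add) \<Rightarrow> bool" where
  "mesh W \<longleftrightarrow> (\<forall>y p. vert y p \<longrightarrow> W y p + W y (p - 2 * d y) = (\<Sum>z | adj y z. W z (below z p)))"

text \<open>A cut through the quiver. As \<open>adj\<close> is symmetric, the condition bounds
  \<open>a z\<close> on both sides: a mesh relation at a vertex \<open>p \<le> a y\<close> involves
  neighbours on or below the cut, one at a vertex \<open>p > a y\<close> neighbours on or above
  it.\<close>

definition slice :: "('v \<Rightarrow> int) \<Rightarrow> bool" where
  "slice a \<longleftrightarrow> (\<forall>y. vert y (a y)) \<and> (\<forall>y z. adj y z \<longrightarrow> a z < a y + 2 * d y)"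

lemma adj_vert: "adj x y \<Longrightarrow> vert x p \<Longrightarrow> \<not> vert y p"
  using adj_levels by (auto simp: vert_def)

lemma vert_shift: "vert y (p + 2 * d y * k) \<longleftrightarrow> vert y p"
  unfolding vert_def by (metis add_diff_eq add.commute dvd_add_times_triv_left_iff mult.commute)

lemma vert_down [simp]: "vert y (p - 2 * d y) \<longleftrightarrow> vert y p"
  using vert_shift[of y p "-1"] by simp

lemma vert_up [simp]: "vert y (p + 2 * d y) \<longleftrightarrow> vert y p"
  using vert_shift[of y p 1] by simp

lemma vert_less: assumes "vert y p" "vert y q" "p < q" shows "p + 2 * d y \<le> q"
proof -
  have "2 * d y dvd (q - \<epsilon> y) - (p - \<epsilon> y)"
    using assms unfolding vert_def by (metis dvd_diff)
  hence "2 * d y dvd q - p" by simp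
  thus ?thesis using assms(3) zdvd_imp_le[of "2 * d y" "q - p"] by linarith
qed

lemma vert_below: "vert z (below z p)"
proof -
  have "below z p - \<epsilon> z = (p - 1 - \<epsilon> z) - (p - 1 - \<epsilon> z) mod (2 * d z)"
    by (simp add: below_def)
  thus ?thesis unfolding vert_def by (metis dvd_minus_mod)
qed

lemma below_less: "below z p < p"
  using d_pos[of z] pos_mod_sign[of "2 * d z" "p - 1 - \<epsilon> z"] by (simp add: below_def del: pos_mod_sign)

lemma below_ge: "p \<le> below z p + 2 * d z"
  using d_pos[of z] pos_mod_bound[of "2 * d z" "p - 1 - \<epsilon> z"] by (simp add: below_def)

lemma below_gt: "adj y z \<Longrightarrow> vert y p \<Longrightarrow> p < below z p + 2 * d z"
  using below_ge[of p z] adj_vert[of y z p] vert_below[of z p] vert_up[of z "below z p"]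
  by (metis order_le_less)

lemma below_eqI: assumes "vert z q" "q < p" "p \<le> q + 2 * d z" shows "below z p = q"
  using vert_less[of z q "below z p"] vert_less[of z "below z p" q] assms
    vert_below[of z p] below_less[of z p] below_ge[of p z] by linarith

lemma le_below: assumes "vert z q" "q < p" shows "q \<le> below z p"
  using vert_less[of z "below z p" q] assms vert_below[of z p] below_ge[of p z] by linarith

lemma below_le_slice:
  assumes "slice a" "adj y z" "p \<le> a y" shows "below z p \<le> a z"
proof -
  have "a y < a z + 2 * d z" "vert z (a z)" using assms(1,2) adj_sym unfolding slice_def by blast+
  thus ?thesis
    using vert_less[of z "a z" "below z p"] vert_below[of z p] below_less[of z p] assms(3) by linarith
qed

lemma slice_le_below:
  assumes "slice a" "adj y z" "a y < p" "vert y p" shows "a z \<le> below z p"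
proof -
  have "a z < a y + 2 * d y" "vert z (a z)" "vert y (a y)"
    using assms(1,2) unfolding slice_def by blast+
  thus ?thesis using vert_less[of y "a y" p] assms(3,4) by (intro le_below) auto
qed

lemma meshD: "mesh W \<Longrightarrow> vert y p \<Longrightarrow> W y p + W y (p - 2 * d y) = (\<Sum>z | adj y z. W z (below z p))"
  by (simp add: mesh_def)

lemma mesh_eqI_above:
  assumes "slice a" "mesh W" "mesh W'" "\<And>y. W y (a y) = W' y (a y)"
    and "vert y p" "a y \<le> p"
  shows "W y p = W' y p"
proof -
  obtain m where mm: "\<And>y. m \<le> a y" using ex_lower_bound by metis
  show ?thesis using assms(5,6)
  proof (induction "nat (p - m)" arbitrary: y p rule: less_induct)
    case less
    show ?case
    proof (cases "p = a y")
      case False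
      hence lt: "a y < p" using less.prems by simp
      have va: "vert y (a y)" using assms(1) by (simp add: slice_def)
      have m: "m \<le> a y" by (rule mm)
      have le: "a y \<le> p - 2 * d y" using vert_less[OF va less.prems(1) lt] by simp
      have "W z (below z p) = W' z (below z p)" if "adj y z" for z
        using slice_le_below[OF assms(1) that lt less.prems(1)] below_less[of z p] m lt
        by (intro less.hyps vert_below) auto
      moreover have "W y (p - 2 * d y) = W' y (p - 2 * d y)"
        using le d_pos[of y] m lt less.prems(1) by (intro less.hyps) auto
      ultimately show ?thesis
        using meshD[OF assms(2) less.prems(1)] meshD[OF assms(3) less.prems(1)]
        by (metis (mono_tags, lifting) add_right_cancel mem_Collect_eq sum.cong)
    qed (use assms(4) in auto)
  qed
qed

lemma mesh_eqI_below:
  assumes "slice a" "mesh W" "mesh W'" "\<And>y. W y (a y) = W' y (a y)"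
    and "vert y p" "p \<le> a y"
  shows "W y p = W' y p"
proof -
  obtain m where mm: "\<And>y. a y + 2 * d y \<le> m" using ex_upper_bound[of "\<lambda>y. a y + 2 * d y"] by blast
  show ?thesis using assms(5,6)
  \<comment> \<open>The relation used is the one at \<open>p + 2 * d y\<close>. The level of a
    neighbour \<open>z\<close> in it can be smaller than \<open>p\<close> if
    \<open>d z > d y\<close>; what always grows, by \<open>below_gt\<close>, is the level of the
    next vertex.\<close>
  proof (induction "nat (m - (p + 2 * d y))" arbitrary: y p rule: less_induct)
    case less
    show ?case
    proof (cases "p = a y")
      case False
      hence lt: "p < a y" using less.prems by simp
      define P where "P = p + 2 * d y"
      have vP: "vert y P" using less.prems by (simp add: P_def)
      have va: "vert y (a y)" using assms(1) by (simp add: slice_def)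
      have le: "P \<le> a y" using vert_less[OF less.prems(1) va lt] by (simp add: P_def)
      have m: "a y + 2 * d y \<le> m" by (rule mm)
      have "W z (below z P) = W' z (below z P)" if "adj y z" for z
        using below_le_slice[OF assms(1) that le] below_gt[OF that vP] m le d_pos[of y]
        unfolding P_def[symmetric]
        by (intro less.hyps vert_below) (auto simp: P_def)
      moreover have "W y P = W' y P"
        using le d_pos[of y] m vP by (intro less.hyps) (auto simp: P_def)
      moreover have "p = P - 2 * d y" by (simp add: P_def)
      ultimately show ?thesis
        using meshD[OF assms(2) vP] meshD[OF assms(3) vP]
        by (metis (mono_tags, lifting) add_left_cancel mem_Collect_eq sum.cong)
    qed (use assms(4) in auto)
  qed
qed

lemma mesh_eqI:
  assumes "slice a" "mesh W" "mesh W'" "\<And>y. W y (a y) = W' y (a y)" "vert y p"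
  shows "W y p = W' y p"
  using mesh_eqI_above[OF assms] mesh_eqI_below[OF assms] by linarith

context
  fixes a :: "'v \<Rightarrow> int" and f :: "'v \<Rightarrow> 'b::ab_group_add"
begin

function extend_up :: "'v \<Rightarrow> int \<Rightarrow> 'b" where
  "extend_up y p = (if p \<le> a y then f y
     else (\<Sum>z | adj y z. extend_up z (below z p)) - extend_up y (p - 2 * d y))"
  by pat_completeness auto
termination
proof -
  obtain m where mm: "\<And>y. m \<le> a y" using ex_lower_bound by metis
  show ?thesis
  proof (relation "measure (\<lambda>(y, p). nat (p - m))")
    fix y p z assume h: "\<not> p \<le> a y"
    have m: "m \<le> a y" by (rule mm)
    show "((z, below z p), y, p) \<in> measure (\<lambda>(y, p). nat (p - m))"
      using m h below_less[of z p] by simp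
    show "((y, p - 2 * d y), y, p) \<in> measure (\<lambda>(y, p). nat (p - m))"
      using m h d_pos[of y] by simp
  qed simp
qed

text \<open>Off the vertices the value is the default \<open>f y\<close>, because
  \<open>below_gt\<close>, and with it termination, is available at vertices only.\<close>

function extend_down :: "'v \<Rightarrow> int \<Rightarrow> 'b" where
  "extend_down y p = (if a y \<le> p \<or> \<not> vert y p then f y
     else (\<Sum>z\<in>{z. adj y z}. extend_down z (below z (p + 2 * d y))) - extend_down y (p + 2 * d y))"
  by pat_completeness auto
termination
proof -
  obtain m where mm: "\<And>y. a y + 2 * d y \<le> m" using ex_upper_bound[of "\<lambda>y. a y + 2 * d y"] by blast
  show ?thesis
  proof (relation "measure (\<lambda>(y, p). nat (m - (p + 2 * d y)))")
    fix y p assume h: "\<not> (a y \<le> p \<or> \<not> vert y p)"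
    have m: "a y + 2 * d y \<le> m" by (rule mm)
    show "((y, p + 2 * d y), y, p) \<in> measure (\<lambda>(y, p). nat (m - (p + 2 * d y)))"
      using m h d_pos[of y] by simp
  next
    fix y p z assume h: "\<not> (a y \<le> p \<or> \<not> vert y p)"
    have m: "a y + 2 * d y \<le> m" by (rule mm)
    assume "z \<in> {z. adj y z}"
    hence "p + 2 * d y < below z (p + 2 * d y) + 2 * d z" using h by (intro below_gt) auto
    thus "((z, below z (p + 2 * d y)), y, p) \<in> measure (\<lambda>(y, p). nat (m - (p + 2 * d y)))"
      using m h by simp
  qed simp
qed

declare extend_up.simps [simp del] extend_down.simps [simp del]

lemma ex_mesh:
  assumes "slice a"
  obtains W where "mesh W" "\<And>y. W y (a y) = f y"
proof -
  define W where "W y p = (if a y \<le> p then extend_up y p else extend_down y p)" for y p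
  have dn: "W y p = extend_down y p" if "p \<le> a y" for y p
    using that by (auto simp: W_def extend_down.simps[of y p] extend_up.simps[of y p])
  have up: "W y p = extend_up y p" if "a y \<le> p" for y p
    using that by (auto simp: W_def)
  have "W y (a y) = f y" for y by (simp add: up extend_up.simps)
  moreover have "mesh W" unfolding mesh_def
  proof (intro allI impI)
    fix y p assume v: "vert y p"
    have va: "vert y (a y)" using assms by (simp add: slice_def)
    show "W y p + W y (p - 2 * d y) = (\<Sum>z | adj y z. W z (below z p))"
    proof (cases "p \<le> a y")
      case True
      have "(\<Sum>z | adj y z. W z (below z p)) = (\<Sum>z | adj y z. extend_down z (below z p))"
        using below_le_slice[OF assms _ True] dn by (intro sum.cong) auto
      thus ?thesis using True d_pos[of y] v dn[of p y] dn[of "p - 2 * d y" y]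
        by (simp add: extend_down.simps[of y "p - 2 * d y"])
    next
      case False
      hence lt: "a y < p" by simp
      have "(\<Sum>z | adj y z. W z (below z p)) = (\<Sum>z | adj y z. extend_up z (below z p))"
        using slice_le_below[OF assms _ lt v] up by (intro sum.cong) auto
      thus ?thesis using False up[of y p] up[of y "p - 2 * d y"] vert_less[OF va v lt]
        by (simp add: extend_up.simps[of y p])
    qed
  qed
  ultimately show ?thesis using that by blast
qed

end

end

section \<open>Cutting a mesh off above a slice\<close>

context repetition_quiver
begin

text \<open>Freezing \<open>A\<close> above the slice, instead of replacing it by 0, makes
  \<open>increment\<close> a plain difference and keeps the mesh relation true up to a constant
  defect at one vertex.\<close>

definition trunc :: "('v \<Rightarrow> int) \<Rightarrow> ('v \<Rightarrow> int \<Rightarrow> 'b) \<Rightarrow> 'v \<Rightarrow> int \<Rightarrow> 'b::ab_group_add" where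
  "trunc a A y p = A y (min p (a y))"

definition increment :: "('v \<Rightarrow> int) \<Rightarrow> ('v \<Rightarrow> int \<Rightarrow> 'b) \<Rightarrow> 'v \<Rightarrow> int \<Rightarrow> 'b::ab_group_add" where
  "increment a A y p = (if p \<le> a y then A y p - A y (p - 2 * d y) else 0)"

lemma trunc_high: "a y \<le> p \<Longrightarrow> trunc a A y p = A y (a y)"
  by (simp add: trunc_def min_def)

lemma increment_eq_trunc:
  assumes "slice a" "vert y p"
  shows "increment a A y p = trunc a A y p - trunc a A y (p - 2 * d y)"
proof (cases "p \<le> a y")
  case True
  thus ?thesis using d_pos[of y] by (simp add: increment_def trunc_def min_def)
next
  case False
  have "vert y (a y)" using assms(1) by (simp add: slice_def)
  from vert_less[OF this assms(2)] False show ?thesis by (simp add: increment_def trunc_high)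
qed

text \<open>Above the slice every term is frozen, and the relation becomes the Cartan equation
  \<open>dual\<close>, whose right-hand side is the defect.\<close>

lemma trunc_mesh_defect:
  fixes A :: "'v \<Rightarrow> int \<Rightarrow> 'b::comm_ring_1"
  assumes "slice a" "mesh A" "vert y p"
    and dual: "\<And>y. 2 * A y (a y) - (\<Sum>z | adj y z. A z (a z)) = (if y = x then 1 else 0)"
  shows "trunc a A y p + trunc a A y (p - 2 * d y) =
    (\<Sum>z | adj y z. trunc a A z (below z p)) + (if y = x \<and> a x < p then 1 else 0)"
proof (cases "p \<le> a y")
  case True
  have "(\<Sum>z | adj y z. trunc a A z (below z p)) = (\<Sum>z | adj y z. A z (below z p))"
    using below_le_slice[OF assms(1) _ True] by (intro sum.cong) (auto simp: trunc_def)
  thus ?thesis using meshD[OF assms(2,3)] True d_pos[of y] by (auto simp: trunc_def)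
next
  case False
  hence lt: "a y < p" by simp
  have "vert y (a y)" using assms(1) by (simp add: slice_def)
  from vert_less[OF this assms(3) lt] have "trunc a A y (p - 2 * d y) = A y (a y)"
    by (simp add: trunc_high)
  moreover have "trunc a A y p = A y (a y)" using lt by (simp add: trunc_def)
  moreover have "(\<Sum>z | adj y z. trunc a A z (below z p)) = (\<Sum>z | adj y z. A z (a z))"
    using slice_le_below[OF assms(1) _ lt assms(3)]
    by (intro sum.cong refl) (auto intro: trunc_high)
  ultimately show ?thesis using dual[of y] lt by (auto simp: algebra_simps split: if_splits)
qed

lemma finite_levels: "finite {q. vert z q \<and> m \<le> q \<and> q < n}"
  by (rule finite_subset[of _ "{m..<n}"]) auto

lemma below_add1: "below z (n + 1) = (if vert z n then n else below z n)"
proof (cases "vert z n")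
  case True
  thus ?thesis using d_pos[of z] by (auto intro!: below_eqI)
next
  case False
  hence "n \<noteq> below z n + 2 * d z" using vert_up vert_below by metis
  with False show ?thesis using below_ge[of n z] below_less[of z n]
    by (auto intro!: below_eqI vert_below)
qed

lemma sum_increment:
  assumes "slice a" "m \<le> n"
  shows "(\<Sum>q | vert z q \<and> m \<le> q \<and> q < n. increment a A z q) =
    trunc a A z (below z n) - trunc a A z (below z m)"
  using assms(2)
proof (induction n rule: int_ge_induct)
  case base
  have "{q. vert z q \<and> m \<le> q \<and> q < m} = {}" by auto
  thus ?case by (simp only: sum.empty) simp
next
  case (step n)
  show ?case
  proof (cases "vert z n")
    case True
    have "{q. vert z q \<and> m \<le> q \<and> q < n + 1} = insert n {q. vert z q \<and> m \<le> q \<and> q < n}"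
      using step.hyps True by auto
    moreover have "below z n = n - 2 * d z" using True d_pos[of z] by (intro below_eqI) auto
    ultimately show ?thesis
      using step.IH True increment_eq_trunc[OF assms(1) True, of A]
      by (simp add: finite_levels below_add1)
  next
    case False
    have "{q. vert z q \<and> m \<le> q \<and> q < n + 1} = {q. vert z q \<and> m \<le> q \<and> q < n}"
      using False by (auto simp: order_less_le)
    thus ?thesis using step.IH False by (simp add: below_add1)
  qed
qed

text \<open>The difference of the relations for \<open>trunc\<close> at \<open>p + 2 * d y\<close>
  and at \<open>p\<close>. The neighbour terms telescope by \<open>sum_increment\<close>; the defect
  is a step function of the level, so it survives only at the step, \<open>p = a x\<close>.\<close>

lemma increment_recursion:
  fixes A :: "'v \<Rightarrow> int \<Rightarrow> 'b::comm_ring_1"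
  assumes "slice a" "mesh A" "vert y p"
    and dual: "\<And>y. 2 * A y (a y) - (\<Sum>z | adj y z. A z (a z)) = (if y = x then 1 else 0)"
  shows "increment a A y (p + 2 * d y) + increment a A y p =
    (\<Sum>z | adj y z. \<Sum>q | vert z q \<and> p < q \<and> q < p + 2 * d y. increment a A z q) +
    (if y = x \<and> p = a x then 1 else 0)"
proof -
  define P where "P = p + 2 * d y"
  have vP: "vert y P" using assms(3) by (simp add: P_def)
  have *: "(\<Sum>q | vert z q \<and> p < q \<and> q < P. increment a A z q) =
      trunc a A z (below z P) - trunc a A z (below z p)" if "adj y z" for z
  proof -
    have "{q. vert z q \<and> p < q \<and> q < P} = {q. vert z q \<and> p \<le> q \<and> q < P}"
      using adj_vert[OF that assms(3)] by (auto simp: order_less_le)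
    thus ?thesis using sum_increment[OF assms(1), of p P] d_pos[of y] by (simp add: P_def)
  qed
  have va: "vert y (a y)" using assms(1) by (simp add: slice_def)
  have eq: "a y < P \<longleftrightarrow> a y < p \<or> p = a y"
    using vert_less[OF assms(3) va] vert_less[OF va vP] d_pos[of y] unfolding P_def by linarith
  have "increment a A y P + increment a A y p =
      (trunc a A y P + trunc a A y (P - 2 * d y)) - (trunc a A y p + trunc a A y (p - 2 * d y))"
    using increment_eq_trunc[OF assms(1) vP, of A] increment_eq_trunc[OF assms(1,3), of A]
    by (simp add: P_def)
  also have "\<dots> = (\<Sum>z | adj y z. trunc a A z (below z P) - trunc a A z (below z p)) +
      (if y = x \<and> p = a x then 1 else 0)"
    using trunc_mesh_defect[OF assms(1,2) vP dual] trunc_mesh_defect[OF assms(1,2,3) dual] eq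
    by (auto simp: sum_subtractf)
  also have "(\<Sum>z | adj y z. trunc a A z (below z P) - trunc a A z (below z p)) =
      (\<Sum>z | adj y z. \<Sum>q | vert z q \<and> p < q \<and> q < P. increment a A z q)"
    using * by (intro sum.cong) auto
  finally show ?thesis by (simp add: P_def)
qed

text \<open>At every \<open>y \<noteq> x\<close> the equation \<open>dual\<close> is homogeneous, so
  the mesh relation continues the values on the slice unchanged. The bound on \<open>p\<close> is
  the first level of \<open>x\<close> above the slice, where this breaks down.\<close>

lemma mesh_const_above_slice:
  fixes A :: "'v \<Rightarrow> int \<Rightarrow> 'b::comm_ring_1"
  assumes "slice a" "mesh A"
    and dual: "\<And>y. 2 * A y (a y) - (\<Sum>z | adj y z. A z (a z)) = (if y = x then 1 else 0)"
    and "vert y p" "a y \<le> p" "p < a x + 2 * d x"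
  shows "A y p = A y (a y)"
proof -
  obtain m where mm: "\<And>y. m \<le> a y" using ex_lower_bound by metis
  show ?thesis using assms(4-6)
  proof (induction "nat (p - m)" arbitrary: y p rule: less_induct)
    case less
    show ?case
    proof (cases "p = a y")
      case False
      hence lt: "a y < p" using less.prems by simp
      have va: "vert y (a y)" using assms(1) by (simp add: slice_def)
      have m: "m \<le> a y" by (rule mm)
      have le: "a y \<le> p - 2 * d y" using vert_less[OF va less.prems(1) lt] by simp
      have "A z (below z p) = A z (a z)" if "adj y z" for z
        using slice_le_below[OF assms(1) that lt less.prems(1)] below_less[of z p] m lt less.prems(3)
        by (intro less.hyps vert_below) auto
      moreover have "A y (p - 2 * d y) = A y (a y)"
        using le d_pos[of y] m lt less.prems by (intro less.hyps) auto
      moreover have "y \<noteq> x" using le less.prems(3) by auto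
      ultimately show ?thesis
        using meshD[OF assms(2) less.prems(1)] dual[of y] by (simp add: eq_diff_eq[symmetric])
    qed auto
  qed
qed

lemma increment_eq_diff:
  fixes A :: "'v \<Rightarrow> int \<Rightarrow> 'b::comm_ring_1"
  assumes "slice a" "mesh A"
    and dual: "\<And>y. 2 * A y (a y) - (\<Sum>z | adj y z. A z (a z)) = (if y = x then 1 else 0)"
    and "vert y p" "p < a x + 2 * d x"
  shows "increment a A y p = A y p - A y (p - 2 * d y)"
proof (cases "p \<le> a y")
  case False
  have "vert y (a y)" using assms(1) by (simp add: slice_def)
  from vert_less[OF this assms(4)] False have "a y \<le> p - 2 * d y" by simp
  with False show ?thesis
    using mesh_const_above_slice[OF assms(1-4) _ assms(5)] d_pos[of y] assms(4,5)
      mesh_const_above_slice[OF assms(1-3), of y "p - 2 * d y"]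
    by (simp add: increment_def)
qed (simp add: increment_def)

end

section \<open>Foldings and compatible readings\<close>

text \<open>\<open>r\<close> is the common size of the orbits with more than one element. By
  \<open>unique_neighbour\<close> the edges between adjacent orbits of equal size form a perfect
  matching, so such an orbit enters a mesh relation with one term.\<close>

locale folding =
  fixes adj :: "'v::finite \<Rightarrow> 'v \<Rightarrow> bool" and \<sigma> :: "'v \<Rightarrow> 'v" and \<epsilon> :: "'v \<Rightarrow> int" and r :: nat
  assumes adj_sym': "adj x y \<Longrightarrow> adj y x"
    and bij_\<sigma>: "bij \<sigma>"
    and adj_\<sigma>: "adj (\<sigma> x) (\<sigma> y) \<longleftrightarrow> adj x y"
    and adj_orbit: "adj x y \<Longrightarrow> orbit \<sigma> x \<noteq> orbit \<sigma> y"
    and card_orbit: "card (orbit \<sigma> x) = 1 \<or> card (orbit \<sigma> x) = r"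
    and unique_neighbour: "adj x y \<Longrightarrow> adj x z \<Longrightarrow> orbit \<sigma> y = orbit \<sigma> z \<Longrightarrow>
      card (orbit \<sigma> x) = card (orbit \<sigma> y) \<Longrightarrow> y = z"
    and parity: "parity_function adj \<sigma> \<epsilon>"
begin

abbreviation d :: "'v \<Rightarrow> int" where "d x \<equiv> int (card (orbit \<sigma> x))"

lemma perm: "permutation \<sigma>"
  using bij_\<sigma> by (simp add: permutation)

lemma self_in_orbit: "x \<in> orbit \<sigma> x"
  by (rule permutation_self_in_orbit[OF perm])

lemma orbit_eq_of_mem: "y \<in> orbit \<sigma> x \<Longrightarrow> orbit \<sigma> y = orbit \<sigma> x"
  using cyclic_on_orbit'[OF perm] orbit_cyclic_eq3 by metis

lemma orbit_\<sigma>: "orbit \<sigma> (\<sigma> x) = orbit \<sigma> x"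
  by (rule permutation_orbit_step[OF perm])

lemma orbit_funpow: "orbit \<sigma> ((\<sigma> ^^ l) x) = orbit \<sigma> x"
  by (induction l) (auto simp: orbit_\<sigma>)

lemma card_orbit_pos: "0 < card (orbit \<sigma> x)"
  using self_in_orbit[of x] by (auto simp: card_gt_0_iff)

lemma card_orbit_eq_dist: "card (orbit \<sigma> x) = funpow_dist1 \<sigma> x x"
  using orbit_conv_funpow_dist1[OF self_in_orbit[of x]] inj_on_funpow_dist1[OF self_in_orbit[of x]]
  by (metis card_image card_atLeastLessThan minus_nat.diff_0)

lemma in_orbitE:
  assumes "y \<in> orbit \<sigma> x" obtains l where "l < card (orbit \<sigma> x)" "y = (\<sigma> ^^ l) x"
  using assms orbit_conv_funpow_dist1[OF self_in_orbit[of x]] unfolding card_orbit_eq_dist by auto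

lemma funpow_card_orbit: "(\<sigma> ^^ card (orbit \<sigma> x)) x = x"
  using funpow_dist1_prop[OF self_in_orbit[of x]] unfolding card_orbit_eq_dist .

lemma fixed_iff: "card (orbit \<sigma> x) = 1 \<longleftrightarrow> \<sigma> x = x"
proof
  assume "card (orbit \<sigma> x) = 1"
  thus "\<sigma> x = x" using funpow_card_orbit[of x] by simp
next
  assume "\<sigma> x = x"
  hence "orbit \<sigma> x = {x}" by (simp add: orbit_eq_singleton_iff)
  thus "card (orbit \<sigma> x) = 1" by simp
qed

lemma adj_funpow: "adj ((\<sigma> ^^ l) x) ((\<sigma> ^^ l) y) \<longleftrightarrow> adj x y"
  by (induction l) (auto simp: adj_\<sigma>)

lemma card_cases:
  obtains "card (orbit \<sigma> x) = card (orbit \<sigma> y)"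
  | "card (orbit \<sigma> x) = 1" "card (orbit \<sigma> y) = r" "1 < r"
  | "card (orbit \<sigma> x) = r" "card (orbit \<sigma> y) = 1" "1 < r"
  using card_orbit[of x] card_orbit[of y] card_orbit_pos[of x] card_orbit_pos[of y] by linarith

lemma min_dvd: "min (d x) (d y) dvd d x" "min (d x) (d y) dvd d y"
  by (cases rule: card_cases[of x y]; simp add: min_def)+

lemma \<epsilon>_adj:
  assumes "adj x y" shows "2 * min (d x) (d y) dvd \<epsilon> x - (\<epsilon> y + min (d x) (d y))"
proof -
  have "[\<epsilon> x = \<epsilon> y + min (d x) (d y)] (mod (2 * min (d x) (d y)))"
    using parity assms unfolding parity_function_def by blast
  thus ?thesis by (simp only: cong_iff_dvd_diff)
qed

lemma \<epsilon>_funpow: "2 * d x dvd \<epsilon> ((\<sigma> ^^ l) x) - (\<epsilon> x - 2 * int l)"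
proof -
  have "[\<epsilon> (int_funpow \<sigma> (int l) x) = \<epsilon> x - 2 * int l] (mod (2 * d x))"
    using parity unfolding parity_function_def by blast
  thus ?thesis by (simp add: int_funpow_def cong_iff_dvd_diff)
qed

lemma \<epsilon>_even: assumes "orbit \<sigma> x = orbit \<sigma> y" shows "even (\<epsilon> x - \<epsilon> y)"
proof -
  have "[\<epsilon> x = \<epsilon> y] (mod 2)" using parity assms unfolding parity_function_def by blast
  thus ?thesis by (simp add: cong_iff_dvd_diff)
qed

text \<open>Since sizes are 1 or \<open>r\<close>, the smaller period divides the larger, and the
  level conditions at both ends can be compared modulo the smaller one.\<close>

lemma adj_level_diff:
  assumes "adj x y" "2 * d x dvd p - \<epsilon> x" "2 * d y dvd q - \<epsilon> y"
  shows "2 * min (d x) (d y) dvd p - q - min (d x) (d y)"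
proof -
  let ?m = "min (d x) (d y)"
  have "2 * ?m dvd p - \<epsilon> x" "2 * ?m dvd q - \<epsilon> y"
    using assms(2,3) min_dvd[of x y] by (meson dvd_trans mult_dvd_mono dvd_refl)+
  hence "2 * ?m dvd (p - \<epsilon> x) + (\<epsilon> x - (\<epsilon> y + ?m)) - (q - \<epsilon> y)"
    using \<epsilon>_adj[OF assms(1)] by (metis dvd_add dvd_diff)
  thus ?thesis by (simp add: algebra_simps)
qed

sublocale repetition_quiver adj d \<epsilon>
proof
  fix x y p assume *: "adj x y" "2 * d x dvd p - \<epsilon> x"
  show "\<not> 2 * d y dvd p - \<epsilon> y"
  proof
    assume "2 * d y dvd p - \<epsilon> y"
    from adj_level_diff[OF * this] have "2 * min (d x) (d y) dvd min (d x) (d y)" by simp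
    moreover have "0 < min (d x) (d y)" using card_orbit_pos[of x] card_orbit_pos[of y] by simp
    ultimately show False using zdvd_imp_le by fastforce
  qed
qed (use adj_sym' card_orbit_pos in auto)

lemma adj_vert_diff:
  "adj x y \<Longrightarrow> vert x p \<Longrightarrow> vert y q \<Longrightarrow> 2 * min (d x) (d y) dvd p - q - min (d x) (d y)"
  unfolding vert_def by (rule adj_level_diff)

lemma vert_neighbour:
  assumes "adj x y" "vert x p" "d y \<le> d x" "2 * d y dvd p - q - d y"
  shows "vert y q"
proof -
  have "2 * d y dvd p - \<epsilon> y - d y"
    using adj_vert_diff[OF assms(1,2), of "\<epsilon> y"] assms(3) by (simp add: vert_def min_def split: if_splits)
  hence "2 * d y dvd (p - \<epsilon> y - d y) - (p - q - d y)" using assms(4) by (metis dvd_diff)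
  thus ?thesis by (simp add: vert_def)
qed

lemma vert_same_parity:
  assumes "orbit \<sigma> x = orbit \<sigma> y" "vert x p" "vert y q" shows "even (p - q)"
proof -
  have "even (p - \<epsilon> x)" "even (q - \<epsilon> y)" using assms(2,3) unfolding vert_def
    by (meson dvd_mult_left)+
  thus ?thesis using \<epsilon>_even[OF assms(1)] by auto
qed

lemma vert_funpow: "vert ((\<sigma> ^^ l) x) (p - 2 * int l) \<longleftrightarrow> vert x p"
proof -
  let ?e = "\<epsilon> ((\<sigma> ^^ l) x) - (\<epsilon> x - 2 * int l)"
  have "2 * d x dvd (p - \<epsilon> x) - ?e \<longleftrightarrow> 2 * d x dvd p - \<epsilon> x"
    using \<epsilon>_funpow[of x l] by (rule dvd_diff_left_iff)
  moreover have "(p - \<epsilon> x) - ?e = p - 2 * int l - \<epsilon> ((\<sigma> ^^ l) x)" by simp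
  ultimately show ?thesis by (simp only: vert_def orbit_funpow)
qed

lemma vert_\<sigma>: "vert (\<sigma> x) (p - 2) \<longleftrightarrow> vert x p"
  using vert_funpow[of 1 x p] by simp

text \<open>Each step along an orbit shifts the levels by -2, modulo twice the size of the orbit, so
  the offsets run once through the residues of one parity. With \<open>ex_vert\<close> this puts
  exactly one vertex of the orbit on each level of that parity.\<close>

lemma vert_unique:
  assumes "orbit \<sigma> x = orbit \<sigma> y" "vert x p" "vert y p" shows "x = y"
proof -
  obtain l where l: "l < card (orbit \<sigma> x)" "y = (\<sigma> ^^ l) x"
    using in_orbitE[of y x] self_in_orbit[of y] assms(1) by metis
  have "vert x (p + 2 * int l)" using vert_funpow[of l x "p + 2 * int l"] assms(3) l(2) by simp
  with vert_less[OF assms(2) this] l(1) have "l = 0" by (cases "l = 0") auto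
  thus ?thesis using l(2) by simp
qed

lemma ex_vert:
  assumes "vert x q" "even (p - q)" obtains y where "y \<in> orbit \<sigma> x" "vert y p"
proof -
  obtain k where k: "p = q - 2 * k"
    using assms(2) by (metis add_diff_cancel_left' diff_add_cancel evenE minus_diff_eq mult_minus_right)
  define l where "l = nat (k mod d x)"
  have l: "int l = k mod d x" using card_orbit_pos[of x] by (simp add: l_def)
  have "k = d x * (k div d x) + int l" by (simp add: l)
  hence "p = q - 2 * (d x * (k div d x) + int l)" using k by simp
  hence "p = q - 2 * int l + 2 * d x * (- (k div d x))" by (simp add: algebra_simps)
  moreover have "vert ((\<sigma> ^^ l) x) (q - 2 * int l)" using vert_funpow assms(1) by blast
  ultimately have "vert ((\<sigma> ^^ l) x) p"
    using vert_shift[of "(\<sigma> ^^ l) x" "q - 2 * int l" "- (k div d x)"] by (simp add: orbit_funpow)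
  thus thesis using that funpow_in_orbit[OF self_in_orbit] by blast
qed

lemma below_\<sigma>: "below (\<sigma> y) (p - 2) = below y p - 2"
  using vert_\<sigma>[of y "below y p"] vert_below[of y p] below_less[of y p] below_ge[of p y]
  by (intro below_eqI) (auto simp: orbit_\<sigma>)

lemma adj_fixed: assumes "card (orbit \<sigma> y) = 1" "adj y z" "z' \<in> orbit \<sigma> z" shows "adj y z'"
proof -
  obtain l where "z' = (\<sigma> ^^ l) z" using assms(3) by (rule in_orbitE)
  moreover have "\<sigma> y = y" using fixed_iff assms(1) by blast
  hence "(\<sigma> ^^ l) y = y" by (induction l) auto
  ultimately show ?thesis using adj_funpow[of l y z] assms(2) by simp
qed

lemma rep_vertices_iff: "(x, p) \<in> rep_vertices \<sigma> \<epsilon> \<longleftrightarrow> vert x p"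
  by (simp add: rep_vertices_def vert_def)

text \<open>If the orbit of \<open>z\<close> is the larger one, then \<open>y\<close> is fixed by
  \<sigma> and adjacent to that entire orbit, one member of which sits on level
  \<open>p + 1\<close>.\<close>

lemma ex_arrow:
  assumes "vert y p" "adj y z"
  obtains z' where "rep_arrow adj \<sigma> \<epsilon> (y, p) (z', p + min (d y) (d z))" "orbit \<sigma> z' = orbit \<sigma> z"
    "d z \<le> d y \<Longrightarrow> z' = z"
proof (cases "d z \<le> d y")
  case True
  have "p - (p + d z) - d z = 2 * d z * (- 1)" by simp
  hence "vert z (p + d z)" by (intro vert_neighbour[OF assms(2,1) True]) (metis dvd_triv_left)
  thus ?thesis using True assms that[of z] by (simp add: rep_arrow_def rep_vertices_iff min_def)
next
  case False
  hence c: "card (orbit \<sigma> y) = 1" "1 \<le> card (orbit \<sigma> z)"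
    using card_cases[of y z] card_orbit_pos[of z] by fastforce+
  have v: "vert z (\<epsilon> z)" by (simp add: vert_def)
  have "even (p + 1 - \<epsilon> z)" using adj_vert_diff[OF assms(2,1) v] c by simp
  then obtain z' where z': "z' \<in> orbit \<sigma> z" "vert z' (p + 1)" using ex_vert[OF v] by blast
  have "adj y z'" using adj_fixed[OF c(1) assms(2) z'(1)] .
  thus ?thesis using that[of z'] False c z' orbit_eq_of_mem[OF z'(1)] assms(1)
    by (simp add: rep_arrow_def rep_vertices_iff)
qed

section \<open>Regions between two slices and their compatible readings\<close>

definition region :: "('v \<Rightarrow> int) \<Rightarrow> ('v \<Rightarrow> int) \<Rightarrow> ('v \<times> int) set" where
  "region b a = {(y, p). vert y p \<and> b y < p \<and> p \<le> a y}"

lemma finite_region: "finite (region b a)"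
proof (rule finite_subset)
  show "region b a \<subseteq> (SIGMA y:UNIV. {b y<..a y})" by (auto simp: region_def)
qed auto

lemma slice_above:
  assumes "slice b" "adj y z" "vert y p" "b y < p" shows "b z < p"
proof -
  have "vert y (b y)" "b z < b y + 2 * d y" using assms(1,2) by (auto simp: slice_def)
  thus ?thesis using vert_less[of y "b y" p] assms(3,4) by simp
qed

lemma slice_downset:
  assumes "slice a" "adj y z" "vert z q" "q < p" "p \<le> a y" shows "q \<le> a z"
proof (rule ccontr)
  assume "\<not> q \<le> a z"
  moreover have "vert z (a z)" "a y < a z + 2 * d z"
    using assms(1,2) adj_sym by (auto simp: slice_def)
  ultimately show False using vert_less[of z "a z" q] assms(3-5) by simp
qed

lemma compatible_head:
  assumes "compatible_reading adj \<sigma> \<epsilon> X (u # us)" "v \<in> X"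
  shows "\<not> rep_arrow adj \<sigma> \<epsilon> u v"
proof
  assume *: "rep_arrow adj \<sigma> \<epsilon> u v"
  obtain k where k: "k < length (u # us)" "(u # us) ! k = v"
    using assms unfolding compatible_reading_def by (metis in_set_conv_nth)
  have "\<forall>k<length (u # us). \<forall>k'<length (u # us).
      rep_arrow adj \<sigma> \<epsilon> ((u # us) ! k') ((u # us) ! k) \<longrightarrow> k < k'"
    using assms(1) unfolding compatible_reading_def by blast
  from this[rule_format, of k 0] * k show False by auto
qed

lemma compatible_tail:
  assumes "compatible_reading adj \<sigma> \<epsilon> X (u # us)"
  shows "compatible_reading adj \<sigma> \<epsilon> (X - {u}) us"
proof -
  have *: "k < k'" if "k < length us" "k' < length us" "rep_arrow adj \<sigma> \<epsilon> (us ! k') (us ! k)" for k k'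
  proof -
    have "\<forall>k<length (u # us). \<forall>k'<length (u # us).
        rep_arrow adj \<sigma> \<epsilon> ((u # us) ! k') ((u # us) ! k) \<longrightarrow> k < k'"
      using assms unfolding compatible_reading_def by blast
    from this[rule_format, of "Suc k" "Suc k'"] that show ?thesis by simp
  qed
  have "distinct us" "set us = X - {u}"
    using assms unfolding compatible_reading_def by (simp, force)
  thus ?thesis unfolding compatible_reading_def using * by blast
qed

text \<open>A higher neighbour in the region would pull the target of some arrow out of the head
  into the region as well, against compatibility.\<close>

lemma head_neighbour_below:
  assumes "compatible_reading adj \<sigma> \<epsilon> (region b a) ((y, p) # us)" "slice a" "slice b"
    and "(y, p) \<in> region b a" "(z, q) \<in> region b a" "adj y z"
  shows "q \<le> p"
proof (rule ccontr)
  assume "\<not> q \<le> p"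
  hence pq: "p < q" by simp
  have yp: "vert y p" "b y < p" "p \<le> a y" and zq: "vert z q" "q \<le> a z"
    using assms(4,5) by (auto simp: region_def)
  obtain z' where z': "rep_arrow adj \<sigma> \<epsilon> (y, p) (z', p + min (d y) (d z))"
      "orbit \<sigma> z' = orbit \<sigma> z" "d z \<le> d y \<Longrightarrow> z' = z"
    using ex_arrow[OF yp(1) assms(6)] by blast
  define m where "m = min (d y) (d z)"
  have m: "0 < m" using d_pos by (simp add: m_def)
  have az: "adj y z'" "vert z' (p + m)" using z'(1) by (auto simp: rep_arrow_def rep_vertices_iff m_def)
  have "b z' < p + m" using slice_above[OF assms(3) az(1) yp(1,2)] m by simp
  moreover have "p + m \<le> a z'"
  proof (cases "d z \<le> d y")
    case True
    hence "p + m \<le> q" using vert_less[of z q "p + m"] zq(1) az(2) z'(3) pq m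
      by (cases "q < p + m") (auto simp: m_def)
    thus ?thesis using zq z'(3)[OF True] by simp
  next
    case False
    hence m1: "m = 1" "d y = 1" using card_cases[of y z] unfolding m_def by fastforce+
    show ?thesis
    \<comment> \<open>The target on level \<open>p + 1\<close> may be another member of the orbit of
      \<open>z\<close>. If \<open>q\<close> is higher, the vertex \<open>(y, p + 2)\<close> lies
      under the slice because of \<open>(z, q)\<close>, and the target because of
      \<open>(y, p + 2)\<close>.\<close>
    proof (cases "q = p + 1")
      case True
      thus ?thesis using vert_unique[OF z'(2), of q] az(2) zq m1 by simp
    next
      case False
      have "vert y (p + 2)" using vert_up[of y p] yp(1) m1 by simp
      have "p + 2 < q" using False pq adj_vert[OF assms(6) \<open>vert y (p + 2)\<close>] zq(1)
        by (cases "q = p + 2") auto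
      have "p + 2 \<le> a y"
        using slice_downset[OF assms(2) adj_sym[OF assms(6)] \<open>vert y (p + 2)\<close> \<open>p + 2 < q\<close> zq(2)] .
      thus ?thesis using slice_downset[OF assms(2) az(1,2), of "p + 2"] m1 by simp
    qed
  qed
  ultimately have "(z', p + m) \<in> region b a" using az(2) by (simp add: region_def)
  thus False using compatible_head[OF assms(1)] z'(1) by (simp add: m_def)
qed

text \<open>Letters over the same \<open>y\<close> are ordered only by paths through a neighbour. An
  isolated vertex (type \<open>A\<^sub>1\<close>) has no arrows, hence the alternative that the
  region holds at most one letter over \<open>y\<close>.\<close>

lemma head_top:
  assumes "compatible_reading adj \<sigma> \<epsilon> (region b a) ((y, p) # us)" "slice a" "slice b"
    and "(y, p) \<in> region b a" "a y \<le> b y + 2 * d y \<or> (\<exists>z. adj y z)"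
  shows "p = a y"
proof (rule ccontr)
  assume "p \<noteq> a y"
  have yp: "vert y p" "b y < p" "p < a y" using assms(4) \<open>p \<noteq> a y\<close> by (auto simp: region_def)
  have v: "vert y (a y)" "vert y (b y)" using assms(2,3) by (auto simp: slice_def)
  have 1: "p + 2 * d y \<le> a y" "b y + 2 * d y \<le> p" using vert_less v yp by blast+
  then obtain z where z: "adj y z" using assms(5) d_pos[of y] by force
  obtain z' where z': "rep_arrow adj \<sigma> \<epsilon> (y, p) (z', p + min (d y) (d z))"
    using ex_arrow[OF yp(1) z] by blast
  define m where "m = min (d y) (d z)"
  have m: "0 < m" "m \<le> d y" using d_pos by (auto simp: m_def)
  have az: "adj y z'" "vert z' (p + m)" using z' by (auto simp: rep_arrow_def rep_vertices_iff m_def)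
  have "b z' < p + m" using slice_above[OF assms(3) az(1) yp(1,2)] m by simp
  moreover have "p + m \<le> a z'"
    by (rule slice_downset[OF assms(2) az, of "a y"]) (use m 1 in auto)
  ultimately have "(z', p + m) \<in> region b a" using az(2) by (simp add: region_def)
  thus False using compatible_head[OF assms(1)] z' by (simp add: m_def)
qed

text \<open>Reading a letter \<open>(y, a y)\<close> replaces the slice \<open>a\<close> by the one which has \<open>y\<close> lowered to its
  next vertex, and the mesh relation is exactly what the reflection at \<open>y\<close> does to \<open>\<varpi>\<^sub>y\<close>.\<close>

lemma foldr_reflection_mesh:
  assumes "compatible_reading adj \<sigma> \<epsilon> (region b a) xs" "slice a" "slice b" "\<And>y. b y \<le> a y"
    and "\<And>y. a y \<le> b y + 2 * d y \<or> (\<exists>z. adj y z)"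
    and "mesh W" "additive T" "\<And>y. T (fund_weight y) = W y (a y)"
  shows "T (foldr (\<lambda>a w. reflection adj (fst a) \<circ> w) xs id (fund_weight y)) = W y (b y)"
  using assms
proof (induction xs arbitrary: a T)
  case Nil
  have "region b a = {}" using Nil.prems(1) by (simp add: compatible_reading_def)
  moreover have "vert y (a y)" using Nil.prems(2) by (simp add: slice_def)
  ultimately have "a y = b y" using Nil.prems(4)[of y] by (auto simp: region_def order_le_less)
  thus ?case using Nil.prems by simp
next
  case (Cons u xs)
  obtain y0 p where u: "u = (y0, p)" by (cases u)
  have mem: "(y0, p) \<in> region b a" using Cons.prems(1) by (auto simp: compatible_reading_def u)
  have p: "p = a y0" using head_top[OF _ Cons.prems(2,3) mem Cons.prems(5)] Cons.prems(1) u by blast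
  have v: "vert z (a z)" "vert z (b z)" for z using Cons.prems(2,3) by (auto simp: slice_def)
  have lt: "b y0 < p" using mem by (simp add: region_def)
  \<comment> \<open>So each neighbour stands on its last vertex before \<open>p\<close>, and the
    mesh relation at \<open>p\<close> involves values on the current slice only.\<close>
  have nb: "a z < p" if "adj y0 z" for z
  proof (rule ccontr)
    assume "\<not> a z < p"
    moreover have "a z \<noteq> p" using adj_vert[OF that v(1)] v(1) p by metis
    ultimately have "p < a z" by simp
    moreover have "b z < p" using slice_above[OF Cons.prems(3) that, of p] v(1)[of y0] p lt by simp
    ultimately have "(z, a z) \<in> region b a" using v by (simp add: region_def)
    from head_neighbour_below[OF _ Cons.prems(2,3) mem this that] Cons.prems(1) u \<open>p < a z\<close>
    show False by simp
  qed
  define a' where "a' = a(y0 := a y0 - 2 * d y0)"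
  have "region b a' = region b a - {u}"
    using vert_less[OF _ v(1)] p u d_pos[of y0]
    by (auto simp: region_def a'_def order_le_less split: if_splits) force+
  hence 1: "compatible_reading adj \<sigma> \<epsilon> (region b a') xs" using compatible_tail[OF Cons.prems(1)] by simp
  have 2: "slice a'" unfolding slice_def
  proof (intro conjI allI impI)
    show "vert z (a' z)" for z using v by (simp add: a'_def)
    fix z z' assume *: "adj z z'"
    have "z \<noteq> z'" using adj_orbit[OF *] by auto
    have "a z' < a z + 2 * d z" using Cons.prems(2) * by (simp add: slice_def)
    thus "a' z' < a' z + 2 * d z"
      using nb[of z'] * d_pos[of y0] \<open>z \<noteq> z'\<close> p by (auto simp: a'_def)
  qed
  have 4: "b z \<le> a' z" for z
    using Cons.prems(4)[of z] vert_less[OF v(2) v(1), of y0] lt p by (simp add: a'_def)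
  have 5: "a' z \<le> b z + 2 * d z \<or> (\<exists>w. adj z w)" for z
    using Cons.prems(5)[of z] d_pos[of z] by (auto simp: a'_def)
  \<comment> \<open>The word is consumed from its left end, so the letters already read accumulate
    on the right of \<open>T\<close>; this is why the induction generalises over
    \<open>T\<close>.\<close>
  have T: "additive (T \<circ> reflection adj y0)" using Cons.prems(7) additive_reflection by (rule additive_comp)
  have 8: "(T \<circ> reflection adj y0) (fund_weight z) = W z (a' z)" for z
  proof (cases "z = y0")
    case True
    have "W y0 (a y0) + W y0 (a y0 - 2 * d y0) = (\<Sum>z | adj y0 z. W z (below z (a y0)))"
      using meshD[OF Cons.prems(6) v(1)] .
    also have "\<dots> = (\<Sum>z | adj y0 z. W z (a z))"
    proof (intro sum.cong refl)
      fix z assume z: "z \<in> {z. adj y0 z}"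
      have "a y0 < a z + 2 * d z" using z Cons.prems(2) adj_sym by (auto simp: slice_def)
      thus "W z (below z (a y0)) = W z (a z)"
        using nb[of z] z p v(1) by (intro arg_cong[of _ _ "W z"] below_eqI) auto
    qed
    finally have "W y0 (a y0 - 2 * d y0) = (\<Sum>z | adj y0 z. W z (a z)) - W y0 (a y0)"
      by (simp add: eq_diff_eq add.commute)
    thus ?thesis using True Cons.prems(8)
      by (simp add: a'_def reflection_fund_weight additive.diff[OF Cons.prems(7)]
          additive.sum[OF Cons.prems(7)])
  qed (use Cons.prems(8) in \<open>simp add: a'_def reflection_fund_weight\<close>)
  show ?case using Cons.IH[OF 1 2 Cons.prems(3) 4 5 Cons.prems(6) T 8] by (simp add: u)
qed

text \<open>Arrows strictly raise the level, so any ordering by decreasing level is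
  compatible.\<close>

lemma ex_compatible_reading: assumes "finite X" shows "\<exists>xs. compatible_reading adj \<sigma> \<epsilon> X xs"
proof -
  obtain ys where ys: "set ys = X" "distinct ys" using finite_distinct_list[OF assms] by blast
  define xs where "xs = rev (sort_key snd ys)"
  have "k < k'" if "k < length xs" "k' < length xs" "rep_arrow adj \<sigma> \<epsilon> (xs ! k') (xs ! k)" for k k'
  proof (rule ccontr)
    assume "\<not> k < k'"
    hence "k' \<le> k" by simp
    have len: "k < length ys" "k' < length ys" using that(1,2) by (auto simp: xs_def)
    have "sorted (map snd (sort_key snd ys))" by simp
    hence "map snd (sort_key snd ys) ! (length ys - Suc k) \<le> map snd (sort_key snd ys) ! (length ys - Suc k')"
      using \<open>k' \<le> k\<close> len by (intro sorted_nth_mono) auto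
    hence "snd (xs ! k) \<le> snd (xs ! k')" using len unfolding xs_def by (simp add: rev_nth)
    moreover have "0 < min (d a) (d b)" for a b using d_pos by simp
    ultimately show False using that(3) unfolding rep_arrow_def by (metis diff_gt_0_iff_gt linorder_not_le)
  qed
  moreover have "set xs = X" "distinct xs" using ys by (auto simp: xs_def)
  ultimately have "compatible_reading adj \<sigma> \<epsilon> X xs" by (simp add: compatible_reading_def)
  thus ?thesis ..
qed

lemma adj_irrefl: "\<not> adj y y"
  using adj_orbit by blast

lemma additive_weyl_word: "additive (weyl_word adj \<sigma> \<epsilon> X)"
  unfolding weyl_word_def by (rule additive_foldr_reflection)

lemma bij_weyl_word: "bij (weyl_word adj \<sigma> \<epsilon> X)"
  unfolding weyl_word_def by (rule bij_foldr_reflection) (rule adj_irrefl)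

text \<open>Every compatible reading leads to the same values, in particular the one chosen by
  \<open>weyl_word\<close>. The map \<open>T\<close> leaves room for further factors on the
  left.\<close>

lemma weyl_word_mesh:
  assumes "slice a" "slice b" "\<And>y. b y \<le> a y" "\<And>y. a y \<le> b y + 2 * d y \<or> (\<exists>z. adj y z)"
    and "mesh W" "additive T" "\<And>y. T (fund_weight y) = W y (a y)"
  shows "T (weyl_word adj \<sigma> \<epsilon> (region b a) (fund_weight y)) = W y (b y)"
  unfolding weyl_word_def
  by (rule foldr_reflection_mesh[OF someI_ex[OF ex_compatible_reading[OF finite_region]] assms])

end

section \<open>Q-data and twisted Coxeter elements\<close>

text \<open>\<open>card_le_2\<close> singles out the triality orbit, whose vertices have a fixed
  neighbour; \<open>ex_neighbour\<close> supplies the side condition of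
  \<open>head_top\<close>.\<close>

locale q_datum = folding +
  fixes \<xi> :: "'a \<Rightarrow> int"
  assumes height: "height_function adj \<sigma> \<epsilon> \<xi>"
    and card_le_order: "card (orbit \<sigma> x) \<le> aut_order \<sigma>"
    and card_le_2: "card (orbit \<sigma> x) \<le> 2 \<or> (\<exists>z. adj x z \<and> card (orbit \<sigma> z) = 1)"
    and ex_neighbour: "card (orbit \<sigma> x) \<noteq> 1 \<Longrightarrow> \<exists>z. adj x z"
begin

lemma vert_\<xi>: "vert y (\<xi> y)"
  using height by (simp add: height_function_def vert_def)

lemma \<xi>_adj_same: "adj x y \<Longrightarrow> card (orbit \<sigma> x) = card (orbit \<sigma> y) \<Longrightarrow> \<bar>\<xi> x - \<xi> y\<bar> = d x"
  using height by (simp add: height_function_def)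

lemma \<xi>_adj_fixed:
  assumes "adj x y" "card (orbit \<sigma> x) < card (orbit \<sigma> y)"
  obtains t where "t \<in> orbit \<sigma> y" "\<bar>\<xi> x - \<xi> t\<bar> = 1"
    "\<And>l. l < card (orbit \<sigma> y) \<Longrightarrow> \<xi> ((\<sigma> ^^ l) t) = \<xi> t - 2 * int l"
proof -
  have "orbit_adj adj (orbit \<sigma> x) (orbit \<sigma> y)"
    using assms(1) self_in_orbit unfolding orbit_adj_def by blast
  hence "\<exists>!t. t \<in> orbit \<sigma> y \<and> \<bar>\<xi> x - \<xi> t\<bar> = 1 \<and> (\<forall>l<aut_order \<sigma>. \<xi> ((\<sigma> ^^ l) t) = \<xi> t - 2 * int l)"
    using height assms(2) self_in_orbit[of x] unfolding height_function_def orbits_def by blast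
  thus ?thesis using that card_le_order[of y] by (metis order_less_le_trans)
qed

lemma \<xi>_inj: "orbit \<sigma> y = orbit \<sigma> z \<Longrightarrow> \<xi> y = \<xi> z \<Longrightarrow> y = z"
  using vert_unique vert_\<xi> by metis

section \<open>Orbit summits and the auxiliary slices\<close>

definition summit :: "'a \<Rightarrow> 'a" where "summit y = orbit_top \<xi> (orbit \<sigma> y)"

definition height_max :: "'a \<Rightarrow> int" where "height_max y = \<xi> (summit y)"

lemma finite_orb: "finite (orbit \<sigma> y)"
  by (rule finite_orbit[OF self_in_orbit])

lemma summit_Max: "summit y \<in> orbit \<sigma> y \<and> \<xi> (summit y) = Max (\<xi> ` orbit \<sigma> y)"
proof -
  have "Max (\<xi> ` orbit \<sigma> y) \<in> \<xi> ` orbit \<sigma> y"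
    using self_in_orbit[of y] finite_orb by (intro Max_in) auto
  then obtain t where t: "t \<in> orbit \<sigma> y" "\<xi> t = Max (\<xi> ` orbit \<sigma> y)" by auto
  show ?thesis unfolding summit_def orbit_top_def
    by (rule theI[of _ t]) (use t orbit_eq_of_mem \<xi>_inj in metis)+
qed

lemma summit_in_orbit: "summit y \<in> orbit \<sigma> y"
  using summit_Max by blast

lemma orbit_summit: "orbit \<sigma> (summit y) = orbit \<sigma> y"
  by (rule orbit_eq_of_mem[OF summit_in_orbit])

lemma height_max_cong: "orbit \<sigma> y = orbit \<sigma> z \<Longrightarrow> height_max y = height_max z"
  by (simp add: height_max_def summit_def)

lemma \<xi>_le_height_max: "\<xi> y \<le> height_max y"
  using summit_Max[of y] finite_orb self_in_orbit by (simp add: height_max_def)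

lemma vert_summit: "vert (summit y) (height_max y)"
  unfolding height_max_def by (rule vert_\<xi>)

text \<open>A vertex from which the heights descend along the whole orbit is the highest. This
  identifies the element singled out by condition (b) with the summit.\<close>

lemma summit_eqI:
  assumes "t \<in> orbit \<sigma> y" "\<And>l. l < card (orbit \<sigma> y) \<Longrightarrow> \<xi> ((\<sigma> ^^ l) t) = \<xi> t - 2 * int l"
  shows "summit y = t"
proof -
  have o: "orbit \<sigma> t = orbit \<sigma> y" by (rule orbit_eq_of_mem[OF assms(1)])
  obtain l where l: "l < card (orbit \<sigma> t)" "summit y = (\<sigma> ^^ l) t"
    using in_orbitE[of "summit y" t] summit_in_orbit o by metis
  have "\<xi> (summit y) \<le> \<xi> t" using assms(2)[of l] l o by simp
  moreover have "\<xi> t \<le> \<xi> (summit y)"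
    using \<xi>_le_height_max[of t] height_max_cong[OF o] by (simp add: height_max_def)
  ultimately show ?thesis using \<xi>_inj[of "summit y" t] o orbit_summit by simp
qed

lemma orbit_fixed: assumes "card (orbit \<sigma> y) = 1" shows "orbit \<sigma> y = {y}"
  using assms fixed_iff by (simp add: orbit_eq_singleton_iff)

lemma summit_fixed: "card (orbit \<sigma> y) = 1 \<Longrightarrow> summit y = y"
  using summit_in_orbit[of y] orbit_fixed[of y] by simp

lemma \<xi>_adj_top:
  assumes "adj x y" "card (orbit \<sigma> x) < card (orbit \<sigma> y)"
  shows "\<bar>\<xi> x - height_max y\<bar> = 1"
    and "l < card (orbit \<sigma> y) \<Longrightarrow> \<xi> ((\<sigma> ^^ l) (summit y)) = height_max y - 2 * int l"
    and "height_max x = \<xi> x"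
proof -
  obtain t where t: "t \<in> orbit \<sigma> y" "\<bar>\<xi> x - \<xi> t\<bar> = 1"
      "\<And>l. l < card (orbit \<sigma> y) \<Longrightarrow> \<xi> ((\<sigma> ^^ l) t) = \<xi> t - 2 * int l"
    using \<xi>_adj_fixed[OF assms] by blast
  have summit: "summit y = t" by (rule summit_eqI[OF t(1,3)])
  show "\<bar>\<xi> x - height_max y\<bar> = 1" using t(2) summit by (simp add: height_max_def)
  show "\<xi> ((\<sigma> ^^ l) (summit y)) = height_max y - 2 * int l" if "l < card (orbit \<sigma> y)"
    using t(3)[OF that] summit by (simp add: height_max_def)
  have "card (orbit \<sigma> x) = 1" using card_cases[of x y] assms(2) by fastforce
  thus "height_max x = \<xi> x" by (simp add: height_max_def summit_fixed)
qed

lemma height_max_adj: assumes "adj y z" shows "height_max z \<le> height_max y + min (d y) (d z)"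
proof -
  consider "card (orbit \<sigma> y) = card (orbit \<sigma> z)" | "card (orbit \<sigma> y) < card (orbit \<sigma> z)"
    | "card (orbit \<sigma> z) < card (orbit \<sigma> y)" by linarith
  thus ?thesis
  proof cases
    case 1
    \<comment> \<open>Moving the edge by \<sigma> puts \<open>z\<close> on its summit, while the
      other end stays at most as high as the maximum of its orbit.\<close>
    obtain l where l: "summit z = (\<sigma> ^^ l) z" using in_orbitE[OF summit_in_orbit] by metis
    have "adj (summit z) ((\<sigma> ^^ l) y)" using adj_sym[OF assms] by (simp add: l adj_funpow)
    from \<xi>_adj_same[OF this] 1 have "\<bar>\<xi> (summit z) - \<xi> ((\<sigma> ^^ l) y)\<bar> = d z"
      by (simp add: orbit_summit orbit_funpow)
    moreover have "\<xi> ((\<sigma> ^^ l) y) \<le> height_max y"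
      using \<xi>_le_height_max height_max_cong orbit_funpow by metis
    ultimately show ?thesis using 1 by (simp add: height_max_def)
  next
    case 2
    thus ?thesis using \<xi>_adj_top(1,3)[OF assms 2] card_orbit_pos[of y] by linarith
  next
    case 3
    thus ?thesis using \<xi>_adj_top(1,3)[OF adj_sym[OF assms] 3] card_orbit_pos[of z] by linarith
  qed
qed

text \<open>The height function with the same orbit maxima as \<open>\<xi>\<close> whose values descend in steps of 2
  along every orbit: \<open>X'\<close> is the region between \<open>\<xi>\<close> and \<open>\<zeta>\<close>, and \<open>X\<^sup>\<circ>\<close> the one between \<open>\<zeta>\<close> and
  its shift \<open>\<eta>\<close>.\<close>

definition \<zeta> :: "'a \<Rightarrow> int" where "\<zeta> y = below y (height_max y + 1)"

text \<open>Comparing maxima gives only \<open>\<zeta> z - \<zeta> y - m < 2 * d y\<close> for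
  \<open>m = min (d y) (d z)\<close>. Both sides are multiples of \<open>2 * m\<close>, so the bound
  improves by \<open>2 * m\<close> to
  \<open>\<zeta> z \<le> \<zeta> y + 2 * d y - m\<close>.\<close>

lemma slice_\<zeta>: "slice \<zeta>"
  unfolding slice_def
proof (intro conjI allI impI)
  show v: "vert y (\<zeta> y)" for y by (simp add: \<zeta>_def vert_below)
  fix y z assume yz: "adj y z"
  let ?m = "min (d y) (d z)"
  have m: "0 < ?m" using d_pos by simp
  obtain k where k: "\<zeta> z - \<zeta> y - ?m = 2 * ?m * k"
    using adj_vert_diff[OF adj_sym[OF yz] v v] by (auto simp: min.commute)
  obtain e where e: "d y = ?m * e" using min_dvd(1) by blast
  have "\<zeta> z \<le> height_max z" using below_less[of z "height_max z + 1"] by (simp add: \<zeta>_def)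
  moreover have "height_max y + 1 \<le> \<zeta> y + 2 * d y" using below_ge by (simp add: \<zeta>_def)
  ultimately have "\<zeta> z - \<zeta> y - ?m < 2 * d y" using height_max_adj[OF yz] by linarith
  hence "2 * ?m * k < 2 * ?m * e" using k e by (metis mult.assoc)
  hence "k + 1 \<le> e" using m by simp
  hence "2 * ?m * (k + 1) \<le> 2 * ?m * e" using m by (intro mult_left_mono) auto
  hence "2 * ?m * k + 2 * ?m \<le> 2 * d y" using e by (simp only: distrib_left mult_1_right mult.assoc)
  thus "\<zeta> z < \<zeta> y + 2 * d y" using k m by linarith
qed

lemma \<xi>_le_\<zeta>: "\<xi> y \<le> \<zeta> y"
  using \<xi>_le_height_max[of y] unfolding \<zeta>_def by (intro le_below vert_\<xi>) simp

lemma slice_\<xi>: "slice \<xi>"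
  unfolding slice_def
proof (intro conjI allI impI vert_\<xi>)
  fix y z assume yz: "adj y z"
  consider "card (orbit \<sigma> y) = card (orbit \<sigma> z)" | "card (orbit \<sigma> y) < card (orbit \<sigma> z)"
    | "card (orbit \<sigma> z) < card (orbit \<sigma> y)" by linarith
  thus "\<xi> z < \<xi> y + 2 * d y"
  proof cases
    case 1
    thus ?thesis using \<xi>_adj_same[OF yz] d_pos[of y] by linarith
  next
    case 2
    thus ?thesis using \<xi>_adj_top(1)[OF yz 2] \<xi>_le_height_max[of z] d_pos[of y] by linarith
  next
    case 3
    \<comment> \<open>In its orbit \<open>y\<close> lies at most \<open>d y - 1\<close> steps of 2
      below the summit, and \<open>\<xi> z\<close> exceeds the height of the summit by at most
      1.\<close>
    obtain l where l: "l < card (orbit \<sigma> y)" "y = (\<sigma> ^^ l) (summit y)"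
      using in_orbitE[of y "summit y"] self_in_orbit[of y] orbit_summit by metis
    have "\<xi> y = height_max y - 2 * int l" using \<xi>_adj_top(2)[OF adj_sym[OF yz] 3 l(1)] l(2) by simp
    thus ?thesis using \<xi>_adj_top(1)[OF adj_sym[OF yz] 3] l(1) by linarith
  qed
qed

lemma below_height_max: "vert y p \<Longrightarrow> p \<le> \<zeta> y \<longleftrightarrow> p \<le> height_max y"
  using le_below[of y p "height_max y + 1"] below_less[of y "height_max y + 1"] by (auto simp: \<zeta>_def)

lemma X_prime_eq: "X_prime \<sigma> \<epsilon> \<xi> = region \<xi> \<zeta>"
proof (intro set_eqI iffI; clarify)
  fix y p assume "(y, p) \<in> X_prime \<sigma> \<epsilon> \<xi>"
  then obtain w where w: "y = \<sigma> (summit w)" "vert y p" "\<xi> y < p" "p \<le> height_max w - 2"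
    unfolding X_prime_def orbits_def rep_vertices_iff summit_def height_max_def by auto
  have "height_max y = height_max w"
    by (rule height_max_cong) (simp add: w(1) orbit_\<sigma> orbit_summit)
  thus "(y, p) \<in> region \<xi> \<zeta>" using w below_height_max[OF w(2)] by (simp add: region_def)
next
  fix y p assume "(y, p) \<in> region \<xi> \<zeta>"
  hence p: "vert y p" "\<xi> y < p" "p \<le> height_max y"
    using below_height_max by (auto simp: region_def)
  have ne: "y \<noteq> summit y" using p(2,3) by (auto simp: height_max_def)
  have "p \<noteq> height_max y"
    using vert_unique[OF orbit_summit vert_summit] p(1) ne by metis
  moreover have "even (p - height_max y)"
    using vert_same_parity[OF _ p(1) vert_summit] orbit_summit by metis
  ultimately have le: "p \<le> height_max y - 2" using p(3) by presburger
  obtain l where l: "l < card (orbit \<sigma> y)" "y = (\<sigma> ^^ l) (summit y)"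
    using in_orbitE[of y "summit y"] self_in_orbit[of y] orbit_summit by metis
  \<comment> \<open>In a larger orbit the fixed neighbour forces descent in steps of 2, so \<xi>
    agrees with \<zeta> there and leaves no letter. In an orbit of two the only vertex besides the
    summit is its image under \<sigma>.\<close>
  have "card (orbit \<sigma> y) \<le> 2"
  proof (rule ccontr)
    assume big: "\<not> card (orbit \<sigma> y) \<le> 2"
    then obtain z where z: "adj y z" "card (orbit \<sigma> z) = 1" using card_le_2 by blast
    have "\<xi> y = height_max y - 2 * int l"
      using \<xi>_adj_top(2)[OF adj_sym[OF z(1)] _ l(1)] z(2) big l(2) by simp
    moreover have "\<xi> y + 2 * d y \<le> p" by (rule vert_less[OF vert_\<xi> p(1,2)])
    ultimately show False using p(3) l(1) by simp
  qed
  hence "l = 0 \<or> l = 1" using l(1) by linarith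
  hence "y = \<sigma> (summit y)" using l(2) ne by auto
  thus "(y, p) \<in> X_prime \<sigma> \<epsilon> \<xi>"
    using p le unfolding X_prime_def orbits_def rep_vertices_iff summit_def height_max_def by auto
qed

definition \<eta> :: "'a \<Rightarrow> int" where "\<eta> y = below y (height_max y - 1)"

lemma \<eta>_\<sigma>: "\<eta> (\<sigma> y) = \<zeta> y - 2"
  using below_\<sigma>[of y "height_max y + 1"] height_max_cong[OF orbit_\<sigma>[of y]] by (simp add: \<eta>_def \<zeta>_def)

lemma slice_\<eta>: "slice \<eta>"
  unfolding slice_def
proof (intro conjI allI impI)
  show "vert y (\<eta> y)" for y by (simp add: \<eta>_def vert_below)
  fix y z assume yz: "adj y z"
  obtain y' z' where [simp]: "y = \<sigma> y'" "z = \<sigma> z'" using bij_\<sigma> by (metis bij_pointE)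
  have "\<zeta> z' < \<zeta> y' + 2 * d y'" using slice_\<zeta> yz by (simp add: slice_def adj_\<sigma>)
  thus "\<eta> z < \<eta> y + 2 * d y" by (simp add: \<eta>_\<sigma> orbit_\<sigma>)
qed

text \<open>By parity, the only level within distance 1 below the maximum of an orbit that carries
  one of its vertices is the maximum itself, and the vertex is the summit.\<close>

lemma X_circ_eq: "X_circ \<sigma> \<xi> = region \<eta> \<zeta>"
proof (intro set_eqI iffI; clarify)
  fix y p assume "(y, p) \<in> X_circ \<sigma> \<xi>"
  then obtain w where w: "y = summit w" "p = height_max w"
    unfolding X_circ_def orbits_def summit_def height_max_def by auto
  have "height_max y = height_max w" by (rule height_max_cong) (simp add: w(1) orbit_summit)
  thus "(y, p) \<in> region \<eta> \<zeta>" using w vert_summit[of w] below_height_max[of y p]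
      below_less[of y "height_max y - 1"] by (simp add: region_def \<eta>_def)
next
  fix y p assume "(y, p) \<in> region \<eta> \<zeta>"
  hence p: "vert y p" "\<eta> y < p" "p \<le> height_max y"
    using below_height_max by (auto simp: region_def)
  have "height_max y - 1 \<le> p" 
    by (rule ccontr) (use le_below[OF p(1), of "height_max y - 1"] p(2) in \<open>simp add: \<eta>_def\<close>)
  moreover have "even (p - height_max y)"
    using vert_same_parity[OF _ p(1) vert_summit] orbit_summit by metis
  ultimately have eq: "p = height_max y" using p(3) by presburger
  hence "y = summit y" using vert_unique[OF _ p(1), of "summit y"] vert_summit orbit_summit by metis
  thus "(y, p) \<in> X_circ \<sigma> \<xi>" using eq
    unfolding X_circ_def orbits_def summit_def height_max_def by (auto intro: exI[of _ "orbit \<sigma> y"])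
qed

section \<open>The mesh of the twisted Coxeter element\<close>

abbreviation \<tau> :: "'a weight \<Rightarrow> 'a weight" where "\<tau> \<equiv> twisted_coxeter adj \<sigma> \<epsilon> \<xi>"

lemma bij_\<tau>: "bij \<tau>"
  unfolding twisted_coxeter_def tau_circ_def
  by (intro bij_comp bij_imp_bij_inv bij_weyl_word bij_weight_aut bij_\<sigma>)

lemma additive_\<tau>: "additive \<tau>"
  unfolding twisted_coxeter_def tau_circ_def
  by (intro additive_comp additive_inv additive_weyl_word bij_weyl_word additive_weight_aut)

lemma mesh_additive: assumes "mesh W" "additive T" shows "mesh (\<lambda>y p. T (W y p))"
  unfolding mesh_def
  using meshD[OF assms(1)] additive.add[OF assms(2)] additive.sum[OF assms(2)] by metis

text \<open>The map sending \<open>(y, p)\<close> to \<open>(\<sigma> y, p - 2)\<close> is an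
  automorphism of the repetition quiver.\<close>

lemma mesh_\<sigma>: assumes "mesh W" shows "mesh (\<lambda>y p. W (\<sigma> y) (p - 2))"
  unfolding mesh_def
proof (intro allI impI)
  fix y p assume v: "vert y p"
  have "W (\<sigma> y) (p - 2) + W (\<sigma> y) (p - 2 - 2 * d (\<sigma> y)) = (\<Sum>z | adj (\<sigma> y) z. W z (below z (p - 2)))"
    using meshD[OF assms] v by (simp add: vert_\<sigma>)
  also have "{z. adj (\<sigma> y) z} = \<sigma> ` {z. adj y z}"
    using bij_\<sigma> by (auto simp: adj_\<sigma> image_iff) (metis adj_\<sigma> bij_pointE)
  also have "(\<Sum>z\<in>\<sigma> ` {z. adj y z}. W z (below z (p - 2))) =
      (\<Sum>z | adj y z. W (\<sigma> z) (below z p - 2))"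
    using inj_on_subset[OF bij_is_inj[OF bij_\<sigma>]] by (subst sum.reindex) (auto simp: below_\<sigma>)
  finally show "W (\<sigma> y) (p - 2) + W (\<sigma> y) (p - 2 * d y - 2) =
      (\<Sum>z | adj y z. W (\<sigma> z) (below z p - 2))"
    by (simp add: orbit_\<sigma> algebra_simps)
qed

lemma \<eta>_le_\<zeta>: "\<eta> y \<le> \<zeta> y"
  unfolding \<zeta>_def \<eta>_def using below_less[of y "height_max y - 1"]
    le_below[OF vert_below, of y "height_max y - 1" "height_max y + 1"] by linarith

lemma \<zeta>_le_\<eta>: "\<zeta> y \<le> \<eta> y + 2 * d y"
proof -
  have "\<zeta> y < height_max y + 1" unfolding \<zeta>_def by (rule below_less)
  moreover have "height_max y - 1 \<le> \<eta> y + 2 * d y" unfolding \<eta>_def by (rule below_ge)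
  moreover have "vert y (\<zeta> y)" "vert y (\<eta> y + 2 * d y)" by (simp_all add: \<zeta>_def \<eta>_def vert_below)
  ultimately show ?thesis
    using vert_less[of y "\<eta> y + 2 * d y" "\<zeta> y"] d_pos[of y] by linarith
qed

text \<open>On the mesh normalised along \<zeta>, \<open>tau_circ\<close> takes the values on
  \<zeta> to the shifted ones by reading X\<degree>. The conjugation in the definition of \<tau>
  moves the normalisation from \<zeta> to \<xi>.\<close>

lemma ex_coxeter_mesh:
  obtains W where "mesh W" "\<And>y. W y (\<xi> y) = fund_weight y"
    "\<And>y p. vert y p \<Longrightarrow> \<tau> (W y p) = W (\<sigma> y) (p - 2)"
proof -
  let ?w' = "weyl_word adj \<sigma> \<epsilon> (X_prime \<sigma> \<epsilon> \<xi>)"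
  let ?w = "weyl_word adj \<sigma> \<epsilon> (X_circ \<sigma> \<xi>)"
  obtain V where V: "mesh V" "\<And>y. V y (\<zeta> y) = fund_weight y" using ex_mesh[OF slice_\<zeta>] by blast
  have nb: "\<zeta> y \<le> \<xi> y + 2 * d y \<or> (\<exists>z. adj y z)" for y
  proof (cases "card (orbit \<sigma> y) = 1")
    case True
    hence "\<zeta> y < \<xi> y + 1" using below_less[of y "height_max y + 1"]
      by (simp add: \<zeta>_def height_max_def summit_fixed)
    thus ?thesis using d_pos[of y] by simp
  qed (use ex_neighbour in blast)
  have w': "T (?w' (fund_weight y)) = W y (\<xi> y)"
    if "mesh W" "additive T" "\<And>y. T (fund_weight y) = W y (\<zeta> y)" for W T y
    unfolding X_prime_eq by (rule weyl_word_mesh[OF slice_\<zeta> slice_\<xi> \<xi>_le_\<zeta> nb that])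
  have V\<xi>: "V y (\<xi> y) = ?w' (fund_weight y)" for y
    using w'[of V id y] V by (simp add: additive_def)
  define W where "W y p = inv ?w' (V y p)" for y p
  have add: "additive (inv ?w')" by (intro additive_inv additive_weyl_word bij_weyl_word)
  have mesh: "mesh W" unfolding W_def by (rule mesh_additive[OF V(1) add])
  have W\<xi>: "W y (\<xi> y) = fund_weight y" for y
    using bij_weyl_word by (simp add: W_def V\<xi> bij_is_inj)
  have "inv ?w' (?w (fund_weight y)) = W y (\<eta> y)" for y
    unfolding X_circ_eq
    by (rule weyl_word_mesh[OF slice_\<zeta> slice_\<eta> \<eta>_le_\<zeta> _ mesh add]) (auto simp: \<zeta>_le_\<eta> W_def V(2))
  hence T: "(inv ?w' \<circ> tau_circ adj \<sigma> \<epsilon> \<xi>) (fund_weight y) = W (\<sigma> y) (\<zeta> y - 2)" for y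
    by (simp add: tau_circ_def weight_aut_fund_weight \<eta>_\<sigma>)
  have addT: "additive (inv ?w' \<circ> tau_circ adj \<sigma> \<epsilon> \<xi>)"
    unfolding tau_circ_def by (intro additive_comp add additive_weyl_word additive_weight_aut)
  \<comment> \<open>The word of X' is read a second time, now on the shifted mesh, which it carries
    from \<zeta> to \<xi>.\<close>
  have "\<tau> (fund_weight y) = W (\<sigma> y) (\<xi> y - 2)" for y
    using w'[OF mesh_\<sigma>[OF mesh] addT T] by (simp add: twisted_coxeter_def)
  hence "\<tau> (W y (\<xi> y)) = W (\<sigma> y) (\<xi> y - 2)" for y by (simp add: W\<xi>)
  hence "\<tau> (W y p) = W (\<sigma> y) (p - 2)" if "vert y p" for y p
    using mesh_eqI[OF slice_\<xi> mesh_additive[OF mesh additive_\<tau>] mesh_\<sigma>[OF mesh] _ that] by blast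
  thus ?thesis using that mesh W\<xi> by blast
qed

lemma coxeter_mesh_power:
  assumes W: "\<And>y p. vert y p \<Longrightarrow> \<tau> (W y p) = W (\<sigma> y) (p - 2)" and "vert y p"
  shows "int_funpow \<tau> k (W y p) = W (int_funpow \<sigma> k y) (p - 2 * k)"
    and "vert (int_funpow \<sigma> k y) (p - 2 * k)"
proof -
  have pos: "(\<tau> ^^ n) (W y p) = W ((\<sigma> ^^ n) y) (p - 2 * int n) \<and> vert ((\<sigma> ^^ n) y) (p - 2 * int n)" for n
  proof (induction n)
    case (Suc n)
    have "p - 2 * int (Suc n) = p - 2 * int n - 2" by simp
    thus ?case using Suc.IH W vert_\<sigma> by (simp only: funpow.simps o_apply)
  qed (use assms(2) in simp)
  have inv: "inv \<tau> (W z q) = W (inv \<sigma> z) (q + 2) \<and> vert (inv \<sigma> z) (q + 2)" if "vert z q" for z q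
  proof -
    have *: "\<sigma> (inv \<sigma> z) = z" using bij_\<sigma> by (simp add: bij_is_surj surj_f_inv_f)
    hence v: "vert (inv \<sigma> z) (q + 2)" using vert_\<sigma>[of "inv \<sigma> z" "q + 2"] that by simp
    have "\<tau> (W (inv \<sigma> z) (q + 2)) = W z q" using W[OF v] * by simp
    thus ?thesis using v bij_\<tau> by (metis bij_inv_eq_iff)
  qed
  have neg: "(inv \<tau> ^^ n) (W y p) = W ((inv \<sigma> ^^ n) y) (p + 2 * int n) \<and>
      vert ((inv \<sigma> ^^ n) y) (p + 2 * int n)" for n
  proof (induction n)
    case (Suc n)
    have "p + 2 * int (Suc n) = p + 2 * int n + 2" by simp
    thus ?case using Suc.IH inv by (simp only: funpow.simps o_apply)
  qed (use assms(2) in simp)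
  show "int_funpow \<tau> k (W y p) = W (int_funpow \<sigma> k y) (p - 2 * k)"
    "vert (int_funpow \<sigma> k y) (p - 2 * k)"
    using pos[of "nat k"] neg[of "nat (- k)"] by (auto simp: int_funpow_def)
qed

end

section \<open>Rows of the inverse quantum Cartan matrix\<close>

text \<open>For adjacent orbits this is the number of terms of the entry [c_kj]_z, that is, the
  ceiling in \<open>folded_cartan\<close> when the smaller of two different sizes is 1.\<close>

definition quantum_length :: "'v set \<Rightarrow> 'v set \<Rightarrow> nat" where
  "quantum_length k j = (if card k < card j then card j else 1)"

context q_datum
begin

text \<open>By \<open>vert_unique\<close> at most one summand is present; the sum avoids naming the
  vertex of the orbit that lies on level \<open>p\<close>.\<close>

definition orbit_increment :: "('a \<Rightarrow> int \<Rightarrow> 'b::comm_ring_1) \<Rightarrow> 'a set \<Rightarrow> int \<Rightarrow> 'b" where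
  "orbit_increment A j p = (\<Sum>y | y \<in> j \<and> vert y p. increment \<xi> A y p)"

lemma orbit_in_orbits: "orbit \<sigma> y \<in> orbits \<sigma>"
  by (simp add: orbits_def)

lemma orbit_eq_if_mem: "j \<in> orbits \<sigma> \<Longrightarrow> y \<in> j \<Longrightarrow> orbit \<sigma> y = j"
  using orbit_eq_of_mem by (auto simp: orbits_def)

lemma orbit_increment_vert:
  assumes "vert y p" shows "orbit_increment A (orbit \<sigma> y) p = increment \<xi> A y p"
proof -
  have "{z. z \<in> orbit \<sigma> y \<and> vert z p} = {y}"
    using assms self_in_orbit vert_unique orbit_eq_of_mem by blast
  thus ?thesis by (simp add: orbit_increment_def)
qed

lemma orbit_increment_odd:
  assumes "odd (p - \<xi> y)" shows "orbit_increment A (orbit \<sigma> y) p = 0"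
proof -
  have "{z. z \<in> orbit \<sigma> y \<and> vert z p} = {}"
    using assms vert_same_parity[OF orbit_eq_of_mem _ vert_\<xi>] by blast
  thus ?thesis by (simp only: orbit_increment_def sum.empty)
qed

lemma orbit_increment_high:
  assumes "\<And>y. \<xi> y < p" shows "orbit_increment A j p = 0"
  unfolding orbit_increment_def increment_def
  by (intro sum.neutral) (simp add: not_le[THEN iffD2, OF assms])

lemma orbit_adj_iff:
  assumes "adj y z" shows "orbit_adj adj (orbit \<sigma> z) (orbit \<sigma> y)"
  using assms adj_sym self_in_orbit unfolding orbit_adj_def by blast

lemma orbit_adj_neighbour:
  assumes "k \<in> orbits \<sigma>" "orbit_adj adj k (orbit \<sigma> y)" obtains z where "adj y z" "z \<in> k"
proof -
  obtain z y' where *: "z \<in> k" "y' \<in> orbit \<sigma> y" "adj z y'" using assms(2) by (auto simp: orbit_adj_def)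
  obtain l where l: "y = (\<sigma> ^^ l) y'" using in_orbitE[of y y'] self_in_orbit orbit_eq_of_mem[OF *(2)] by metis
  have "(\<sigma> ^^ l) z \<in> k" using self_in_orbit[of "(\<sigma> ^^ l) z"] orbit_eq_if_mem[OF assms(1) *(1)]
    by (simp add: orbit_funpow)
  moreover have "adj y ((\<sigma> ^^ l) z)" using *(3) adj_sym by (simp add: l adj_funpow)
  ultimately show ?thesis using that by blast
qed

text \<open>Here the asymmetry of the folded Cartan matrix arises. Equal sizes: one neighbour on one
  level. A fixed neighbour of a moved \<open>y\<close>: it occurs on \<open>d y\<close> levels of
  the window. A fixed \<open>y\<close> beside a larger orbit: the window is the level
  \<open>p + 1\<close>, which carries one member of that orbit at most.\<close>

lemma sum_neighbours_in_orbit: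
  assumes "adj y z" "vert y p"
  shows "(\<Sum>z' | adj y z' \<and> orbit \<sigma> z' = orbit \<sigma> z.
      \<Sum>q | vert z' q \<and> p < q \<and> q < p + 2 * d y. increment \<xi> A z' q) =
    (\<Sum>l<quantum_length (orbit \<sigma> z) (orbit \<sigma> y). orbit_increment A (orbit \<sigma> z)
      (p + d y + int (quantum_length (orbit \<sigma> z) (orbit \<sigma> y)) - 1 - 2 * int l))"
    (is "?lhs = ?rhs")
proof -
  consider "card (orbit \<sigma> z) = card (orbit \<sigma> y)"
    | "card (orbit \<sigma> z) = 1" "1 < card (orbit \<sigma> y)"
    | "card (orbit \<sigma> y) = 1" "1 < card (orbit \<sigma> z)"
    using card_cases[of y z] by metis
  thus ?thesis
  proof cases
    case 1
    have "z' = z" if "adj y z'" "orbit \<sigma> z' = orbit \<sigma> z" for z'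
      using unique_neighbour[OF assms(1) that(1) that(2)[symmetric]] 1 by simp
    hence "{z'. adj y z' \<and> orbit \<sigma> z' = orbit \<sigma> z} = {z}" using assms(1) by blast
    moreover have v: "vert z (p + d y)"
    proof (rule vert_neighbour[OF assms])
      have "p - (p + d y) - d z = 2 * d z * (- 1)" using 1 by simp
      thus "2 * d z dvd p - (p + d y) - d z" by (metis dvd_triv_left)
    qed (use 1 in simp)
    moreover have "{q. vert z q \<and> p < q \<and> q < p + 2 * d y} = {p + d y}"
    proof (intro set_eqI iffI; clarify)
      fix q assume q: "vert z q" "p < q" "q < p + 2 * d y"
      show "q = p + d y"
        using vert_less[OF q(1) v] vert_less[OF v q(1)] q(2,3) 1 by linarith
    qed (use v d_pos in auto)
    ultimately show ?thesis using 1 by (simp add: quantum_length_def orbit_increment_vert)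
  next
    case 2
    have "{z'. adj y z' \<and> orbit \<sigma> z' = orbit \<sigma> z} = {z}"
      using orbit_fixed[OF 2(1)] self_in_orbit assms(1) by blast
    hence "?lhs = (\<Sum>q | vert z q \<and> p < q \<and> q < p + 2 * d y. orbit_increment A (orbit \<sigma> z) q)"
      by (simp add: orbit_increment_vert)
    also have "{q. vert z q \<and> p < q \<and> q < p + 2 * d y} =
        (\<lambda>l. p + 2 * d y - 1 - 2 * int l) ` {..<card (orbit \<sigma> y)}" (is "?L = ?R")
    proof (intro set_eqI iffI)
      fix q assume q: "q \<in> ?L"
      have "2 * min (d y) (d z) dvd p - q - min (d y) (d z)"
        using adj_vert_diff[OF assms] q by blast
      hence "odd (p - q)" using 2 by (simp add: min_def)
      then obtain e where e: "p - q = 2 * e + 1" by (rule oddE)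
      have "q = p + 2 * d y - 1 - 2 * int (nat (d y + e))" "nat (d y + e) < card (orbit \<sigma> y)"
        using e q by auto
      thus "q \<in> ?R" by blast
    next
      fix q assume "q \<in> ?R"
      then obtain l where l: "q = p + 2 * d y - 1 - 2 * int l" "l < card (orbit \<sigma> y)" by blast
      have "p - q - d z = 2 * d z * (int l - d y)" using l 2 by simp
      hence "2 * d z dvd p - q - d z" by (metis dvd_triv_left)
      hence "vert z q" by (intro vert_neighbour[OF assms]) (use 2 in auto)
      thus "q \<in> ?L" using l by auto
    qed
    also have "(\<Sum>q\<in>?R. orbit_increment A (orbit \<sigma> z) q) = ?rhs"
      using 2 by (subst sum.reindex) (auto simp: inj_on_def quantum_length_def algebra_simps)
    finally show ?thesis .
  next
    case 3
    have eq: "{q. vert z' q \<and> p < q \<and> q < p + 2 * d y} = (if vert z' (p + 1) then {p + 1} else {})" for z'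
      using 3 by (auto simp: int_one_le_iff_zero_less) (smt (verit))+
    have "?lhs = (\<Sum>z' | adj y z' \<and> orbit \<sigma> z' = orbit \<sigma> z.
        if vert z' (p + 1) then increment \<xi> A z' (p + 1) else 0)"
      unfolding eq by (intro sum.cong) auto
    also have "\<dots> = (\<Sum>z' | (adj y z' \<and> orbit \<sigma> z' = orbit \<sigma> z) \<and> vert z' (p + 1). increment \<xi> A z' (p + 1))"
      by (subst sum.inter_filter[symmetric]) auto
    also have "{z'. (adj y z' \<and> orbit \<sigma> z' = orbit \<sigma> z) \<and> vert z' (p + 1)} =
        {z'. z' \<in> orbit \<sigma> z \<and> vert z' (p + 1)}"
      using adj_fixed[OF 3(1) assms(1)] orbit_eq_of_mem self_in_orbit by blast
    finally show ?thesis using 3 by (simp add: orbit_increment_def quantum_length_def)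
  qed
qed

lemma quantum_length_parity:
  assumes "adj y z" "vert z q"
    and "q = m + int (quantum_length (orbit \<sigma> z) (orbit \<sigma> y)) - 1 - 2 * int l"
  shows "even (m - d y - \<xi> y)"
proof -
  let ?m = "min (d y) (d z)"
  have "2 * ?m dvd \<xi> y - q - ?m" by (rule adj_vert_diff[OF assms(1) vert_\<xi> assms(2)])
  hence "even (\<xi> y - q - ?m)" by (rule dvd_mult_left)
  thus ?thesis
    by (cases rule: card_cases[of y z]) (use assms(3) in \<open>auto simp: quantum_length_def\<close>)
qed

text \<open>For levels of the right parity this is \<open>increment_recursion\<close> with the
  neighbours grouped by orbits; for the others every term vanishes.\<close>

lemma orbit_increment_recursion:
  fixes A :: "'a \<Rightarrow> int \<Rightarrow> 'b::comm_ring_1"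
  assumes "mesh A" "j \<in> orbits \<sigma>"
    and dual: "\<And>y. 2 * A y (\<xi> y) - (\<Sum>z | adj y z. A z (\<xi> z)) = (if y = x then 1 else 0)"
  shows "orbit_increment A j (m + int (card j)) + orbit_increment A j (m - int (card j)) =
    (\<Sum>k\<in>orbits \<sigma> - {j}. if orbit_adj adj k j
      then \<Sum>l<quantum_length k j. orbit_increment A k (m + int (quantum_length k j) - 1 - 2 * int l)
      else 0) + (if j = orbit \<sigma> x \<and> m = \<xi> x + d x then 1 else 0)"
proof -
  obtain y0 where y0: "j = orbit \<sigma> y0" using assms(2) by (auto simp: orbits_def)
  show ?thesis
  proof (cases "even (m - d y0 - \<xi> y0)")
    case True
    then obtain y where y: "y \<in> orbit \<sigma> y0" "vert y (m - d y0)" using ex_vert[OF vert_\<xi>] by blast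
    have j: "j = orbit \<sigma> y" using orbit_eq_of_mem[OF y(1)] y0 by simp
    define p where "p = m - d y"
    have p: "vert y p" using y(2) j y0 by (simp add: p_def)
    have m: "m = p + d y" by (simp add: p_def)
    have "orbit_increment A j (m + int (card j)) + orbit_increment A j (m - int (card j)) =
        increment \<xi> A y (p + 2 * d y) + increment \<xi> A y p"
      using orbit_increment_vert[of y p A] orbit_increment_vert[of y "p + 2 * d y" A] p
      by (simp add: j m add.assoc)
    also have "\<dots> = (\<Sum>z | adj y z. \<Sum>q | vert z q \<and> p < q \<and> q < p + 2 * d y. increment \<xi> A z q) +
        (if y = x \<and> p = \<xi> x then 1 else 0)"
      by (rule increment_recursion[OF slice_\<xi> assms(1) p dual])
    also have "(\<Sum>z | adj y z. \<Sum>q | vert z q \<and> p < q \<and> q < p + 2 * d y. increment \<xi> A z q) =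
        (\<Sum>k\<in>orbits \<sigma> - {j}. \<Sum>z\<in>{z \<in> {z. adj y z}. orbit \<sigma> z = k}.
          \<Sum>q | vert z q \<and> p < q \<and> q < p + 2 * d y. increment \<xi> A z q)"
    proof (rule sum.group[symmetric])
      show "orbit \<sigma> ` {z. adj y z} \<subseteq> orbits \<sigma> - {j}"
        using orbit_in_orbits adj_orbit j by auto
    qed auto
    also have "\<dots> = (\<Sum>k\<in>orbits \<sigma> - {j}. if orbit_adj adj k j
      then \<Sum>l<quantum_length k j. orbit_increment A k (m + int (quantum_length k j) - 1 - 2 * int l)
      else 0)"
    proof (intro sum.cong refl)
      fix k assume k: "k \<in> orbits \<sigma> - {j}"
      show "(\<Sum>z\<in>{z \<in> {z. adj y z}. orbit \<sigma> z = k}.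
          \<Sum>q | vert z q \<and> p < q \<and> q < p + 2 * d y. increment \<xi> A z q) = (if orbit_adj adj k j
        then \<Sum>l<quantum_length k j. orbit_increment A k (m + int (quantum_length k j) - 1 - 2 * int l)
        else 0)"
      proof (cases "orbit_adj adj k j")
        case True
        then obtain z where z: "adj y z" "z \<in> k" using orbit_adj_neighbour k j by blast
        have "k = orbit \<sigma> z" using orbit_eq_if_mem z(2) k by blast
        thus ?thesis using sum_neighbours_in_orbit[OF z(1) p, of A] True by (simp add: j m)
      next
        case False
        hence "{z \<in> {z. adj y z}. orbit \<sigma> z = k} = {}" using orbit_adj_iff j by blast
        thus ?thesis using False by (simp only: sum.empty if_False)
      qed
    qed
    also have "y = x \<and> p = \<xi> x \<longleftrightarrow> j = orbit \<sigma> x \<and> m = \<xi> x + d x"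
      using vert_unique[of y x p] vert_\<xi>[of x] p j m by auto
    finally show ?thesis .
  next
    case False
    have odd: "odd (m + d y0 - \<xi> y0)" "odd (m - d y0 - \<xi> y0)" using False by auto
    have "orbit_increment A j (m + int (card j)) = 0" "orbit_increment A j (m - int (card j)) = 0"
      using orbit_increment_odd[OF odd(1)] orbit_increment_odd[OF odd(2)] by (simp_all add: y0)
    moreover have "(\<Sum>l<quantum_length k j. orbit_increment A k (m + int (quantum_length k j) - 1 - 2 * int l)) = 0"
      if k: "k \<in> orbits \<sigma>" "orbit_adj adj k j" for k
    proof (intro sum.neutral ballI)
      fix l
      obtain z where z: "adj y0 z" "z \<in> k" using orbit_adj_neighbour[OF k(1)] k(2) y0 by blast
      let ?q = "m + int (quantum_length k j) - 1 - 2 * int l"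
      have kz: "k = orbit \<sigma> z" using orbit_eq_if_mem z(2) k by blast
      show "orbit_increment A k ?q = 0"
      proof (rule ccontr)
        assume "orbit_increment A k ?q \<noteq> 0"
        then obtain z' where z': "z' \<in> k" "vert z' ?q"
          unfolding orbit_increment_def by (metis (mono_tags, lifting) empty_Collect_eq sum.empty)
        hence o: "orbit \<sigma> z' = orbit \<sigma> z" using orbit_eq_of_mem kz by simp
        have "z' \<in> orbit \<sigma> z" using z' kz by simp
        then obtain t where t: "z' = (\<sigma> ^^ t) z" by (rule in_orbitE)
        have "adj ((\<sigma> ^^ t) y0) z'" using z(1) by (simp add: t adj_funpow)
        from quantum_length_parity[OF this z'(2), of m l]
        have "even (m - d y0 - \<xi> ((\<sigma> ^^ t) y0))" by (simp add: o orbit_funpow kz y0)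
        moreover have "even (\<xi> ((\<sigma> ^^ t) y0) - \<xi> y0)"
          by (rule vert_same_parity[OF orbit_funpow vert_\<xi> vert_\<xi>])
        ultimately show False using False by auto
      qed
    qed
    moreover have "\<not> (j = orbit \<sigma> x \<and> m = \<xi> x + d x)"
    proof
      assume *: "j = orbit \<sigma> x \<and> m = \<xi> x + d x"
      hence "even (\<xi> x - \<xi> y0)" using vert_same_parity[OF _ vert_\<xi> vert_\<xi>] y0 by metis
      moreover have "m - d y0 - \<xi> y0 = \<xi> x - \<xi> y0" using * y0 by simp
      ultimately show False using False by simp
    qed
    ultimately show ?thesis by (simp only: if_False) (simp add: sum.neutral)
  qed
qed

text \<open>In terms of \<open>u = \<xi>\<^sub>x + d\<^sub>x - p\<close> the recursion is the row of index \<open>x\<close> of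
  \<open>C~(z) C(z) = 1\<close>.\<close>

definition row :: "('a \<Rightarrow> int \<Rightarrow> 'b::comm_ring_1) \<Rightarrow> 'a \<Rightarrow> 'a set \<Rightarrow> int \<Rightarrow> 'b" where
  "row A x j u = orbit_increment A j (\<xi> x + d x - u)"

lemma row_recursion:
  fixes A :: "'a \<Rightarrow> int \<Rightarrow> 'b::comm_ring_1"
  assumes "mesh A" "j \<in> orbits \<sigma>"
    and dual: "\<And>y. 2 * A y (\<xi> y) - (\<Sum>z | adj y z. A z (\<xi> z)) = (if y = x then 1 else 0)"
  shows "row A x j (u - int (card j)) + row A x j (u + int (card j)) =
    (\<Sum>k\<in>orbits \<sigma> - {j}. if orbit_adj adj k j
      then \<Sum>l<quantum_length k j. row A x k (u - (int (quantum_length k j) - 1 - 2 * int l))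
      else 0) + (if j = orbit \<sigma> x \<and> u = 0 then 1 else 0)"
proof -
  have r: "row A x k (u - (n - 1 - 2 * l)) = orbit_increment A k (\<xi> x + d x - u + n - 1 - 2 * l)" for k n l
    by (simp add: row_def algebra_simps)
  have r': "row A x k (u - int n) = orbit_increment A k (\<xi> x + d x - u + int n)"
    "row A x k (u + int n) = orbit_increment A k (\<xi> x + d x - u - int n)" for k n
    by (simp_all add: row_def algebra_simps)
  show ?thesis
    unfolding r r' using orbit_increment_recursion[OF assms, of "\<xi> x + d x - u"] by simp
qed

lemma row_bounded: "\<exists>N. \<forall>j u. u < N \<longrightarrow> row A x j u = 0"
proof -
  obtain M where M: "\<And>y. \<xi> y \<le> M" using ex_upper_bound by metis
  have "row A x j u = 0" if "u < \<xi> x + d x - M" for j u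
    unfolding row_def using M that by (intro orbit_increment_high) (smt (verit))
  thus ?thesis by blast
qed

text \<open>\<open>w\<close> is the vertex of the orbit on level \<open>\<xi> x + d x - u\<close>.
  As \<open>u\<close> is nonnegative, this level is below \<open>\<xi> x + 2 * d x\<close>, and the
  cut-off has no effect.\<close>

lemma row_eq:
  fixes A :: "'a \<Rightarrow> int \<Rightarrow> 'b::comm_ring_1"
  assumes "mesh A" "0 \<le> u"
    and dual: "\<And>y. 2 * A y (\<xi> y) - (\<Sum>z | adj y z. A z (\<xi> z)) = (if y = x then 1 else 0)"
  shows "row A x (orbit \<sigma> y) u = (if even (u + \<xi> y - \<xi> x - d x)
    then let k = (u + \<xi> y - \<xi> x - d x) div 2; w = int_funpow \<sigma> k y
      in A w (\<xi> y - 2 * k) - A w (\<xi> y - 2 * (k + d y)) else 0)"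
proof (cases "even (u + \<xi> y - \<xi> x - d x)")
  case True
  define k where "k = (u + \<xi> y - \<xi> x - d x) div 2"
  define w where "w = int_funpow \<sigma> k y"
  have p: "\<xi> x + d x - u = \<xi> y - 2 * k" using True by (auto simp: k_def)
  have o: "orbit \<sigma> w = orbit \<sigma> y"
  proof (cases "0 \<le> k")
    case True thus ?thesis by (simp add: w_def int_funpow_def orbit_funpow)
  next
    case False
    have "\<sigma> (inv \<sigma> z) = z" for z using bij_\<sigma> by (simp add: bij_is_surj surj_f_inv_f)
    hence "orbit \<sigma> (inv \<sigma> z) = orbit \<sigma> z" for z by (metis orbit_\<sigma>)
    hence "orbit \<sigma> ((inv \<sigma> ^^ n) z) = orbit \<sigma> z" for n z by (induction n) auto
    thus ?thesis using False by (simp add: w_def int_funpow_def)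
  qed
  have v: "vert w (\<xi> y - 2 * k)"
  proof (cases "0 \<le> k")
    case True
    thus ?thesis using vert_funpow[of "nat k" y "\<xi> y"] vert_\<xi> by (simp add: w_def int_funpow_def)
  next
    case False
    have "vert ((\<sigma> ^^ n) ((inv \<sigma> ^^ n) y)) q = vert y q" for n q
      using bij_\<sigma> by (metis bij_is_surj comp_apply id_apply surj_iff inv_fn bij_fn surj_f_inv_f)
    hence "vert ((\<sigma> ^^ nat (- k)) w) (\<xi> y)" using False vert_\<xi> by (simp add: w_def int_funpow_def)
    thus ?thesis using vert_funpow[of "nat (- k)" w "\<xi> y - 2 * k"] False by simp
  qed
  have "row A x (orbit \<sigma> y) u = increment \<xi> A w (\<xi> y - 2 * k)"
    using orbit_increment_vert[OF v, of A] by (simp add: row_def p o)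
  also have "\<dots> = A w (\<xi> y - 2 * k) - A w (\<xi> y - 2 * k - 2 * d w)"
    by (rule increment_eq_diff[OF slice_\<xi> assms(1) dual v]) (use p assms(2) d_pos[of x] in linarith)
  also have "\<xi> y - 2 * k - 2 * d w = \<xi> y - 2 * (k + d y)" by (simp add: o)
  finally show ?thesis using True by (simp only: Let_def k_def w_def if_True)
next
  case False
  hence "odd (\<xi> x + d x - u - \<xi> y)" by presburger
  thus ?thesis using False by (simp add: row_def orbit_increment_odd)
qed

end

section \<open>Expansion at zero\<close>

abbreviation fls_of_poly :: "'a::field poly \<Rightarrow> 'a fls" where
  "fls_of_poly p \<equiv> fps_to_fls (fps_of_poly p)"

lemma fls_of_poly_eq_0_iff: "fls_of_poly p = 0 \<longleftrightarrow> p = 0"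
  using fps_of_poly_eq_iff[of p 0] by simp

lemma fls_of_poly_mult: "fls_of_poly (p * q) = fls_of_poly p * fls_of_poly q"
  by (simp add: fps_of_poly_mult fls_times_fps_to_fls)

text \<open>The expansion does not depend on the fraction representing the function; its
  compatibility with the field operations follows from this.\<close>

lemma laurent_at_0_divide:
  assumes "q \<noteq> 0" shows "laurent_at_0 (to_fract p / to_fract q) = fls_of_poly p / fls_of_poly q"
proof -
  define x where "x = to_fract p / to_fract q"
  define a b where "a = fst (quot_of_fract x)" and "b = snd (quot_of_fract x)"
  have b: "b \<noteq> 0" by (simp add: b_def)
  have "to_fract a / to_fract b = to_fract p / to_fract q"
    using Fract_quot_of_fract[of x] unfolding a_def[symmetric] b_def[symmetric]
    by (simp add: Fract_conv_to_fract x_def)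
  hence "to_fract (a * q) = to_fract (p * b)" using assms b by (simp add: frac_eq_eq)
  hence "a * q = p * b" by (simp only: to_fract_eq_iff)
  hence "fls_of_poly a * fls_of_poly q = fls_of_poly p * fls_of_poly b"
    by (simp only: fls_of_poly_mult[symmetric])
  thus ?thesis using assms b
    by (simp add: laurent_at_0_def x_def[symmetric] a_def[symmetric] b_def[symmetric]
        frac_eq_eq fls_of_poly_eq_0_iff)
qed

lemma fractE: fixes x :: "rat poly fract" obtains p q where "x = to_fract p / to_fract q" "q \<noteq> 0"
  using Fract_quot_of_fract[of x] by (metis Fract_conv_to_fract snd_quot_of_fract_nonzero)

lemma laurent_at_0_add: "laurent_at_0 (x + y) = laurent_at_0 x + laurent_at_0 y"
proof -
  obtain p q p' q' where *: "x = to_fract p / to_fract q" "q \<noteq> 0" "y = to_fract p' / to_fract q'" "q' \<noteq> 0"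
    by (metis fractE)
  have "x + y = to_fract (p * q' + p' * q) / to_fract (q * q')"
    using * by (simp add: add_frac_eq)
  thus ?thesis using *
    by (simp add: laurent_at_0_divide fls_of_poly_mult fps_of_poly_add fps_of_poly_mult add_frac_eq
        fls_of_poly_eq_0_iff fls_times_fps_to_fls del: to_fract_add to_fract_mult)
qed

lemma laurent_at_0_mult: "laurent_at_0 (x * y) = laurent_at_0 x * laurent_at_0 y"
proof -
  obtain p q p' q' where *: "x = to_fract p / to_fract q" "q \<noteq> 0" "y = to_fract p' / to_fract q'" "q' \<noteq> 0"
    by (metis fractE)
  have "x * y = to_fract (p * p') / to_fract (q * q')" using * by simp
  thus ?thesis using *
    by (simp add: laurent_at_0_divide fls_of_poly_mult fls_of_poly_eq_0_iff del: to_fract_mult)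
qed

lemma laurent_at_0_0: "laurent_at_0 0 = 0"
  using laurent_at_0_divide[of 1 0] by simp

lemma laurent_at_0_1: "laurent_at_0 1 = 1"
  using laurent_at_0_divide[of 1 1] by simp

lemma laurent_at_0_eq_0_iff: "laurent_at_0 x = 0 \<longleftrightarrow> x = 0"
proof -
  obtain p q where "x = to_fract p / to_fract q" "q \<noteq> 0" by (metis fractE)
  thus ?thesis by (simp add: laurent_at_0_divide fls_of_poly_eq_0_iff)
qed

lemma laurent_at_0_uminus: "laurent_at_0 (- x) = - laurent_at_0 x"
  using laurent_at_0_add[of x "- x"] by (simp add: laurent_at_0_0 eq_neg_iff_add_eq_0 add.commute)

lemma laurent_at_0_sum: "laurent_at_0 (\<Sum>k\<in>S. g k) = (\<Sum>k\<in>S. laurent_at_0 (g k))"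
  by (induction S rule: infinite_finite_induct) (auto simp: laurent_at_0_0 laurent_at_0_add)

lemma laurent_at_0_inverse: "laurent_at_0 (inverse x) = inverse (laurent_at_0 x)"
proof (cases "x = 0")
  case False
  hence "laurent_at_0 x * laurent_at_0 (inverse x) = 1"
    by (simp add: laurent_at_0_mult[symmetric] laurent_at_0_1)
  thus ?thesis by (metis inverse_unique)
qed (simp add: laurent_at_0_0)

lemma laurent_at_0_power: "laurent_at_0 (x ^ n) = laurent_at_0 x ^ n"
  by (induction n) (auto simp: laurent_at_0_1 laurent_at_0_mult)

lemma laurent_at_0_power_int: "laurent_at_0 (x powi n) = laurent_at_0 x powi n"
  by (simp add: power_int_def laurent_at_0_power laurent_at_0_inverse)

lemma laurent_at_0_zvar: "laurent_at_0 zvar = fls_X"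
  using laurent_at_0_divide[of 1 "[:0, 1:]"] by (simp add: zvar_def)

lemma zvar_neq_0: "zvar \<noteq> 0"
  by (simp add: zvar_def)

lemma fls_nth_mult_X_powi: "fls_nth (f * fls_X powi n) u = fls_nth (f :: 'a::field fls) (u - n)"
proof (cases "0 \<le> n")
  case True
  thus ?thesis by (simp add: power_int_def fls_X_power_times_conv_shift)
next
  case False
  thus ?thesis by (simp add: power_int_def fls_inverse_X fls_X_inv_power_times_conv_shift)
qed

lemma fls_nth_laurent_mult_zvar:
  "fls_nth (laurent_at_0 (x * zvar powi n)) u = fls_nth (laurent_at_0 x) (u - n)"
  by (simp only: laurent_at_0_mult laurent_at_0_power_int laurent_at_0_zvar fls_nth_mult_X_powi)

lemma quantum_int_uminus: "quantum_int (- int m) = - (\<Sum>l<m. zvar powi (int m - 1 - 2 * int l))"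
proof -
  let ?s = "\<Sum>l<m. zvar powi (int m - 1 - 2 * int l)"
  \<comment> \<open>The expansions of the two powers differ in the coefficient of degree 1.\<close>
  have z: "zvar - zvar powi (- 1) \<noteq> 0"
  proof
    assume "zvar - zvar powi (- 1) = 0"
    hence "laurent_at_0 (zvar powi 1) = laurent_at_0 (zvar powi (- 1))" by simp
    hence "fls_nth (1 * fls_X powi 1 :: rat fls) 1 = fls_nth (1 * fls_X powi (- 1)) 1"
      by (simp only: laurent_at_0_power_int laurent_at_0_zvar mult_1)
    thus False unfolding fls_nth_mult_X_powi by simp
  qed
  define g where "g l = zvar powi (int m - 2 * int l)" for l
  have "?s * (zvar - zvar powi (- 1)) = (\<Sum>l<m. g l - g (Suc l))"
  proof (unfold sum_distrib_right, intro sum.cong refl)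
    fix l
    have "zvar powi (int m - 1 - 2 * int l) * zvar = zvar powi (int m - 1 - 2 * int l + 1)"
      using zvar_neq_0 by (subst power_int_add_1) auto
    moreover have "zvar powi (int m - 1 - 2 * int l) * zvar powi (- 1) =
        zvar powi (int m - 1 - 2 * int l + - 1)"
      using zvar_neq_0 by (subst power_int_add) auto
    ultimately show "zvar powi (int m - 1 - 2 * int l) * (zvar - zvar powi (- 1)) = g l - g (Suc l)"
      by (simp add: right_diff_distrib g_def algebra_simps)
  qed
  also have "\<dots> = g 0 - g m" by (rule sum_lessThan_telescope')
  also have "\<dots> = zvar powi int m - zvar powi (- int m)" by (simp add: g_def)
  finally have "?s = (zvar powi int m - zvar powi (- int m)) / (zvar - zvar powi (- 1))"
    using z by (simp add: nonzero_eq_divide_eq)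
  thus ?thesis by (simp add: quantum_int_def minus_divide_left)
qed

lemma folded_cartan_off_diagonal:
  assumes "k \<noteq> j" "0 < card k" "0 < card j" "card k < card j \<Longrightarrow> card k = 1"
  shows "folded_cartan adj k j = (if orbit_adj adj k j then - int (quantum_length k j) else 0)"
proof (cases "card k < card j")
  case True
  thus ?thesis using assms by (simp add: folded_cartan_def quantum_length_def)
next
  case False
  have "\<lceil>of_nat (card j) / of_nat (card k) :: rat\<rceil> = 1"
    using False assms(2,3) by (simp add: ceiling_eq_iff)
  thus ?thesis using False assms(1) by (simp add: folded_cartan_def quantum_length_def)
qed

section \<open>Rows multiplied by the quantum Cartan matrix\<close>

locale orbit_family =
  fixes adj :: "'v::finite \<Rightarrow> 'v \<Rightarrow> bool" and I :: "'v set set"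
  assumes card_pos: "j \<in> I \<Longrightarrow> 0 < card j"
    and card_ratio: "k \<in> I \<Longrightarrow> j \<in> I \<Longrightarrow> card k < card j \<Longrightarrow> card k = 1"
begin

text \<open>The coefficient of degree \<open>u\<close> in entry \<open>j\<close> of a row vector
  times the quantum Cartan matrix, written for arbitrary two-sided sequences so that it applies to
  \<open>row\<close> directly.\<close>

definition recursion :: "('v set \<Rightarrow> int \<Rightarrow> rat) \<Rightarrow> 'v set \<Rightarrow> int \<Rightarrow> rat" where
  "recursion t j u = t j (u - int (card j)) + t j (u + int (card j)) -
    (\<Sum>k\<in>I - {j}. if orbit_adj adj k j
      then \<Sum>l<quantum_length k j. t k (u - (int (quantum_length k j) - 1 - 2 * int l)) else 0)"

text \<open>Taken at \<open>u - int (card j)\<close>, the recursion expresses \<open>t j u\<close>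
  through smaller degrees: those of the neighbours exceed \<open>u - int (card j)\<close> by at most
  \<open>quantum_length k j - 1\<close>, and \<open>quantum_length k j \<le> card j\<close>.\<close>

lemma recursion_unique:
  assumes "\<And>j u. j \<in> I \<Longrightarrow> recursion t j u = 0" "\<And>j u. j \<in> I \<Longrightarrow> u < N \<Longrightarrow> t j u = 0" "j \<in> I"
  shows "t j u = 0"
  using assms(3)
proof (induction "nat (u - N)" arbitrary: j u rule: less_induct)
  case less
  show ?case
  proof (cases "u < N")
    case False
    have d: "0 < card j" by (rule card_pos[OF less.prems])
    have IH: "t k w = 0" if "w < u" "k \<in> I" for k w
      using that False assms(2) less.hyps[of w k] by (cases "w < N") auto
    have "(\<Sum>k\<in>I - {j}. if orbit_adj adj k j
      then \<Sum>l<quantum_length k j. t k (u - int (card j) - (int (quantum_length k j) - 1 - 2 * int l)) else 0) = 0"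
    proof (intro sum.neutral ballI)
      fix k assume k: "k \<in> I - {j}"
      have "t k (u - int (card j) - (int (quantum_length k j) - 1 - 2 * int l)) = 0"
        if "l < quantum_length k j" for l
        using that k d by (intro IH) (auto simp: quantum_length_def split: if_splits)
      thus "(if orbit_adj adj k j then \<Sum>l<quantum_length k j.
          t k (u - int (card j) - (int (quantum_length k j) - 1 - 2 * int l)) else 0) = 0" by simp
    qed
    moreover have "t j (u - int (card j) - int (card j)) = 0" using d less.prems by (intro IH) auto
    ultimately show ?thesis using assms(1)[OF less.prems, of "u - int (card j)"]
      by (simp add: recursion_def)
  qed (use assms(2) less.prems in blast)
qed

lemma fls_nth_quantum_cartan:
  assumes "j \<in> I"
  shows "fls_nth (laurent_at_0 (\<Sum>k\<in>I. v k * quantum_cartan adj k j)) u =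
    recursion (\<lambda>k. fls_nth (laurent_at_0 (v k))) j u"
proof -
  let ?t = "\<lambda>k. fls_nth (laurent_at_0 (v k))"
  have diag: "fls_nth (laurent_at_0 (v j * quantum_cartan adj j j)) u =
      ?t j (u - int (card j)) + ?t j (u + int (card j))"
  proof -
    have "v j * quantum_cartan adj j j =
        v j * zvar powi int (card j) + v j * zvar powi (- int (card j))"
      by (simp add: quantum_cartan_def distrib_left)
    thus ?thesis by (simp only: laurent_at_0_add fls_plus_nth fls_nth_laurent_mult_zvar) simp
  qed
  have off: "fls_nth (laurent_at_0 (v k * quantum_cartan adj k j)) u = - (if orbit_adj adj k j
      then \<Sum>l<quantum_length k j. ?t k (u - (int (quantum_length k j) - 1 - 2 * int l)) else 0)"
    if k: "k \<in> I - {j}" for k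
  proof -
    have fc: "folded_cartan adj k j = (if orbit_adj adj k j then - int (quantum_length k j) else 0)"
      using k assms card_pos card_ratio by (intro folded_cartan_off_diagonal) auto
    have "quantum_int 0 = 0" by (simp add: quantum_int_def)
    thus ?thesis using k
      by (auto simp: quantum_cartan_def fc quantum_int_uminus sum_distrib_left laurent_at_0_0
          laurent_at_0_uminus laurent_at_0_sum fls_nth_sum fls_nth_laurent_mult_zvar)
  qed
  have "fls_nth (laurent_at_0 (\<Sum>k\<in>I. v k * quantum_cartan adj k j)) u =
      (\<Sum>k\<in>I. fls_nth (laurent_at_0 (v k * quantum_cartan adj k j)) u)"
    by (simp add: laurent_at_0_sum fls_nth_sum)
  also have "\<dots> = fls_nth (laurent_at_0 (v j * quantum_cartan adj j j)) u +
      (\<Sum>k\<in>I - {j}. fls_nth (laurent_at_0 (v k * quantum_cartan adj k j)) u)"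
    using assms by (simp add: sum.remove)
  also have "(\<Sum>k\<in>I - {j}. fls_nth (laurent_at_0 (v k * quantum_cartan adj k j)) u) =
      - (\<Sum>k\<in>I - {j}. if orbit_adj adj k j
      then \<Sum>l<quantum_length k j. ?t k (u - (int (quantum_length k j) - 1 - 2 * int l)) else 0)"
    unfolding sum_negf[symmetric] by (intro sum.cong refl off)
  finally show ?thesis by (simp add: diag recursion_def)
qed

lemma ex_common_bound:
  fixes g :: "'v set \<Rightarrow> rat fls" obtains N where "\<And>k u. u < N \<Longrightarrow> fls_nth (g k) u = 0"
proof -
  obtain N where "\<And>k. N \<le> fls_subdegree (g k)"
    using ex_lower_bound[of "\<lambda>k. fls_subdegree (g k)"] by blast
  thus ?thesis using that[of N] by (metis fls_eq0_below_subdegree order_less_le_trans)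
qed

text \<open>The expansions of a kernel vector solve the homogeneous recursion and vanish in all
  sufficiently low degrees, so invertibility over the rational functions comes from
  \<open>recursion_unique\<close>.\<close>

lemma quantum_cartan_kernel:
  assumes "\<And>j. j \<in> I \<Longrightarrow> (\<Sum>k\<in>I. v k * quantum_cartan adj k j) = 0" "k \<in> I"
  shows "v k = 0"
proof -
  obtain N where N: "\<And>k u. u < N \<Longrightarrow> fls_nth (laurent_at_0 (v k)) u = 0"
    using ex_common_bound[of "\<lambda>k. laurent_at_0 (v k)"] by blast
  have "fls_nth (laurent_at_0 (v k)) u = 0" for u
    by (rule recursion_unique[OF _ N assms(2)])
      (simp_all add: fls_nth_quantum_cartan[symmetric] assms(1) laurent_at_0_0)
  hence "laurent_at_0 (v k) = 0" by (simp add: fls_eq_iff)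
  thus ?thesis by (simp add: laurent_at_0_eq_0_iff)
qed

lemma ex_quantum_cartan_inverse:
  obtains B where
    "\<And>i j. i \<in> I \<Longrightarrow> j \<in> I \<Longrightarrow> (\<Sum>k\<in>I. quantum_cartan adj i k * B k j) = (if i = j then 1 else 0)"
    "\<And>i j. i \<in> I \<Longrightarrow> j \<in> I \<Longrightarrow> (\<Sum>k\<in>I. B i k * quantum_cartan adj k j) = (if i = j then 1 else 0)"
proof -
  let ?A = "quantum_cartan adj"
  \<comment> \<open>Transposed, so that \<open>M *v x\<close> is a row times the quantum Cartan
    matrix, and padded with the identity because the indices range over all sets of
    vertices.\<close>
  define M :: "rat poly fract ^ 'v set ^ 'v set"
    where "M = (\<chi> a b. if a \<in> I \<and> b \<in> I then ?A b a else if a = b then 1 else 0)"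
  have row: "(\<Sum>b\<in>UNIV. M $ a $ b * w b) = (\<Sum>b\<in>I. ?A b a * w b)" if "a \<in> I" for a w
    using that by (intro sum.mono_neutral_cong_right) (auto simp: M_def)
  have col: "(\<Sum>a\<in>UNIV. w a * M $ a $ b) = (\<Sum>a\<in>I. w a * ?A b a)" if "b \<in> I" for b w
    using that by (intro sum.mono_neutral_cong_right) (auto simp: M_def)
  have "x = 0" if x: "M *v x = 0" for x
  proof -
    have row0: "(\<Sum>b\<in>UNIV. M $ a $ b * x $ b) = 0" for a
      using x by (simp add: vec_eq_iff matrix_vector_mult_def)
    have "x $ k = 0" for k
    proof (cases "k \<in> I")
      case True
      have "(\<Sum>b\<in>I. x $ b * ?A b a) = 0" if "a \<in> I" for a
        using row0[of a] row[OF that, of "\<lambda>b. x $ b"] by (simp add: mult.commute)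
      from quantum_cartan_kernel[OF this True] show ?thesis .
    next
      case False
      have "(\<Sum>b\<in>UNIV. M $ k $ b * x $ b) = (\<Sum>b\<in>UNIV. if b = k then x $ b else 0)"
        using False by (intro sum.cong) (auto simp: M_def)
      thus ?thesis using row0[of k] by simp
    qed
    thus ?thesis by (simp add: vec_eq_iff)
  qed
  then obtain R where R: "R ** M = mat 1" using matrix_left_invertible_ker[of M] by blast
  hence R': "M ** R = mat 1" by (simp add: matrix_left_right_inverse)
  have 1: "(\<Sum>k\<in>I. ?A i k * R $ j $ k) = (if i = j then 1 else 0)" if "i \<in> I" "j \<in> I" for i j
  proof -
    have "(\<Sum>k\<in>UNIV. R $ j $ k * M $ k $ i) = (if i = j then 1 else 0)"
      using arg_cong[OF R, of "\<lambda>X. X $ j $ i"] by (simp add: matrix_matrix_mult_def mat_def eq_commute)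
    thus ?thesis unfolding col[OF that(1)] by (simp only: mult.commute)
  qed
  have 2: "(\<Sum>k\<in>I. R $ k $ i * ?A k j) = (if i = j then 1 else 0)" if "i \<in> I" "j \<in> I" for i j
  proof -
    have "(\<Sum>k\<in>UNIV. M $ j $ k * R $ k $ i) = (if i = j then 1 else 0)"
      using arg_cong[OF R', of "\<lambda>X. X $ j $ i"] by (simp add: matrix_matrix_mult_def mat_def eq_commute)
    thus ?thesis unfolding row[OF that(2)] by (simp only: mult.commute)
  qed
  show ?thesis by (rule that[of "\<lambda>k j. R $ j $ k"]) (use 1 2 in auto)
qed

lemma inverse_matrix_on_left:
  assumes "i \<in> I" "j \<in> I"
  shows "(\<Sum>k\<in>I. inverse_matrix_on I (quantum_cartan adj) i k * quantum_cartan adj k j) =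
    (if i = j then 1 else 0)"
proof -
  let ?A = "quantum_cartan adj"
  let ?P = "\<lambda>B. (\<forall>i j. i \<notin> I \<or> j \<notin> I \<longrightarrow> B i j = 0) \<and>
     (\<forall>i\<in>I. \<forall>j\<in>I. (\<Sum>k\<in>I. ?A i k * B k j) = (if i = j then 1 else 0)) \<and>
     (\<forall>i\<in>I. \<forall>j\<in>I. (\<Sum>k\<in>I. B i k * ?A k j) = (if i = j then 1 else 0))"
  obtain B0 where B0:
    "\<And>i j. i \<in> I \<Longrightarrow> j \<in> I \<Longrightarrow> (\<Sum>k\<in>I. ?A i k * B0 k j) = (if i = j then 1 else 0)"
    "\<And>i j. i \<in> I \<Longrightarrow> j \<in> I \<Longrightarrow> (\<Sum>k\<in>I. B0 i k * ?A k j) = (if i = j then 1 else 0)"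
    using ex_quantum_cartan_inverse by blast
  define B where "B i j = (if i \<in> I \<and> j \<in> I then B0 i j else 0)" for i j
  have PB: "?P B" using B0 by (simp add: B_def)
  have "?P (inverse_matrix_on I ?A)" unfolding inverse_matrix_on_def
  proof (rule theI[of ?P, OF PB])
    fix C assume C: "?P C"
    have "C i j = B i j" if ij: "i \<in> I" "j \<in> I" for i j
    proof -
      have "C i j = (\<Sum>k\<in>I. C i k * (\<Sum>l\<in>I. ?A k l * B l j))"
        using PB ij by (simp add: if_distrib[of "\<lambda>t. _ * t"] cong: if_cong)
      also have "\<dots> = (\<Sum>l\<in>I. \<Sum>k\<in>I. C i k * ?A k l * B l j)"
        unfolding sum_distrib_left by (subst sum.swap) (simp add: mult.assoc)
      also have "\<dots> = (\<Sum>l\<in>I. (\<Sum>k\<in>I. C i k * ?A k l) * B l j)"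
        by (simp add: sum_distrib_right)
      also have "\<dots> = B i j" using C ij by (simp add: if_distrib[of "\<lambda>t. t * _"] cong: if_cong)
      finally show ?thesis .
    qed
    thus "C = B" using C by (intro ext) (auto simp: B_def)
  qed
  thus ?thesis using assms by blast
qed

text \<open>Both sides solve the same inhomogeneous recursion and vanish in low degrees, so their
  difference falls under \<open>recursion_unique\<close>.\<close>

lemma inverse_coefficients:
  assumes "i \<in> I" "j \<in> I"
    and t: "\<And>j u. j \<in> I \<Longrightarrow> recursion t j u = (if i = j \<and> u = 0 then 1 else 0)"
    and N: "\<And>j u. u < N \<Longrightarrow> t j u = 0"
  shows "fls_nth (laurent_at_0 (inverse_matrix_on I (quantum_cartan adj) i j)) u = t j u"
proof -
  let ?v = "\<lambda>k. inverse_matrix_on I (quantum_cartan adj) i k"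
  let ?c = "\<lambda>k. fls_nth (laurent_at_0 (?v k))"
  obtain N' where N': "\<And>k u. u < N' \<Longrightarrow> ?c k u = 0"
    using ex_common_bound[of "\<lambda>k. laurent_at_0 (?v k)"] by blast
  have c: "recursion ?c j u = (if i = j \<and> u = 0 then 1 else 0)" if "j \<in> I" for j u
    using fls_nth_quantum_cartan[OF that, of ?v u] inverse_matrix_on_left[OF assms(1) that]
    by (cases "i = j") (simp_all add: laurent_at_0_0 laurent_at_0_1)
  define s where "s k u = ?c k u - t k u" for k u
  have diff: "recursion s j u = recursion ?c j u - recursion t j u" for j u
  proof -
    have "(\<Sum>k\<in>I - {j}. if orbit_adj adj k j then \<Sum>l<quantum_length k j.
          s k (u - (int (quantum_length k j) - 1 - 2 * int l)) else 0) =
        (\<Sum>k\<in>I - {j}. (if orbit_adj adj k j then \<Sum>l<quantum_length k j.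
          ?c k (u - (int (quantum_length k j) - 1 - 2 * int l)) else 0) -
        (if orbit_adj adj k j then \<Sum>l<quantum_length k j.
          t k (u - (int (quantum_length k j) - 1 - 2 * int l)) else 0))"
      by (intro sum.cong refl) (simp add: s_def sum_subtractf)
    thus ?thesis by (simp add: recursion_def s_def sum_subtractf)
  qed
  have "s j u = 0"
  proof (rule recursion_unique[OF _ _ assms(2)])
    show "recursion s j u = 0" if "j \<in> I" for j u using c[OF that] t[OF that] by (simp add: diff)
    show "s j u = 0" if "u < min N N'" for j u using that N N' by (simp add: s_def)
  qed
  thus ?thesis by (simp add: s_def)
qed

end

section \<open>The coefficients of the inverse quantum Cartan matrix\<close>

lemma aut_order_eqI:
  assumes "0 < r" "\<sigma> ^^ r = id" "\<And>s. 0 < s \<Longrightarrow> s < r \<Longrightarrow> \<sigma> ^^ s \<noteq> id"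
  shows "aut_order \<sigma> = r"
  unfolding aut_order_def by (rule Least_equality) (use assms not_less in blast)+

lemma orbit_of_fixed: "\<sigma> x = x \<Longrightarrow> card (orbit \<sigma> x) = 1"
  using orbit_eq_singleton_iff[of \<sigma> x] by simp

lemma orbit_period:
  assumes "(\<sigma> ^^ n) x = x" "0 < n" shows "orbit \<sigma> x = (\<lambda>m. (\<sigma> ^^ m) x) ` {..<n}"
  using orbit_altdef_bounded[OF assms] by blast

lemma orbit_order_2: "\<sigma> (\<sigma> x) = x \<Longrightarrow> orbit \<sigma> x = {x, \<sigma> x}"
  using orbit_period[of "Suc (Suc 0)" \<sigma> x] by (simp add: lessThan_Suc insert_commute)

lemma orbit_order_3: "\<sigma> (\<sigma> (\<sigma> x)) = x \<Longrightarrow> orbit \<sigma> x = {x, \<sigma> x, \<sigma> (\<sigma> x)}"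
  using orbit_period[of "Suc (Suc (Suc 0))" \<sigma> x] by (simp add: lessThan_Suc insert_commute)

text \<open>The order is 1, 2 or 3, hence 1 or a prime, so an orbit is a point or has full
  size.\<close>

lemma aut_order_cases:
  assumes "(\<forall>x. \<sigma> (\<sigma> x) = x) \<or> (\<forall>x. \<sigma> (\<sigma> (\<sigma> x)) = x)"
  shows "card (orbit \<sigma> x) = 1 \<or> card (orbit \<sigma> x) = aut_order \<sigma>"
    and "(\<forall>x. \<sigma> (\<sigma> x) = x) \<Longrightarrow> card (orbit \<sigma> x) \<le> 2"
    and "0 < aut_order \<sigma>"
proof -
  have two: "card (orbit \<sigma> x) \<le> 2" if "\<forall>x. \<sigma> (\<sigma> x) = x" for x
    using orbit_order_2[of \<sigma> x] that by (simp add: card_insert_if)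
  show "(\<forall>x. \<sigma> (\<sigma> x) = x) \<Longrightarrow> card (orbit \<sigma> x) \<le> 2" by (rule two)
  have "(card (orbit \<sigma> x) = 1 \<or> card (orbit \<sigma> x) = aut_order \<sigma>) \<and> 0 < aut_order \<sigma>"
  proof (cases "\<sigma> = id")
    case True
    hence "aut_order \<sigma> = 1" by (intro aut_order_eqI) auto
    thus ?thesis using orbit_of_fixed[of \<sigma> x] True by simp
  next
    case False
    show ?thesis
    proof (cases "\<forall>x. \<sigma> (\<sigma> x) = x")
      case True
      have "aut_order \<sigma> = 2"
      proof (rule aut_order_eqI)
        fix s :: nat assume "0 < s" "s < 2"
        thus "\<sigma> ^^ s \<noteq> id" using False by (simp add: less_2_cases_iff)
      qed (use True in \<open>auto simp: numeral_2_eq_2 fun_eq_iff\<close>)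
      moreover have "card (orbit \<sigma> x) = 2" if "\<sigma> x \<noteq> x"
        using orbit_order_2[of \<sigma> x] True that by simp
      ultimately show ?thesis using orbit_of_fixed[of \<sigma> x] by auto
    next
      case not2: False
      hence three: "\<sigma> (\<sigma> (\<sigma> x)) = x" for x using assms by blast
      have "aut_order \<sigma> = 3"
      proof (rule aut_order_eqI)
        fix s :: nat assume "0 < s" "s < 3"
        hence "s = 1 \<or> s = 2" by linarith
        thus "\<sigma> ^^ s \<noteq> id" using False not2 by (auto simp: numeral_2_eq_2 fun_eq_iff)
      qed (use three in \<open>auto simp: numeral_3_eq_3 fun_eq_iff\<close>)
      moreover have "card (orbit \<sigma> x) = 3" if "\<sigma> x \<noteq> x"
      proof -
        have "\<sigma> (\<sigma> x) \<noteq> x" "\<sigma> (\<sigma> x) \<noteq> \<sigma> x" using that three by metis+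
        thus ?thesis using orbit_order_3[of \<sigma> x, OF three] that by auto
      qed
      ultimately show ?thesis using orbit_of_fixed[of \<sigma> x] by auto
    qed
  qed
  thus "card (orbit \<sigma> x) = 1 \<or> card (orbit \<sigma> x) = aut_order \<sigma>" "0 < aut_order \<sigma>" by blast+
qed

lemma admissible_folding:
  assumes S: "admissible_structure adj \<sigma>" and adm: "admissible_automorphism adj \<sigma>"
    and "parity_function adj \<sigma> \<epsilon>"
  shows "folding adj \<sigma> \<epsilon> (aut_order \<sigma>)"
proof
  have sym: "adj x y \<Longrightarrow> adj y x" and irr: "\<not> adj x x" for x y
    using S by (auto simp: admissible_structure_def)
  have ord: "(\<forall>x. \<sigma> (\<sigma> x) = x) \<or> (\<forall>x. \<sigma> (\<sigma> (\<sigma> x)) = x)"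
    using S by (auto simp: admissible_structure_def)
  have \<sigma>: "bij \<sigma>" "adj (\<sigma> x) (\<sigma> y) \<longleftrightarrow> adj x y" "\<not> adj x (\<sigma> x)" for x y
    using adm by (auto simp: admissible_automorphism_def)
  have perm: "permutation \<sigma>" using \<sigma>(1) by (simp add: permutation)
  show "adj x y \<Longrightarrow> adj y x" for x y by (rule sym)
  show "bij \<sigma>" by (rule \<sigma>(1))
  show "adj (\<sigma> x) (\<sigma> y) \<longleftrightarrow> adj x y" for x y by (rule \<sigma>(2))
  show "card (orbit \<sigma> x) = 1 \<or> card (orbit \<sigma> x) = aut_order \<sigma>" for x
    by (rule aut_order_cases(1)[OF ord])
  show "parity_function adj \<sigma> \<epsilon>" by fact
  have orbit_cases: "y = x \<or> y = \<sigma> x \<or> y = \<sigma> (\<sigma> x) \<and> \<sigma> (\<sigma> (\<sigma> x)) = x" if "orbit \<sigma> x = orbit \<sigma> y" for x y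
  proof -
    have "y \<in> orbit \<sigma> x" using permutation_self_in_orbit[OF perm, of y] that by simp
    thus ?thesis using ord orbit_order_2[of \<sigma> x] orbit_order_3[of \<sigma> x] by auto
  qed
  show "orbit \<sigma> x \<noteq> orbit \<sigma> y" if "adj x y" for x y
  proof
    assume "orbit \<sigma> x = orbit \<sigma> y"
    from orbit_cases[OF this] consider "y = x" | "y = \<sigma> x" | "y = \<sigma> (\<sigma> x)" "\<sigma> (\<sigma> (\<sigma> x)) = x" by blast
    thus False
    proof cases
      case 3
      have "adj (\<sigma> x) (\<sigma> (\<sigma> (\<sigma> x)))" using that 3(1) \<sigma>(2) by simp
      thus False using 3(2) sym \<sigma>(3) by metis
    qed (use that irr \<sigma>(3) in auto)
  qed
  fix x y z
  assume a: "adj x y" "adj x z" "orbit \<sigma> y = orbit \<sigma> z" "card (orbit \<sigma> x) = card (orbit \<sigma> y)"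
  show "y = z"
  proof (rule ccontr)
    assume "y \<noteq> z"
    have \<sigma>y: "\<sigma> y \<noteq> y" using orbit_cases[OF a(3)] \<open>y \<noteq> z\<close> by auto
    have self: "w \<in> orbit \<sigma> w" for w by (rule permutation_self_in_orbit[OF perm])
    have "card (orbit \<sigma> y) \<noteq> 1"
    proof
      assume "card (orbit \<sigma> y) = 1"
      then obtain b where "orbit \<sigma> y = {b}" by (rule card_1_singletonE)
      hence "\<sigma> y = y" using self[of y] orbit.base[of \<sigma> y] by auto
      thus False using \<sigma>y by simp
    qed
    hence \<sigma>x: "\<sigma> x \<noteq> x" using a(4) orbit_of_fixed[of \<sigma> x] by auto
    \<comment> \<open>The power of \<sigma> that takes \<open>z\<close> to \<open>y\<close> turns
      the edge between \<open>x\<close> and \<open>z\<close> into a second edge at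
      \<open>y\<close>.\<close>
    have "\<exists>x'. x' \<in> orbit \<sigma> x \<and> x' \<noteq> x \<and> adj y x'"
    proof (cases "\<forall>w. \<sigma> (\<sigma> w) = w")
      case True
      hence "z = \<sigma> y" using orbit_cases[OF a(3)] \<open>y \<noteq> z\<close> by auto
      hence "adj (\<sigma> x) (\<sigma> (\<sigma> y))" using a(2) \<sigma>(2) by simp
      thus ?thesis using True sym \<sigma>x orbit.base[of \<sigma> x] by metis
    next
      case False
      hence three: "\<sigma> (\<sigma> (\<sigma> w)) = w" for w using ord by blast
      consider "z = \<sigma> y" | "z = \<sigma> (\<sigma> y)" using orbit_cases[OF a(3)] \<open>y \<noteq> z\<close> by auto
      thus ?thesis
      proof cases
        case 1
        hence "adj (\<sigma> (\<sigma> x)) (\<sigma> (\<sigma> (\<sigma> y)))" using a(2) \<sigma>(2) by simp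
        moreover have "\<sigma> (\<sigma> x) \<noteq> x" using three \<sigma>x by metis
        moreover have "\<sigma> (\<sigma> x) \<in> orbit \<sigma> x" by (intro orbit.intros)
        ultimately show ?thesis using three sym by metis
      next
        case 2
        hence "adj (\<sigma> x) (\<sigma> (\<sigma> (\<sigma> y)))" using a(2) \<sigma>(2) by simp
        thus ?thesis using three sym \<sigma>x orbit.base[of \<sigma> x] by metis
      qed
    qed
    then obtain x' where x': "x' \<in> orbit \<sigma> x" "x' \<noteq> x" "adj y x'" by blast
    obtain h :: "'a \<Rightarrow> rat" where h: "\<And>x. 0 < h x" "\<And>x. (\<Sum>y | adj x y. h y) < 2 * h x"
      using S by (auto simp: admissible_structure_def)
    have adjf: "adj ((\<sigma> ^^ l) u) ((\<sigma> ^^ l) v) \<longleftrightarrow> adj u v" for l u v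
      by (induction l) (auto simp: \<sigma>(2))
    have injf: "(\<sigma> ^^ l) u \<noteq> (\<sigma> ^^ l) v" if "u \<noteq> v" for l u v
      using that bij_is_inj[OF bij_fn[OF \<sigma>(1)]] by (metis injD)
    have mem: "(\<sigma> ^^ l) u \<in> orbit \<sigma> v" if "u \<in> orbit \<sigma> v" for l u v
      using that by (rule funpow_in_orbit)
    show False
    \<comment> \<open>Translating by \<sigma> gives every vertex of the two orbits two neighbours
      among them, which \<open>h\<close> forbids.\<close>
    proof (rule no_two_neighbours[OF h, of "orbit \<sigma> x \<union> orbit \<sigma> y"])
      fix w assume "w \<in> orbit \<sigma> x \<union> orbit \<sigma> y"
      then consider l where "w = (\<sigma> ^^ l) x" | l where "w = (\<sigma> ^^ l) y"
        by (auto simp: orbit_altdef)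
      thus "\<exists>u v. u \<in> orbit \<sigma> x \<union> orbit \<sigma> y \<and> v \<in> orbit \<sigma> x \<union> orbit \<sigma> y \<and> u \<noteq> v \<and> adj w u \<and> adj w v"
      proof cases
        case (1 l)
        thus ?thesis
          using adjf injf[OF \<open>y \<noteq> z\<close>] mem[OF self] a(1-3)
          by (intro exI[of _ "(\<sigma> ^^ l) y"] exI[of _ "(\<sigma> ^^ l) z"]) auto
      next
        case (2 l)
        thus ?thesis
          using adjf injf[OF x'(2)] mem[OF self] mem[OF x'(1)] a(1) sym x'(3)
          by (intro exI[of _ "(\<sigma> ^^ l) x'"] exI[of _ "(\<sigma> ^^ l) x"]) auto
      qed
    qed (use self in auto)
  qed
qed

lemma admissible_q_datum:
  assumes S: "admissible_structure adj \<sigma>" and adm: "admissible_automorphism adj \<sigma>"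
    and "parity_function adj \<sigma> \<epsilon>" "height_function adj \<sigma> \<epsilon> \<xi>"
  shows "q_datum adj \<sigma> \<epsilon> (aut_order \<sigma>) \<xi>"
proof -
  interpret folding adj \<sigma> \<epsilon> "aut_order \<sigma>" by (rule admissible_folding[OF S adm assms(3)])
  have ord: "(\<forall>x. \<sigma> (\<sigma> x) = x) \<or> (\<forall>x. \<sigma> (\<sigma> (\<sigma> x)) = x)"
    using S by (auto simp: admissible_structure_def)
  show ?thesis
  proof
    show "height_function adj \<sigma> \<epsilon> \<xi>" by fact
    show "card (orbit \<sigma> x) \<le> aut_order \<sigma>" for x
      using aut_order_cases(1)[OF ord, of x] aut_order_cases(3)[OF ord] by linarith
    show "\<exists>z. adj x z" if "card (orbit \<sigma> x) \<noteq> 1" for x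
      using that fixed_iff[of x] S by (auto simp: admissible_structure_def)
    show "card (orbit \<sigma> x) \<le> 2 \<or> (\<exists>z. adj x z \<and> card (orbit \<sigma> z) = 1)" for x
    proof (cases "\<forall>x. \<sigma> (\<sigma> x) = x")
      case True
      thus ?thesis using aut_order_cases(2)[OF ord] by blast
    next
      case False
      hence "\<sigma> x \<noteq> x \<longrightarrow> (\<exists>z. adj x z \<and> \<sigma> z = z)"
        using S unfolding admissible_structure_def by blast
      thus ?thesis using fixed_iff by (metis one_le_numeral)
    qed
  qed
qed

lemma additive_int_funpow:
  assumes "additive f" "bij f" shows "additive (int_funpow f k)"
proof -
  have "additive (g ^^ n)" if "additive g" for g :: "'a::ab_group_add \<Rightarrow> 'a" and n
  proof (induction n)
    case (Suc n)
    show ?case using additive_comp[OF that Suc.IH] by (simp add: comp_def)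
  qed (simp add: additive_def)
  thus ?thesis using assms additive_inv[OF assms] unfolding int_funpow_def by auto
qed

theorem theorem3p8:
  fixes adj :: "'v::finite \<Rightarrow> 'v \<Rightarrow> bool"
    and \<sigma> :: "'v \<Rightarrow> 'v"
    and \<epsilon> \<xi> :: "'v \<Rightarrow> int"
    and i j :: "'v set"
    and x y :: 'v
    and u :: int
  assumes "ADE_diagram adj"
    and "admissible_automorphism adj \<sigma>"
    and "parity_function adj \<sigma> \<epsilon>"
    and "height_function adj \<sigma> \<epsilon> \<xi>"
    and "i \<in> orbits \<sigma>" and "j \<in> orbits \<sigma>"
    and "x \<in> i" and "y \<in> j"
    and "0 \<le> u"
  shows "c_tilde adj \<sigma> i j u =
    (if even (u + \<xi> y - \<xi> x - int (card i))
     then weight_form adj (fund_weight x)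
       (int_funpow (twisted_coxeter adj \<sigma> \<epsilon> \<xi>) ((u + \<xi> y - \<xi> x - int (card i)) div 2)
         (gamma_weight adj \<sigma> \<epsilon> \<xi> y))
     else 0)"
proof -
  have S: "admissible_structure adj \<sigma>" by (rule ADE_admissible_structure[OF assms(1,2)])
  interpret q_datum adj \<sigma> \<epsilon> "aut_order \<sigma>" \<xi> by (rule admissible_q_datum[OF S assms(2-4)])
  have i: "i = orbit \<sigma> x" and j: "j = orbit \<sigma> y"
    using orbit_eq_if_mem assms(5-8) by blast+
  obtain h :: "'v \<Rightarrow> rat" where h: "\<And>x. 0 < h x" "\<And>x. (\<Sum>y | adj x y. h y) < 2 * h x"
    using S by (auto simp: admissible_structure_def)
  have kernel: "cartan_kernel_trivial adj"
    unfolding cartan_kernel_trivial_def using dominant_weight_kernel[OF h] by blast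
  note form = weight_form_props[OF adj_sym adj_irrefl kernel]
  obtain W where W: "mesh W" "\<And>y. W y (\<xi> y) = fund_weight y"
      "\<And>y p. vert y p \<Longrightarrow> \<tau> (W y p) = W (\<sigma> y) (p - 2)"
    using ex_coxeter_mesh by blast
  \<comment> \<open>Pairing with \<varpi>_x turns the mesh of weights into a mesh of numbers, whose
    values on \<xi> form row x of the inverse Cartan matrix.\<close>
  define A where "A w p = weight_form adj (fund_weight x) (W w p)" for w p
  have mesh_A: "mesh A" unfolding A_def by (rule mesh_additive[OF W(1) form(1)])
  have dual: "2 * A w (\<xi> w) - (\<Sum>z | adj w z. A z (\<xi> z)) = (if w = x then 1 else 0)" for w
    unfolding A_def W(2) by (rule form(2))
  interpret orbit_family adj "orbits \<sigma>"
  proof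
    show "0 < card k" if "k \<in> orbits \<sigma>" for k
      using that card_orbit_pos by (auto simp: orbits_def)
    show "card k = 1" if "k \<in> orbits \<sigma>" "l \<in> orbits \<sigma>" "card k < card l" for k l
    proof -
      obtain a b where "k = orbit \<sigma> a" "l = orbit \<sigma> b" using \<open>k \<in> orbits \<sigma>\<close> \<open>l \<in> orbits \<sigma>\<close>
        by (auto simp: orbits_def)
      thus ?thesis using that(3) card_cases[of a b] by fastforce
    qed
  qed
  obtain N where N: "\<And>j u. u < N \<Longrightarrow> row A x j u = 0" using row_bounded by blast
  have "recursion (row A x) k v = (if i = k \<and> v = 0 then 1 else 0)" if "k \<in> orbits \<sigma>" for k v
    using row_recursion[OF mesh_A that dual, of v] by (auto simp: recursion_def i)
  hence coefficient: "c_tilde adj \<sigma> i j u = row A x (orbit \<sigma> y) u"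
    unfolding c_tilde_def quantum_cartan_inv_def j[symmetric]
    by (intro inverse_coefficients[OF assms(5,6) _ N])
  have "A (int_funpow \<sigma> k y) (\<xi> y - 2 * k) - A (int_funpow \<sigma> k y) (\<xi> y - 2 * (k + d y)) =
      weight_form adj (fund_weight x) (int_funpow \<tau> k (gamma_weight adj \<sigma> \<epsilon> \<xi> y))" for k
  proof -
    have power: "int_funpow \<tau> l (W y p) = W (int_funpow \<sigma> l y) (p - 2 * l)" if "vert y p" for l p
      by (rule coxeter_mesh_power(1)[where W = W, OF W(3) that])
    \<comment> \<open>After as many steps as the orbit has elements \<sigma> is back at
      \<open>y\<close>, and the level has dropped by one period. So the weight \<gamma> of
      \<open>y\<close> is the first difference of \<open>W\<close> at \<xi>.\<close>
    have "(\<tau> ^^ card (orbit \<sigma> y)) (fund_weight y) = W y (\<xi> y - 2 * d y)"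
      using power[OF vert_\<xi>, of "d y"] by (simp add: int_funpow_def W(2) funpow_card_orbit)
    hence "gamma_weight adj \<sigma> \<epsilon> \<xi> y = W y (\<xi> y) - W y (\<xi> y - 2 * d y)"
      by (simp add: gamma_weight_def W(2))
    hence "int_funpow \<tau> k (gamma_weight adj \<sigma> \<epsilon> \<xi> y) =
        W (int_funpow \<sigma> k y) (\<xi> y - 2 * k) - W (int_funpow \<sigma> k y) (\<xi> y - 2 * d y - 2 * k)"
      using vert_\<xi> by (simp add: additive.diff[OF additive_int_funpow[OF additive_\<tau> bij_\<tau>]] power)
    also have "\<xi> y - 2 * d y - 2 * k = \<xi> y - 2 * (k + d y)" by simp
    finally show ?thesis by (simp add: A_def additive.diff[OF form(1)])
  qed
  thus ?thesis unfolding coefficient unfolding row_eq[OF mesh_A assms(9) dual] Let_def i by (simp only:)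
qed

end
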